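(* Assume $\mathrm{Sol}(\widehat{KV})$ is nonempty. Then the group $\widehat{KV}_2$ acts on $\mathrm{Sol}(\widehat{KV})$ by right multiplication $F\mapsto Fg$, and this action is free and transitive.
   Context: $k$ is a field of characteristic zero; $\mathfrak{lie}_n$, $\mathrm{Ass}_n$ are the degree completions of the free Lie and free associative algebras over $k$ on $x_1,\dots,x_n$ ($x,y$ for $n=2$); $a=a_0+\sum_k(\partial_ka)x_k$ is the unique decomposition in $\mathrm{Ass}_n$. $\mathfrak{tr}_n=\mathrm{Ass}_n^+/\langle ab-ba\rangle$ with projection $\mathrm{Tr}$; for $f\in xk[[x]]$, $\mathrm{Tr}(f(x))=\sum f_m\mathrm{Tr}(x^m)$. $\mathrm{ch}(x,y)=\ln(e^xe^y)$. $\mathfrak{tder}_2$: derivations $u$ of $\mathfrak{lie}_2$ with $u(x)=[x,a]$, $u(y)=[y,b]$, written $u=(a,b)$ (normalized: $a$ has no term $\lambda x$, $b$ no term $\lambda y$); $\mathfrak{sder}_2$: those with $u(x+y)=0$. $\mathrm{div}(u)=\mathrm{Tr}(x\partial_xa+y\partial_yb)$; derivations and automorphisms act on $\mathfrak{tr}_2$ via their action on $\mathrm{Ass}_2$. $\delta:\mathfrak{tr}_1\to\mathfrak{tr}_2$, $\delta g=g(x)-g(x+y)+g(y)$ and $\delta:\mathfrak{tr}_2\to\mathfrak{tr}_3$, $(\delta g)(x,y,z)=g(y,z)-g(x+y,z)+g(x,y+z)-g(x,y)$; $\tilde\delta:\mathfrak{tr}_1\to\mathfrak{tr}_2$, $\tilde\delta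 g=g(x)-g(\mathrm{ch}(x,y))+g(y)$. $\widehat{\mathfrak{kv}}_2=\{u\in\mathfrak{sder}_2:\delta(\mathrm{div}\,u)=0\}$. For $u$ a derivation of positive degree, $\exp(u)=\sum_m u^m/m!$ is an automorphism of $\mathfrak{lie}_2$; $\mathrm{TAut}_2=\exp(\mathfrak{tder}_2)$ and $\widehat{KV}_2=\exp(\widehat{\mathfrak{kv}}_2)$ are groups under composition. $j:\mathrm{TAut}_2\to\mathfrak{tr}_2$ is $j(\exp u)=\sum_{m\ge0}\frac{u^m}{(m+1)!}\cdot\mathrm{div}(u)$ (the unique map with $j(gh)=j(g)+g\cdot j(h)$ and $\frac{d}{ds}j(\exp(su))|_{s=0}=\mathrm{div}(u)$). $\mathrm{Sol}(\widehat{KV})$ is the set of $F\in\mathrm{TAut}_2$ with $F(x+y)=\mathrm{ch}(x,y)$ and $j(F)\in\tilde\delta(\mathfrak{tr}_1)$. *)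

theory Defs
  imports Main
begin

text \<open>A series in the letters 0,1,2,... is its coefficient function on words.
  Letter 0 is x, letter 1 is y, letter 2 is z.  Ass_n consists of the series supported
  on words over the letters below n.\<close>

type_synonym 'k ser = "nat list \<Rightarrow> 'k"

definition szero :: "'k::field_char_0 ser" where "szero = (\<lambda>w. 0)"
definition sone :: "'k::field_char_0 ser" where "sone = (\<lambda>w. if w = [] then 1 else 0)"
definition svar :: "nat \<Rightarrow> 'k::field_char_0 ser" where "svar i = (\<lambda>w. if w = [i] then 1 else 0)"
definition sword :: "nat list \<Rightarrow> 'k::field_char_0 ser" where "sword u = (\<lambda>w. if w = u then 1 else 0)"
definition sadd :: "'k::field_char_0 ser \<Rightarrow> 'k ser \<Rightarrow> 'k ser" where "sadd f g = (\<lambda>w. f w + g w)"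
definition ssub :: "'k::field_char_0 ser \<Rightarrow> 'k ser \<Rightarrow> 'k ser" where "ssub f g = (\<lambda>w. f w - g w)"
definition sscale :: "'k::field_char_0 \<Rightarrow> 'k ser \<Rightarrow> 'k ser" where "sscale c f = (\<lambda>w. c * f w)"

definition smul :: "'k::field_char_0 ser \<Rightarrow> 'k ser \<Rightarrow> 'k ser" where
  "smul f g = (\<lambda>w. \<Sum>k\<in>{0..length w}. f (take k w) * g (drop k w))"

definition sbr :: "'k::field_char_0 ser \<Rightarrow> 'k ser \<Rightarrow> 'k ser" where
  "sbr f g = ssub (smul f g) (smul g f)"

definition spow :: "'k::field_char_0 ser \<Rightarrow> nat \<Rightarrow> 'k ser" where
  "spow f m = ((smul f) ^^ m) sone"

definition in_alph :: "nat \<Rightarrow> 'k::field_char_0 ser \<Rightarrow> bool" where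
  "in_alph n f \<longleftrightarrow> (\<forall>w. f w \<noteq> 0 \<longrightarrow> set w \<subseteq> {..<n})"

definition spoly :: "nat \<Rightarrow> 'k::field_char_0 ser \<Rightarrow> bool" where
  "spoly n p \<longleftrightarrow> in_alph n p \<and> finite {w. p w \<noteq> 0}"

definition homog :: "nat \<Rightarrow> 'k::field_char_0 ser \<Rightarrow> 'k ser" where
  "homog d f = (\<lambda>w. if length w = d then f w else 0)"

text \<open>Exponential and logarithm of series (the truncation is exact: f without constant
  term resp. h with constant term 1).\<close>
definition sexp :: "'k::field_char_0 ser \<Rightarrow> 'k ser" where
  "sexp f = (\<lambda>w. \<Sum>m\<in>{0..length w}. spow f m w / fact m)"

definition sln :: "'k::field_char_0 ser \<Rightarrow> 'k ser" where
  "sln h = (\<lambda>w. \<Sum>m\<in>{1..length w}. (-1) ^ (m + 1) * spow (ssub h sone) m w / of_nat m)"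

definition ch :: "'k::field_char_0 ser" where
  "ch = sln (smul (sexp (svar 0)) (sexp (svar 1)))"

inductive_set lie_poly :: "nat \<Rightarrow> 'k::field_char_0 ser set" for n where
  lp_zero: "szero \<in> lie_poly n"
| lp_var: "i < n \<Longrightarrow> svar i \<in> lie_poly n"
| lp_add: "p \<in> lie_poly n \<Longrightarrow> q \<in> lie_poly n \<Longrightarrow> sadd p q \<in> lie_poly n"
| lp_scale: "p \<in> lie_poly n \<Longrightarrow> sscale c p \<in> lie_poly n"
| lp_br: "p \<in> lie_poly n \<Longrightarrow> q \<in> lie_poly n \<Longrightarrow> sbr p q \<in> lie_poly n"

text \<open>Degree completion of the free Lie algebra: every homogeneous component is a Lie polynomial.\<close>
definition lie :: "nat \<Rightarrow> 'k::field_char_0 ser set" where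
  "lie n = {f. \<forall>d. homog d f \<in> lie_poly n}"

text \<open>Continuous algebra homomorphism sending letter i to s i (s i without constant term).\<close>
definition ssubst :: "nat \<Rightarrow> (nat \<Rightarrow> 'k::field_char_0 ser) \<Rightarrow> 'k ser \<Rightarrow> 'k ser" where
  "ssubst n s f = (\<lambda>v. \<Sum>w\<in>{w. set w \<subseteq> {..<n} \<and> length w \<le> length v}.
       f w * foldr smul (map s w) sone v)"

text \<open>Continuous derivation sending letter i to s i (s i without constant term).\<close>
definition dword :: "(nat \<Rightarrow> 'k::field_char_0 ser) \<Rightarrow> nat list \<Rightarrow> 'k ser" where
  "dword s w = (\<lambda>v. \<Sum>i<length w.
       smul (smul (sword (take i w)) (s (w ! i))) (sword (drop (Suc i) w)) v)"

definition sder :: "nat \<Rightarrow> (nat \<Rightarrow> 'k::field_char_0 ser) \<Rightarrow> 'k ser \<Rightarrow> 'k ser" where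
  "sder n s f = (\<lambda>v. \<Sum>w\<in>{w. set w \<subseteq> {..<n} \<and> length w \<le> length v}. f w * dword s w v)"

text \<open>u = (a,b): u(x) = [x,a], u(y) = [y,b]; normalized.\<close>
definition tder2 :: "('k::field_char_0 ser \<times> 'k ser) set" where
  "tder2 = {(a, b). a \<in> lie 2 \<and> b \<in> lie 2 \<and> a [0] = 0 \<and> b [1] = 0}"

definition tgen :: "'k::field_char_0 ser \<times> 'k ser \<Rightarrow> nat \<Rightarrow> 'k ser" where
  "tgen u = (\<lambda>i. if i = 0 then sbr (svar 0) (fst u) else sbr (svar 1) (snd u))"

definition tact :: "'k::field_char_0 ser \<times> 'k ser \<Rightarrow> 'k ser \<Rightarrow> 'k ser" where
  "tact u = sder 2 (tgen u)"

text \<open>exp(u) = sum u^m/m!; u raises degree by at least one, so the truncation is exact.\<close>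
definition texp :: "'k::field_char_0 ser \<times> 'k ser \<Rightarrow> 'k ser \<Rightarrow> 'k ser" where
  "texp u f = (\<lambda>w. \<Sum>m\<in>{0..length w}. ((tact u) ^^ m) f w / fact m)"

definition sder2 :: "('k::field_char_0 ser \<times> 'k ser) set" where
  "sder2 = {u. u \<in> tder2 \<and> tact u (sadd (svar 0) (svar 1)) = szero}"

inductive_set comm_span :: "nat \<Rightarrow> 'k::field_char_0 ser set" for n where
  cs_zero: "szero \<in> comm_span n"
| cs_comm: "spoly n p \<Longrightarrow> spoly n q \<Longrightarrow> ssub (smul p q) (smul q p) \<in> comm_span n"
| cs_add: "p \<in> comm_span n \<Longrightarrow> q \<in> comm_span n \<Longrightarrow> sadd p q \<in> comm_span n"
| cs_scale: "p \<in> comm_span n \<Longrightarrow> sscale c p \<in> comm_span n"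

text \<open>tr_n = Ass_n^+ / (closure of span of commutators); h represents 0 in tr_n.\<close>
definition tr_zero :: "nat \<Rightarrow> 'k::field_char_0 ser \<Rightarrow> bool" where
  "tr_zero n h \<longleftrightarrow> h [] = 0 \<and> (\<forall>d. homog d h \<in> comm_span n)"

definition tr_eq :: "nat \<Rightarrow> 'k::field_char_0 ser \<Rightarrow> 'k ser \<Rightarrow> bool" where
  "tr_eq n f g \<longleftrightarrow> tr_zero n (ssub f g)"

text \<open>Representatives of tr_1 = x k[[x]].\<close>
definition tr1 :: "'k::field_char_0 ser set" where
  "tr1 = {g. g [] = 0 \<and> in_alph 1 g}"

definition dx :: "'k::field_char_0 ser \<Rightarrow> 'k ser" where "dx a = (\<lambda>w. a (w @ [0]))"
definition dy :: "'k::field_char_0 ser \<Rightarrow> 'k ser" where "dy a = (\<lambda>w. a (w @ [1]))"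

text \<open>div(u) = Tr(x d_x a + y d_y b) (representative).\<close>
definition sdiv :: "'k::field_char_0 ser \<times> 'k ser \<Rightarrow> 'k ser" where
  "sdiv u = sadd (smul (svar 0) (dx (fst u))) (smul (svar 1) (dy (snd u)))"

definition dtilde :: "'k::field_char_0 ser \<Rightarrow> 'k ser" where
  "dtilde g = sadd (ssub (ssubst 1 (\<lambda>_. svar 0) g) (ssubst 1 (\<lambda>_. ch) g)) (ssubst 1 (\<lambda>_. svar 1) g)"

definition delta2 :: "'k::field_char_0 ser \<Rightarrow> 'k ser" where
  "delta2 g = ssub (sadd (ssub
      (ssubst 2 (\<lambda>i. if i = 0 then svar 1 else svar 2) g)
      (ssubst 2 (\<lambda>i. if i = 0 then sadd (svar 0) (svar 1) else svar 2) g))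
      (ssubst 2 (\<lambda>i. if i = 0 then svar 0 else sadd (svar 1) (svar 2)) g))
      (ssubst 2 (\<lambda>i. if i = 0 then svar 0 else svar 1) g)"

definition kv2 :: "('k::field_char_0 ser \<times> 'k ser) set" where
  "kv2 = {u. u \<in> sder2 \<and> tr_zero 3 (delta2 (sdiv u))}"

text \<open>j(exp u) = sum_m u^m/(m+1)! . div(u) (representative in tr_2).\<close>
definition jser :: "'k::field_char_0 ser \<times> 'k ser \<Rightarrow> 'k ser" where
  "jser u = (\<lambda>w. \<Sum>m\<in>{0..length w}. ((tact u) ^^ m) (sdiv u) w / fact (Suc m))"

text \<open>Sol(KV): automorphisms F of lie_2 (given by their action on lie_2) of the form exp(u),
  u in tder_2, with F(x+y) = ch(x,y) and j(F) in the image of delta~.\<close>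
definition Sol :: "('k::field_char_0 ser \<Rightarrow> 'k ser) set" where
  "Sol = {F. \<exists>u \<in> tder2. (\<forall>f \<in> lie 2. F f = texp u f)
             \<and> F (sadd (svar 0) (svar 1)) = ch
             \<and> (\<exists>g \<in> tr1. tr_eq 2 (jser u) (dtilde g))}"

end

theory Submission
  imports Defs "HOL-Computational_Algebra.Formal_Power_Series"
begin

text \<open>Since \<open>ch\<close> is the image of \<open>x + y\<close> under the exponential of a tangential derivation, the existence
  of a solution already makes \<open>ch\<close> a Lie series. Evaluating it at two tangential derivations therefore
  produces a third one, and the Baker-Campbell-Hausdorff identity \<open>exp w = exp u exp v\<close> holds in every
  representation. It is applied to the affine representation \<open>f \<mapsto> u f + f_0 div u\<close>, where \<open>f_0\<close> is the
  constant term: since \<open>div\<close> is a 1-cocycle, this is a representation modulo traces, and its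
  exponential maps \<open>1\<close> to \<open>1 + j(exp u)\<close>, so the cocycle identity for \<open>j\<close> comes out at the same time.
  The theorem then follows from the invariance of \<open>\<delta> g\<close> under derivations killing \<open>x + y\<close>, from
  \<open>F(\<delta> g) = \<delta>~ g\<close>, and from the exactness of the complex of traces in degree two.\<close>

text \<open>Group elements exist only as exponentials of some u, and j is read off from u rather
  than from the automorphism. A product or quotient of exponentials is therefore of no use until a
  generator of it is known, and this is what evaluating \<open>ch\<close> supplies. The passage
  between div u and j(exp u) rests on j(exp u) = phi(u) div u with phi(t) = (e^t - 1)/t. Since
  phi(0) = 1, both phi(u) and its inverse fix, modulo traces, every class that u annihilates, in
  particular \<delta> g for u in \<open>sder2\<close>; so div u and j(exp u) lie in the image of
  \<delta> simultaneously. All infinite sums are finite at each word because the operators involved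
  raise the degree. Equality of traces is tested on the sum over all rotations of a word, which in
  characteristic zero detects precisely the commutators.\<close>

lemma ser_apply [simp]:
  "szero w = 0" "sadd f g w = f w + g w" "ssub f g w = f w - g w" "sscale c f w = c * f w"
  by (simp_all add: szero_def sadd_def ssub_def sscale_def)

lemma sone_apply: "sone w = (if w = [] then 1 else 0)"
  by (simp add: sone_def)

lemma homog_apply: "homog d f w = (if length w = d then f w else 0)"
  by (simp add: homog_def)

subsection \<open>The algebra of series\<close>

lemma smul_Nil [simp]: "smul f g [] = f [] * g []"
  by (simp add: smul_def)

text \<open>One split leaves the whole word to the right factor; in all others the first letter
  belongs to the left factor. This is a recursion on words in which only the left factor changes, so
  inductions generalise over \<open>f\<close>.\<close>

lemma smul_Cons: "smul f g (c # w) = f [] * g (c # w) + smul (\<lambda>v. f (c # v)) g w"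
proof -
  have "smul f g (c # w) = (\<Sum>k\<in>{0..Suc (length w)}. f (take k (c # w)) * g (drop k (c # w)))"
    by (simp add: smul_def)
  also have "\<dots> = f [] * g (c # w) + (\<Sum>k\<in>{0..length w}. f (take (Suc k) (c # w)) * g (drop (Suc k) (c # w)))"
    by (subst sum.atLeast0_atMost_Suc_shift) simp
  finally show ?thesis by (simp add: smul_def)
qed

lemma smul_snoc: "smul f g (w @ [c]) = smul f (\<lambda>v. g (v @ [c])) w + f (w @ [c]) * g []"
proof -
  have "smul f g (w @ [c]) = (\<Sum>k\<in>{0..Suc (length w)}. f (take k (w @ [c])) * g (drop k (w @ [c])))"
    by (simp add: smul_def)
  also have "\<dots> = (\<Sum>k\<in>{0..length w}. f (take k (w @ [c])) * g (drop k (w @ [c]))) + f (w @ [c]) * g []"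
    by (subst sum.atLeast0_atMost_Suc) simp
  finally show ?thesis by (simp add: smul_def)
qed

lemma smul_sadd_left: "smul (sadd f g) h = sadd (smul f h) (smul g h)"
  by (rule ext) (simp add: smul_def sum.distrib algebra_simps)

lemma smul_sadd_right: "smul h (sadd f g) = sadd (smul h f) (smul h g)"
  by (rule ext) (simp add: smul_def sum.distrib algebra_simps)

lemma smul_ssub_left: "smul (ssub f g) h = ssub (smul f h) (smul g h)"
  by (rule ext) (simp add: smul_def sum_subtractf algebra_simps)

lemma smul_ssub_right: "smul h (ssub f g) = ssub (smul h f) (smul h g)"
  by (rule ext) (simp add: smul_def sum_subtractf algebra_simps)

lemma smul_sscale_left: "smul (sscale c f) h = sscale c (smul f h)"
  by (rule ext) (simp add: smul_def sum_distrib_left algebra_simps)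

lemma smul_sscale_right: "smul h (sscale c f) = sscale c (smul h f)"
  by (rule ext) (simp add: smul_def sum_distrib_left algebra_simps)

lemmas smul_distribs = smul_sadd_left smul_sadd_right smul_ssub_left smul_ssub_right
  smul_sscale_left smul_sscale_right

lemma smul_szero [simp]: "smul szero f = szero" "smul f szero = szero"
  by (rule ext, simp add: smul_def)+

lemma smul_sone_left [simp]: "smul sone f = f"
proof
  fix w show "smul sone f w = f w"
  proof (cases w)
    case (Cons c v)
    have "(\<lambda>v. sone (c # v)) = szero" by (rule ext) (simp add: sone_def)
    then have "smul (\<lambda>v. sone (c # v)) f v = smul szero f v" by (rule arg_cong[where f="\<lambda>g. smul g f v"])
    then have "smul (\<lambda>v. sone (c # v)) f v = 0" by (simp only: smul_szero ser_apply)
    then show ?thesis by (simp add: Cons smul_Cons sone_apply)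
  qed (simp add: sone_apply)
qed

lemma smul_sone_right [simp]: "smul f sone = f"
proof
  fix w show "smul f sone w = f w"
    by (induction w arbitrary: f) (simp_all add: smul_Cons sone_apply)
qed

lemma smul_assoc: "smul (smul f g) h = smul f (smul g h)"
proof
  fix w show "smul (smul f g) h w = smul f (smul g h) w"
  proof (induction w arbitrary: f)
    case (Cons c w)
    have "(\<lambda>v. smul f g (c # v)) = sadd (sscale (f []) (\<lambda>v. g (c # v))) (smul (\<lambda>v. f (c # v)) g)"
      by (rule ext) (simp add: smul_Cons)
    then show ?case
      by (simp add: smul_Cons smul_distribs Cons.IH algebra_simps)
  qed simp
qed

lemma sword_Nil: "sword [] = sone"
  by (simp add: sword_def sone_def)

lemma sword_append: "(sword (u @ w) :: 'k::field_char_0 ser) = smul (sword u) (sword w)"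
proof
  fix v show "(sword (u @ w) v :: 'k) = smul (sword u) (sword w) v"
  proof (induction u arbitrary: v)
    case Nil
    show ?case by (simp add: sword_Nil)
  next
    case (Cons c u)
    have z: "(\<lambda>v. sword (c # u) (d # v)) = (if d = c then sword u else szero)" for d
      by (rule ext) (auto simp: sword_def)
    have z0: "sword (c # u) [] = 0" by (simp add: sword_def)
    show ?case
    proof (cases v)
      case Nil then show ?thesis by (simp add: sword_def)
    next
      case (Cons d v')
      have "(sword ((c # u) @ w) v :: 'k) = (if d = c then sword (u @ w) v' else 0)"
        by (auto simp: sword_def Cons)
      also have "\<dots> = smul (sword (c # u)) (sword w) (d # v')"
        by (simp add: smul_Cons z z0 Cons.IH)
      finally show ?thesis by (simp add: Cons)
    qed
  qed
qed

lemma sword_single: "sword [i] = svar i"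
  by (simp add: sword_def svar_def)

lemma sword_Cons: "sword (c # w) = smul (svar c) (sword w)"
  using sword_append[of "[c]" w] by (simp add: sword_single)

subsection \<open>Order, continuity and raising operators\<close>

text \<open>The degree filtration stands in for the topology of the completed algebra; limits below
  are expressed through it.\<close>

definition ord :: "nat \<Rightarrow> 'k::field_char_0 ser \<Rightarrow> bool" where
  "ord n f \<longleftrightarrow> (\<forall>w. length w < n \<longrightarrow> f w = 0)"

definition slin :: "('k::field_char_0 ser \<Rightarrow> 'k ser) \<Rightarrow> bool" where
  "slin L \<longleftrightarrow> (\<forall>f g. L (sadd f g) = sadd (L f) (L g)) \<and> (\<forall>c f. L (sscale c f) = sscale c (L f))"

text \<open>Preserving every step of the filtration is stronger than continuity: the value at a word
  depends only on the coefficients at words that are no longer, so infinite sums become finite ones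
  at that word.\<close>

definition cont :: "('k::field_char_0 ser \<Rightarrow> 'k ser) \<Rightarrow> bool" where
  "cont L \<longleftrightarrow> slin L \<and> (\<forall>n f. ord n f \<longrightarrow> ord n (L f))"

text \<open>Operators of positive degree: the m-th power vanishes at words shorter than m, so a
  power series in such operators is a finite sum at each word.\<close>

definition raising :: "('k::field_char_0 ser \<Rightarrow> 'k ser) \<Rightarrow> bool" where
  "raising L \<longleftrightarrow> slin L \<and> (\<forall>n f. ord n f \<longrightarrow> ord (Suc n) (L f))"

lemma ordD: "ord n f \<Longrightarrow> length w < n \<Longrightarrow> f w = 0"
  by (simp add: ord_def)

lemma ord_0 [simp]: "ord 0 f"
  by (simp add: ord_def)

lemma ord_1_iff: "ord (Suc 0) f \<longleftrightarrow> f [] = 0"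
  by (simp add: ord_def)

lemma ord_mono: "ord n f \<Longrightarrow> m \<le> n \<Longrightarrow> ord m f"
  by (auto simp: ord_def)

lemma ord_smul: assumes "ord m f" "ord n g" shows "ord (m + n) (smul f g)"
  unfolding ord_def smul_def
proof (intro allI impI sum.neutral ballI)
  fix w :: "nat list" and k assume "length w < m + n" "k \<in> {0..length w}"
  then have "length (take k w) < m \<or> length (drop k w) < n" by auto
  then show "f (take k w) * g (drop k w) = 0" using assms by (auto simp: ord_def)
qed

lemma raising_cont: "raising L \<Longrightarrow> cont L"
  unfolding raising_def cont_def using ord_mono Suc_leD order_refl by blast

lemma cont_slin: "cont L \<Longrightarrow> slin L"
  by (simp add: cont_def)

lemma slinD:
  assumes "slin L"
  shows "L (sadd f g) = sadd (L f) (L g)" "L (sscale c f) = sscale c (L f)"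
    "L szero = szero" "L (ssub f g) = ssub (L f) (L g)"
proof -
  show a: "L (sadd f g) = sadd (L f) (L g)" for f g using assms by (simp add: slin_def)
  show s: "L (sscale c f) = sscale c (L f)" for c f using assms by (simp add: slin_def)
  have "szero = sscale 0 szero" by (rule ext) simp
  then have "L szero = sscale 0 (L szero)" using s by metis
  then show "L szero = szero" by (simp add: szero_def sscale_def)
  have "ssub f g = sadd f (sscale (-1) g)" by (rule ext) simp
  then have "L (ssub f g) = sadd (L f) (sscale (-1) (L g))" using s a by metis
  then show "L (ssub f g) = ssub (L f) (L g)" by (auto simp: fun_eq_iff)
qed

lemma slin_sum:
  assumes "slin L"
  shows "L (\<lambda>v. \<Sum>i\<in>I. c i * F i v) = (\<lambda>v. \<Sum>i\<in>I. c i * L (F i) v)"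
proof (induction I rule: infinite_finite_induct)
  case (insert i I)
  have "(\<lambda>v. \<Sum>i\<in>insert i I. c i * F i v) = sadd (sscale (c i) (F i)) (\<lambda>v. \<Sum>i\<in>I. c i * F i v)"
    using insert by (auto simp: fun_eq_iff)
  then have "L (\<lambda>v. \<Sum>i\<in>insert i I. c i * F i v)
      = sadd (sscale (c i) (L (F i))) (L (\<lambda>v. \<Sum>i\<in>I. c i * F i v))"
    by (simp only: slinD[OF assms])
  then show ?case using insert by (simp add: fun_eq_iff)
qed (use slinD(3)[OF assms] in \<open>simp_all add: szero_def\<close>)

lemma cont_agree:
  assumes "cont L" "\<And>w. length w \<le> length v \<Longrightarrow> f w = g w"
  shows "L f v = L g v"
proof -
  have "ord (Suc (length v)) (ssub f g)" using assms by (auto simp: ord_def)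
  then have "ord (Suc (length v)) (L (ssub f g))" using assms by (auto simp: cont_def)
  then have "ssub (L f) (L g) v = 0"
    using slinD(4)[OF cont_slin[OF assms(1)]] by (auto simp: ord_def)
  then show ?thesis by simp
qed

lemma raising_Nil: "raising A \<Longrightarrow> A f [] = 0"
  using ord_0[of f] by (force simp: raising_def ord_def)

lemma cont_id: "cont (\<lambda>f. f)"
  by (simp add: cont_def slin_def)

lemma cont_comp: "cont K \<Longrightarrow> cont L \<Longrightarrow> cont (\<lambda>f. K (L f))"
  by (simp add: cont_def slin_def)

lemma cont_sadd: "cont K \<Longrightarrow> cont L \<Longrightarrow> cont (\<lambda>f. sadd (K f) (L f))"
  by (auto simp: cont_def slin_def ord_def fun_eq_iff algebra_simps)

lemma cont_ssub: "cont K \<Longrightarrow> cont L \<Longrightarrow> cont (\<lambda>f. ssub (K f) (L f))"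
  by (auto simp: cont_def slin_def ord_def fun_eq_iff algebra_simps)

lemma cont_smul_right: "cont (smul f)"
  unfolding cont_def slin_def using ord_smul[of 0 f] by (auto simp: smul_distribs)

lemma cont_smul_left: "cont (\<lambda>g. smul g f)"
  unfolding cont_def slin_def using ord_smul[of _ _ 0 f] by (auto simp: smul_distribs)

lemma raising_smul: "f [] = 0 \<Longrightarrow> raising (smul f)"
  unfolding raising_def slin_def using ord_smul[of 1 f] by (auto simp: smul_distribs ord_1_iff)

lemma cont_homog: "cont (homog d)"
  by (auto simp: cont_def slin_def ord_def fun_eq_iff homog_apply)

lemma cont_homog_expand:
  assumes "cont L" "length v \<le> N"
  shows "L f v = (\<Sum>d\<in>{0..N}. L (homog d f) v)"
proof -
  have "L f v = L (\<lambda>w. \<Sum>d\<in>{0..N}. 1 * homog d f w) v"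
    by (rule cont_agree[OF assms(1)]) (use assms in \<open>auto simp: homog_apply\<close>)
  also have "\<dots> = (\<Sum>d\<in>{0..N}. 1 * L (homog d f) v)"
    by (simp only: slin_sum[OF cont_slin[OF assms(1)]])
  finally show ?thesis by simp
qed

definition words :: "nat \<Rightarrow> nat \<Rightarrow> nat list set" where
  "words n k = {w. set w \<subseteq> {..<n} \<and> length w \<le> k}"

lemma finite_words [simp]: "finite (words n k)"
  unfolding words_def by (rule finite_lists_length_le) simp

lemma cont_expand:
  assumes "cont L" "in_alph n f" "length v \<le> k"
  shows "L f v = (\<Sum>w\<in>words n k. f w * L (sword w) v)"
proof -
  have "L f v = L (\<lambda>u. \<Sum>w\<in>words n k. f w * sword w u) v"
  proof (rule cont_agree[OF assms(1)])
    fix u :: "nat list" assume "length u \<le> length v"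
    then have u: "u \<in> words n k \<or> f u = 0"
      using assms(2,3) by (auto simp: words_def in_alph_def)
    have "(\<Sum>w\<in>words n k. f w * sword w u) = (\<Sum>w\<in>words n k. if w = u then f u else 0)"
      by (rule sum.cong) (auto simp: sword_def)
    also have "\<dots> = f u" using u by auto
    finally show "f u = (\<Sum>w\<in>words n k. f w * sword w u)" ..
  qed
  then show ?thesis by (simp only: slin_sum[OF cont_slin[OF assms(1)]])
qed

text \<open>Each coefficient of either side is a finite combination of images of words. The Leibniz
  rule, multiplicativity of evaluation and cyclicity of traces are all reduced to words in this
  way.\<close>

lemma cont_eqI:
  assumes "cont K" "cont L" "in_alph n f"
    and "\<And>w. set w \<subseteq> {..<n} \<Longrightarrow> K (sword w) = L (sword w)"
  shows "K f = L f"
proof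
  fix v show "K f v = L f v"
    using assms(4) by (simp add: cont_expand[OF _ assms(3) order_refl] assms(1,2) words_def)
qed

subsection \<open>Supports in an alphabet\<close>

lemma in_alph_szero [simp]: "in_alph n szero" by (simp add: in_alph_def)
lemma in_alph_sone [simp]: "in_alph n sone" by (simp add: in_alph_def sone_def)
lemma in_alph_svar: "i < n \<Longrightarrow> in_alph n (svar i)" by (simp add: in_alph_def svar_def)
lemma in_alph_sword: "set w \<subseteq> {..<n} \<Longrightarrow> in_alph n (sword w)" by (simp add: in_alph_def sword_def)
lemma in_alph_sadd: "in_alph n f \<Longrightarrow> in_alph n g \<Longrightarrow> in_alph n (sadd f g)"
  unfolding in_alph_def by (metis ser_apply(2) add.right_neutral)
lemma in_alph_ssub: "in_alph n f \<Longrightarrow> in_alph n g \<Longrightarrow> in_alph n (ssub f g)"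
  unfolding in_alph_def by (metis ser_apply(3) diff_zero)
lemma in_alph_sscale: "in_alph n f \<Longrightarrow> in_alph n (sscale c f)" by (simp add: in_alph_def)
lemma in_alph_homog: "in_alph n f \<Longrightarrow> in_alph n (homog d f)" by (simp add: in_alph_def homog_apply)

lemma in_alph_smul: assumes "in_alph n f" "in_alph n g" shows "in_alph n (smul f g)"
  unfolding in_alph_def
proof (intro allI impI)
  fix w assume "smul f g w \<noteq> 0"
  then obtain k where "f (take k w) * g (drop k w) \<noteq> 0"
    unfolding smul_def by (meson sum.neutral)
  then have "set (take k w) \<subseteq> {..<n}" "set (drop k w) \<subseteq> {..<n}"
    using assms by (auto simp: in_alph_def)
  then show "set w \<subseteq> {..<n}" by (metis append_take_drop_id set_append Un_least)
qed

lemma in_alph_sbr: "in_alph n f \<Longrightarrow> in_alph n g \<Longrightarrow> in_alph n (sbr f g)"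
  by (simp add: sbr_def in_alph_ssub in_alph_smul)

lemmas in_alph_intros = in_alph_szero in_alph_sone in_alph_svar in_alph_sword in_alph_sadd
  in_alph_ssub in_alph_sscale in_alph_homog in_alph_smul in_alph_sbr

subsection \<open>One-variable functional calculus\<close>

text \<open>The power series F(A) applied to \<open>f\<close>. Exponential and logarithm of series,
  automorphisms and j are all instances, with A a left multiplication or a derivation, so identities
  in k[[t]] transfer to all of them.\<close>

definition fev :: "('k::field_char_0 ser \<Rightarrow> 'k ser) \<Rightarrow> 'k fps \<Rightarrow> 'k ser \<Rightarrow> 'k ser" where
  "fev A F f = (\<lambda>v. \<Sum>m\<in>{0..length v}. fps_nth F m * (A ^^ m) f v)"

lemma ord_funpow: "raising A \<Longrightarrow> ord n f \<Longrightarrow> ord (n + m) ((A ^^ m) f)"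
  by (induction m) (auto simp: raising_def)

lemma funpow_raising_zero: "raising A \<Longrightarrow> length v < m \<Longrightarrow> (A ^^ m) f v = 0"
  using ord_funpow[of A 0 f m] by (simp add: ord_def)

lemma cont_funpow: "cont A \<Longrightarrow> cont (A ^^ m)"
  by (induction m) (auto simp: cont_def slin_def)

lemma fev_extend:
  assumes "raising A" "length v \<le> N"
  shows "fev A F f v = (\<Sum>m\<in>{0..N}. fps_nth F m * (A ^^ m) f v)"
  unfolding fev_def using assms by (intro sum.mono_neutral_left) (auto simp: funpow_raising_zero)

lemma fev_apply:
  assumes "raising A" "cont L" "length v \<le> N"
  shows "L (fev A F f) v = (\<Sum>m\<in>{0..N}. fps_nth F m * L ((A ^^ m) f) v)"
proof -
  have "L (fev A F f) v = L (\<lambda>w. \<Sum>m\<in>{0..N}. fps_nth F m * (A ^^ m) f w) v"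
    by (rule cont_agree[OF assms(2)], rule fev_extend[OF assms(1)]) (use assms in auto)
  then show ?thesis by (simp only: slin_sum[OF cont_slin[OF assms(2)]])
qed

text \<open>Intertwining is asked for only along the iterates of one vector, since multiplicativity
  of evaluations and automorphisms is available only for series in the alphabet.\<close>

lemma fev_comm:
  assumes "raising A" "cont L" "\<And>m. L ((A ^^ m) f) = (B ^^ m) g"
  shows "L (fev A F f) = fev B F g"
  by (rule ext, subst fev_apply[OF assms(1,2) order_refl]) (simp add: assms(3) fev_def)

lemma cont_fev:
  assumes "raising A" shows "cont (fev A F)"
  unfolding cont_def slin_def
proof (intro conjI allI impI)
  note c = slinD[OF cont_slin[OF cont_funpow[OF raising_cont[OF assms]]]]
  show "fev A F (sadd f g) = sadd (fev A F f) (fev A F g)" for f g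
    by (rule ext) (simp add: fev_def c sum.distrib algebra_simps)
  show "fev A F (sscale k f) = sscale k (fev A F f)" for k f
    by (rule ext) (simp add: fev_def c sum_distrib_left algebra_simps)
  show "ord n (fev A F f)" if "ord n f" for n f
    unfolding ord_def fev_def
    using ordD[OF ord_funpow[OF assms that]] by (auto intro!: sum.neutral)
qed

lemma sum_square_triangle:
  fixes H :: "nat \<Rightarrow> nat \<Rightarrow> 'a::comm_monoid_add"
  assumes "\<And>i j. N < i + j \<Longrightarrow> H i j = 0"
  shows "(\<Sum>i\<in>{0..N}. \<Sum>j\<in>{0..N}. H i j) = (\<Sum>k\<in>{0..N}. \<Sum>i\<in>{0..k}. H i (k - i))"
proof -
  have "(\<Sum>i\<in>{0..N}. \<Sum>j\<in>{0..N}. H i j) = (\<Sum>(i,j)\<in>{0..N} \<times> {0..N}. H i j)"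
    by (simp add: sum.cartesian_product)
  also have "\<dots> = (\<Sum>(i,j)\<in>{(i,j). i + j \<le> N}. H i j)"
    using assms by (intro sum.mono_neutral_right) (auto, metis leI)
  also have "\<dots> = (\<Sum>k\<le>N. \<Sum>i\<le>k. H i (k - i))"
    by (rule sum.triangle_reindex_eq)
  finally show ?thesis by (simp add: atLeast0AtMost)
qed

lemma sum_convolution:
  fixes a b c :: "nat \<Rightarrow> 'k::field_char_0"
  assumes "\<And>k. N < k \<Longrightarrow> c k = 0"
  shows "(\<Sum>i\<in>{0..N}. \<Sum>j\<in>{0..N}. a i * (b j * c (i + j)))
    = (\<Sum>k\<in>{0..N}. (\<Sum>i\<in>{0..k}. a i * b (k - i)) * c k)"
  by (subst sum_square_triangle) (simp_all add: assms sum_distrib_right mult.assoc)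

text \<open>The pairs (i, j) with i + j beyond the length of the word contribute nothing, and the
  remaining triangle is summed along i + j = k. Hence k[[t]] acts on series.\<close>

lemma fev_mult:
  assumes "raising A" shows "fev A (F * G) f = fev A F (fev A G f)"
proof
  fix v :: "nat list"
  let ?N = "length v"
  have "fev A F (fev A G f) v = (\<Sum>i\<in>{0..?N}. fps_nth F i * (A ^^ i) (fev A G f) v)"
    by (simp add: fev_def[of A F])
  also have "\<dots> = (\<Sum>i\<in>{0..?N}. \<Sum>j\<in>{0..?N}. fps_nth F i * (fps_nth G j * (A ^^ (i + j)) f v))"
    by (simp add: fev_apply[OF assms cont_funpow[OF raising_cont[OF assms]] order_refl]
        sum_distrib_left funpow_add)
  also have "\<dots> = (\<Sum>k\<in>{0..?N}. (\<Sum>i\<in>{0..k}. fps_nth F i * fps_nth G (k - i)) * (A ^^ k) f v)"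
    by (rule sum_convolution) (simp add: funpow_raising_zero assms)
  also have "\<dots> = fev A (F * G) f v" by (simp add: fev_def fps_mult_nth)
  finally show "fev A (F * G) f v = fev A F (fev A G f) v" ..
qed

lemma fev_1 [simp]: "fev A 1 f = f"
  by (rule ext) (simp add: fev_def if_distrib[of "\<lambda>x. x * _"] cong: if_cong)

lemma fev_X: "raising A \<Longrightarrow> fev A fps_X f = A f"
proof
  fix v assume A: "raising A"
  have "fev A fps_X f v = (\<Sum>m\<in>{0..Suc (length v)}. (if m = 1 then A f v else 0))"
    unfolding fev_extend[OF A le_SucI[OF order_refl]]
    by (intro sum.cong) (auto simp: fps_X_def)
  also have "\<dots> = A f v" by (subst sum.delta) auto
  finally show "fev A fps_X f v = A f v" .
qed

lemma fev_add: "fev A (F + G) f = sadd (fev A F f) (fev A G f)"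
  by (rule ext) (simp add: fev_def sum.distrib algebra_simps)

lemma fev_power: "raising A \<Longrightarrow> fev A (F ^ m) f = (fev A F ^^ m) f"
  by (induction m) (simp_all add: fev_mult)

text \<open>Without constant term, F^m starts in degree m; after the two sums are interchanged, the
  inner one therefore stops at m = k.\<close>

lemma fev_compose:
  assumes "raising A" "fps_nth F 0 = 0"
  shows "fev (fev A F) G f = fev A (G oo F) f"
proof
  fix v
  have z: "fps_nth (F ^ m) k = 0" if "k < m" for m k
    using assms(2) that by (intro startsby_zero_power_prefix[rule_format]) auto
  have "fev (fev A F) G f v = (\<Sum>m\<in>{0..length v}. \<Sum>k\<in>{0..length v}. fps_nth G m * fps_nth (F ^ m) k * (A ^^ k) f v)"
    by (simp add: fev_def[of "fev A F"] flip: fev_power[OF assms(1)])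
      (simp add: fev_def sum_distrib_left mult.assoc)
  also have "\<dots> = (\<Sum>k\<in>{0..length v}. \<Sum>m\<in>{0..length v}. fps_nth G m * fps_nth (F ^ m) k * (A ^^ k) f v)"
    by (rule sum.swap)
  also have "\<dots> = (\<Sum>k\<in>{0..length v}. \<Sum>m\<in>{0..k}. fps_nth G m * fps_nth (F ^ m) k * (A ^^ k) f v)"
    by (intro sum.cong refl sum.mono_neutral_right) (auto simp: z)
  also have "\<dots> = fev A (G oo F) f v"
    by (simp add: fev_def fps_compose_nth sum_distrib_right)
  finally show "fev (fev A F) G f v = fev A (G oo F) f v" .
qed

text \<open>Made for operators that agree only on an invariant class: affine operators and
  derivations coincide on series without constant term, but not at 1.\<close>

lemma fev_cong_on:
  assumes "\<And>f. K f \<Longrightarrow> A f = B f" "\<And>f. K f \<Longrightarrow> K (A f)" "K f"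
  shows "fev A F f = fev B F f"
proof -
  have "(A ^^ m) f = (B ^^ m) f \<and> K ((A ^^ m) f)" for m
    using assms by (induction m) auto
  then show ?thesis by (simp add: fev_def)
qed

lemma in_alph_fev:
  assumes "\<And>f. in_alph n f \<Longrightarrow> in_alph n (A f)" "in_alph n f"
  shows "in_alph n (fev A F f)"
proof -
  have "in_alph n ((A ^^ m) f)" for m using assms by (induction m) auto
  then show ?thesis
    unfolding fev_def in_alph_def
    by (metis (no_types, lifting) mult_zero_right sum.neutral)
qed

section \<open>Exponential and logarithm of series\<close>

lemma sexp_eq: "sexp f = fev (smul f) (fps_exp 1) sone"
  by (simp add: sexp_def fev_def spow_def)

lemma sln_eq: "sln h = fev (smul (ssub h sone)) (fps_ln 1) sone"
proof
  fix w :: "nat list"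
  have "fev (smul (ssub h sone)) (fps_ln 1) sone w
      = (\<Sum>m\<in>{1..length w}. fps_nth (fps_ln 1) m * spow (ssub h sone) m w)"
    unfolding fev_def spow_def by (rule sum.mono_neutral_right) (auto simp: fps_ln_nth)
  also have "\<dots> = sln h w"
    unfolding sln_def
  proof (rule sum.cong)
    fix m assume "m \<in> {1..length w}"
    then obtain k where "m = Suc k" by (cases m) auto
    then show "fps_nth (fps_ln 1) m * spow (ssub h sone) m w = (- 1) ^ (m + 1) * spow (ssub h sone) m w / of_nat m"
      by (simp add: fps_ln_nth)
  qed simp
  finally show "sln h w = fev (smul (ssub h sone)) (fps_ln 1) sone w" ..
qed

text \<open>By associativity, multiplying by a power of t is the same as iterating multiplication by
  t. Thus multiplication by ln h is itself a power series in an operator, and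
  \<open>fev_compose\<close> applies to exp(ln h).\<close>

lemma smul_fev:
  assumes "t [] = 0" shows "smul (fev (smul t) F sone) f = fev (smul t) F f"
proof -
  have "smul ((smul t ^^ m) sone) f = (smul t ^^ m) f" for m
    by (induction m) (simp_all add: smul_assoc)
  then show ?thesis
    using fev_comm[of "smul t" "\<lambda>g. smul g f" sone "smul t" f F] raising_smul[of t] cont_smul_left assms
    by blast
qed

text \<open>The series ln(1 + t) is the compositional inverse of exp - 1, so the constant is split
  off before composing and added back afterwards.\<close>

lemma fps_exp_compose_ln: "fps_exp 1 oo fps_ln 1 = (1 + fps_X :: 'k::field_char_0 fps)"
proof -
  have 1: "(fps_exp 1 - 1) oo fps_inv (fps_exp 1 - 1) = (fps_X :: 'k fps)"
    using fps_inv_fps_exp_compose(2)[of "1::'k"] by simp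
  have 2: "(fps_exp 1 - 1) oo fps_ln 1 = (fps_X :: 'k fps)"
    using fps_ln_fps_exp_inv[of "1::'k"] 1 by simp
  have "(fps_exp 1 oo fps_ln 1) - (1 oo fps_ln 1) = (fps_X :: 'k fps)"
    using 2 fps_compose_sub_distrib[of "fps_exp (1::'k)" 1 "fps_ln 1"] by simp
  then show ?thesis by (simp add: diff_eq_eq add.commute)
qed

lemma sexp_sln: assumes "h [] = 1" shows "sexp (sln h) = h"
proof -
  let ?t = "ssub h sone"
  have t: "?t [] = 0" using assms by (simp add: sone_apply)
  have s: "smul (sln h) = fev (smul ?t) (fps_ln 1)"
    unfolding sln_eq by (rule ext, rule smul_fev) (rule t)
  have r: "raising (smul ?t)" by (rule raising_smul) (rule t)
  have "sexp (sln h) = fev (smul ?t) (1 + fps_X) sone"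
    unfolding sexp_eq s by (simp only: fev_compose[OF r fps_ln_0] fps_exp_compose_ln)
  also have "\<dots> = sadd sone (smul ?t sone)" by (simp only: fev_add fev_1 fev_X[OF r])
  also have "\<dots> = h" by (rule ext) simp
  finally show ?thesis .
qed

subsection \<open>Evaluation at raising operators\<close>

text \<open>A noncommutative power series evaluated at operators: the algebra homomorphism sending
  letter i to \<open>s i\<close>, already applied to \<open>f\<close>. Words longer than
  \<open>v\<close> contribute nothing at \<open>v\<close> when the \<open>s i\<close> are
  raising.\<close>

definition ev :: "nat \<Rightarrow> (nat \<Rightarrow> 'k::field_char_0 ser \<Rightarrow> 'k ser) \<Rightarrow> 'k ser \<Rightarrow> 'k ser \<Rightarrow> 'k ser" where
  "ev n s P f = (\<lambda>v. \<Sum>w\<in>words n (length v). P w * foldr s w f v)"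

lemma ord_foldr:
  assumes "\<And>i. i < n \<Longrightarrow> raising (s i)" "set w \<subseteq> {..<n}" "ord k f"
  shows "ord (k + length w) (foldr s w f)"
  using assms(2)
proof (induction w)
  case (Cons i w)
  then show ?case using assms(1)[of i] by (simp add: raising_def)
qed (simp add: assms(3))

lemma cont_foldr:
  assumes "\<And>i. i < n \<Longrightarrow> raising (s i)" "set w \<subseteq> {..<n}"
  shows "cont (foldr s w)"
  using assms(2)
proof (induction w)
  case (Cons i w)
  then show ?case using assms(1)[of i] cont_comp[of "s i" "foldr s w"] by (simp add: raising_cont comp_def)
qed (simp add: cont_id id_def)

lemma ev_extend:
  assumes "\<And>i. i < n \<Longrightarrow> raising (s i)" "length v \<le> N"
  shows "ev n s P f v = (\<Sum>w\<in>words n N. P w * foldr s w f v)"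
  unfolding ev_def
proof (rule sum.mono_neutral_left)
  show "\<forall>w\<in>words n N - words n (length v). P w * foldr s w f v = 0"
    using ordD[OF ord_foldr[where s=s and n=n and k=0, OF assms(1)]]
    by (force simp: words_def not_le[symmetric])
qed (use assms in \<open>auto simp: words_def[of n "length v"] words_def[of n N] finite_words[unfolded words_def]\<close>)

lemma cont_ev:
  assumes "\<And>i. i < n \<Longrightarrow> raising (s i)" shows "cont (ev n s P)"
  unfolding cont_def slin_def
proof (intro conjI allI impI)
  have c: "foldr s w (sadd f g) = sadd (foldr s w f) (foldr s w g)"
    "foldr s w (sscale k f) = sscale k (foldr s w f)" if "w \<in> words n N" for w N f g k
    using that slinD[OF cont_slin[OF cont_foldr[where s=s and n=n, OF assms]], of w]
    by (auto simp: words_def)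
  show "ev n s P (sadd f g) = sadd (ev n s P f) (ev n s P g)" for f g
    by (rule ext) (simp add: ev_def c sum.distrib algebra_simps)
  show "ev n s P (sscale k f) = sscale k (ev n s P f)" for k f
    by (rule ext) (simp add: ev_def c sum_distrib_left algebra_simps)
  show "ord k (ev n s P f)" if "ord k f" for k f
    unfolding ord_def ev_def
    using ordD[OF ord_foldr[where s=s and n=n, OF assms _ that]] by (auto intro!: sum.neutral simp: words_def)
qed

lemma raising_ev:
  assumes "\<And>i. i < n \<Longrightarrow> raising (s i)" "P [] = 0" shows "raising (ev n s P)"
  unfolding raising_def
proof (intro conjI allI impI)
  show "slin (ev n s P)" by (rule cont_slin[OF cont_ev]) (rule assms)
  show "ord (Suc k) (ev n s P f)" if "ord k f" for k f
    unfolding ord_def ev_def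
  proof (intro allI impI sum.neutral ballI)
    fix v :: "nat list" and w assume v: "length v < Suc k" and w: "w \<in> words n (length v)"
    show "P w * foldr s w f v = 0"
    proof (cases w)
      case Cons
      then show ?thesis using ordD[OF ord_foldr[where s=s and n=n, OF assms(1) _ that], of w v] v w
        by (auto simp: words_def)
    qed (simp add: assms)
  qed
qed

lemma cont_ev_left:
  assumes "\<And>i. i < n \<Longrightarrow> raising (s i)" shows "cont (\<lambda>P. ev n s P f)"
  unfolding cont_def slin_def
proof (intro conjI allI impI)
  show "ev n s (sadd P Q) f = sadd (ev n s P f) (ev n s Q f)" for P Q
    by (rule ext) (simp add: ev_def sum.distrib algebra_simps)
  show "ev n s (sscale k P) f = sscale k (ev n s P f)" for k P
    by (rule ext) (simp add: ev_def sum_distrib_left algebra_simps)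
  show "ord k (ev n s P f)" if "ord k P" for k P
    unfolding ord_def ev_def
    using ordD[OF that] by (auto intro!: sum.neutral simp: words_def)
qed

lemma ev_sword:
  assumes "\<And>i. i < n \<Longrightarrow> raising (s i)" "set w \<subseteq> {..<n}"
  shows "ev n s (sword w) f = foldr s w f"
proof
  fix v
  have "ev n s (sword w) f v = (\<Sum>u\<in>words n (max (length v) (length w)). sword w u * foldr s u f v)"
    by (rule ev_extend) (simp_all add: assms)
  also have "\<dots> = (\<Sum>u\<in>words n (max (length v) (length w)). if u = w then foldr s w f v else 0)"
    by (rule sum.cong) (auto simp: sword_def)
  also have "\<dots> = foldr s w f v" using assms(2) by (simp add: words_def[symmetric]) (simp add: words_def)
  finally show "ev n s (sword w) f v = foldr s w f v" .
qed

lemma ev_svar: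
  assumes "\<And>i. i < n \<Longrightarrow> raising (s i)" "i < n"
  shows "ev n s (svar i) f = s i f"
  using ev_sword[where s=s and n=n and w="[i]", OF assms(1)] assms(2) by (simp add: sword_single)

lemma ev_sone:
  assumes "\<And>i. i < n \<Longrightarrow> raising (s i)"
  shows "ev n s sone f = f"
  using ev_sword[where s=s and n=n and w="[]", OF assms] by (simp add: sword_Nil)

lemma ev_smul:
  assumes s: "\<And>i. i < n \<Longrightarrow> raising (s i)" and PQ: "in_alph n P" "in_alph n Q"
  shows "ev n s (smul P Q) f = ev n s P (ev n s Q f)"
proof (rule cont_eqI[OF _ _ PQ(1), where K = "\<lambda>P. ev n s (smul P Q) f"])
  note cl = cont_ev_left[where s=s and n=n, OF s]
  show "cont (\<lambda>P. ev n s (smul P Q) f)" by (rule cont_comp[OF cl cont_smul_left])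
  show "cont (\<lambda>P. ev n s P (ev n s Q f))" by (rule cl)
  fix w assume w: "set w \<subseteq> {..<n}"
  show "ev n s (smul (sword w) Q) f = ev n s (sword w) (ev n s Q f)"
  proof (rule cont_eqI[OF _ _ PQ(2), where K = "\<lambda>Q. ev n s (smul (sword w) Q) f"])
    show "cont (\<lambda>Q. ev n s (smul (sword w) Q) f)" by (rule cont_comp[OF cl cont_smul_right])
    show "cont (\<lambda>Q. ev n s (sword w) (ev n s Q f))" by (rule cont_comp[OF cont_ev cl]) (rule s)
    fix u assume u: "set u \<subseteq> {..<n}"
    show "ev n s (smul (sword w) (sword u)) f = ev n s (sword w) (ev n s (sword u) f)"
      using w u ev_sword[where s=s and n=n, OF s] by (simp flip: sword_append)
  qed
qed

text \<open>An algebra homomorphism commutes with the functional calculus. This turns e^ch = e^x e^y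
  into an identity between exponentials of operators.\<close>

lemma ev_fev:
  assumes s: "\<And>i. i < n \<Longrightarrow> raising (s i)" and P: "in_alph n P" "P [] = 0"
  shows "ev n s (fev (smul P) F sone) f = fev (ev n s P) F f"
proof -
  have a: "in_alph n ((smul P ^^ m) sone)" for m by (induction m) (simp_all add: in_alph_smul P)
  have "ev n s ((smul P ^^ m) sone) f = (ev n s P ^^ m) f" for m
    by (induction m) (simp_all add: ev_sone[where s=s and n=n, OF s] ev_smul[where s=s and n=n, OF s] P a)
  then show ?thesis
    using fev_comm[of "smul P" "\<lambda>Q. ev n s Q f" sone "ev n s P" f F] raising_smul[of P]
      cont_ev_left[of n s f] s P(2) by blast
qed

subsection \<open>Derivations\<close>

lemma dword_Nil [simp]: "dword s [] = szero"
  by (rule ext) (simp add: dword_def)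

lemma smul_sum_right: "smul f (\<lambda>v. \<Sum>i\<in>I. F i v) w = (\<Sum>i\<in>I. smul f (F i) w)"
proof -
  have "smul f (\<lambda>v. \<Sum>i\<in>I. 1 * F i v) = (\<lambda>w. \<Sum>i\<in>I. 1 * smul f (F i) w)"
    by (rule slin_sum[OF cont_slin[OF cont_smul_right]])
  then show ?thesis by (simp add: fun_eq_iff)
qed

lemma dword_Cons: "dword s (l # w) = sadd (smul (s l) (sword w)) (smul (svar l) (dword s w))"
proof
  fix v
  have "dword s (l # w) v = smul (s l) (sword w) v
     + (\<Sum>i<length w. smul (smul (sword (l # take i w)) (s (w ! i))) (sword (drop (Suc i) w)) v)"
    unfolding dword_def by (simp del: sum.lessThan_Suc add: sum.lessThan_Suc_shift sword_Nil)
  also have "(\<Sum>i<length w. smul (smul (sword (l # take i w)) (s (w ! i))) (sword (drop (Suc i) w)) v)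
     = smul (svar l) (dword s w) v"
    by (simp add: sword_Cons smul_assoc dword_def smul_sum_right)
  finally show "dword s (l # w) v = sadd (smul (s l) (sword w)) (smul (svar l) (dword s w)) v" by simp
qed

lemma dword_append: "dword s (u @ w) = sadd (smul (dword s u) (sword w)) (smul (sword u) (dword s w))"
proof (induction u)
  case Nil
  have "dword s w = sadd (smul szero (sword w)) (smul sone (dword s w))" by (rule ext) simp
  then show ?case by (simp del: ser_apply smul_szero smul_sone_left add: sword_Nil)
next
  case (Cons l u)
  have "dword s ((l # u) @ w) = sadd (smul (s l) (smul (sword u) (sword w)))
      (smul (svar l) (sadd (smul (dword s u) (sword w)) (smul (sword u) (dword s w))))"
    by (simp only: append_Cons dword_Cons Cons.IH sword_append)
  also have "\<dots> = sadd (smul (dword s (l # u)) (sword w)) (smul (sword (l # u)) (dword s w))"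
    by (rule ext) (simp add: dword_Cons sword_Cons smul_distribs smul_assoc)
  finally show ?case .
qed

lemma ord_svar: "ord 1 (svar l)"
  by (auto simp: ord_def svar_def)

lemma ord_sword: "ord (length w) (sword w)"
  by (auto simp: ord_def sword_def)

lemma ord_sadd: "ord n f \<Longrightarrow> ord n g \<Longrightarrow> ord n (sadd f g)"
  by (simp add: ord_def)

lemma ord_ssub: "ord n f \<Longrightarrow> ord n g \<Longrightarrow> ord n (ssub f g)"
  by (simp add: ord_def)

lemma ord_sscale: "ord n f \<Longrightarrow> ord n (sscale c f)"
  by (simp add: ord_def)

lemma ord_dword:
  assumes "\<And>i. i < n \<Longrightarrow> ord (Suc k) (s i)" "set w \<subseteq> {..<n}"
  shows "ord (length w + k) (dword s w)"
  using assms(2)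
proof (induction w)
  case Nil then show ?case by (simp add: ord_def)
next
  case (Cons l w)
  have "ord (Suc k + length w) (smul (s l) (sword w))"
    using Cons.prems by (intro ord_smul assms ord_sword) auto
  moreover have "ord (1 + (length w + k)) (smul (svar l) (dword s w))"
    using Cons by (intro ord_smul ord_svar) auto
  ultimately have "ord (Suc (length w + k)) (sadd (smul (s l) (sword w)) (smul (svar l) (dword s w)))"
    by (intro ord_sadd) (simp_all add: add.commute)
  then show ?case by (simp only: dword_Cons list.size add_Suc_right add_0_right add_Suc)
qed

lemma sder_eq: "sder n s f v = (\<Sum>w\<in>words n (length v). f w * dword s w v)"
  by (simp add: sder_def words_def)

lemma ord_sder:
  assumes "\<And>i. i < n \<Longrightarrow> ord (Suc k) (s i)" "ord m f"
  shows "ord (m + k) (sder n s f)"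
  unfolding ord_def sder_eq
proof (intro allI impI sum.neutral ballI)
  fix v :: "nat list" and w assume "length v < m + k" "w \<in> words n (length v)"
  then show "f w * dword s w v = 0"
    using ordD[OF assms(2), of w] ordD[OF ord_dword[where s=s and n=n and k=k, OF assms(1)], of w v]
    by (cases "length w < m") (auto simp: words_def)
qed

lemma raising_sder:
  assumes "\<And>i. i < n \<Longrightarrow> ord 2 (s i)" shows "raising (sder n s)"
  unfolding raising_def slin_def
proof (intro conjI allI impI)
  show "sder n s (sadd f g) = sadd (sder n s f) (sder n s g)" for f g
    by (rule ext) (simp add: sder_eq sum.distrib algebra_simps)
  show "sder n s (sscale k f) = sscale k (sder n s f)" for k f
    by (rule ext) (simp add: sder_eq sum_distrib_left algebra_simps)
  show "ord (Suc k) (sder n s f)" if "ord k f" for k f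
    using ord_sder[where s=s and n=n and k=1, OF _ that] assms by (simp add: numeral_2_eq_2)
qed

lemma sder_sword:
  assumes "\<And>i. i < n \<Longrightarrow> ord 2 (s i)" "set w \<subseteq> {..<n}"
  shows "sder n s (sword w) = dword s w"
proof
  fix v
  have "sder n s (sword w) v = (\<Sum>u\<in>words n (length v). if u = w then dword s w v else 0)"
    unfolding sder_eq by (rule sum.cong) (auto simp: sword_def)
  also have "\<dots> = dword s w v"
    using ordD[OF ord_dword[where s=s and n=n and k=1, OF assms(1)[folded Suc_1]], of w v] assms(2)
    by (auto simp: words_def[of n "length v"] finite_words[unfolded words_def])
  finally show "sder n s (sword w) v = dword s w v" .
qed

lemma sder_svar:
  assumes "\<And>i. i < n \<Longrightarrow> ord 2 (s i)" "i < n"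
  shows "sder n s (svar i) = s i"
  using sder_sword[where s=s and n=n and w="[i]", OF assms(1)] assms(2)
  by (simp add: sword_single dword_Cons sword_Nil fun_eq_iff)

lemma sder_smul:
  assumes s: "\<And>i. i < n \<Longrightarrow> ord 2 (s i)" and fg: "in_alph n f" "in_alph n g"
  shows "sder n s (smul f g) = sadd (smul (sder n s f) g) (smul f (sder n s g))"
proof -
  have c: "cont (sder n s)" by (rule raising_cont[OF raising_sder]) (rule s)
  show ?thesis
  proof (rule cont_eqI[OF _ _ fg(1), where K = "\<lambda>f. sder n s (smul f g)"])
    show "cont (\<lambda>f. sder n s (smul f g))" by (rule cont_comp[OF c cont_smul_left])
    show "cont (\<lambda>f. sadd (smul (sder n s f) g) (smul f (sder n s g)))"
      by (intro cont_sadd cont_comp[OF cont_smul_left c] cont_smul_left)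
    fix u assume u: "set u \<subseteq> {..<n}"
    show "sder n s (smul (sword u) g) = sadd (smul (sder n s (sword u)) g) (smul (sword u) (sder n s g))"
    proof (rule cont_eqI[OF _ _ fg(2), where K = "\<lambda>g. sder n s (smul (sword u) g)"])
      show "cont (\<lambda>g. sder n s (smul (sword u) g))" by (rule cont_comp[OF c cont_smul_right])
      show "cont (\<lambda>g. sadd (smul (sder n s (sword u)) g) (smul (sword u) (sder n s g)))"
        by (intro cont_sadd cont_comp[OF cont_smul_right c] cont_smul_right)
      fix w assume w: "set w \<subseteq> {..<n}"
      show "sder n s (smul (sword u) (sword w)) =
        sadd (smul (sder n s (sword u)) (sword w)) (smul (sword u) (sder n s (sword w)))"
        using u w by (simp add: sder_sword[where s=s and n=n, OF s] dword_append flip: sword_append)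
    qed
  qed
qed

text \<open>The Leibniz rule for one letter in front of a word is a recursion on words, so it
  already determines \<open>L\<close>. Commutators of derivations are identified by this
  criterion.\<close>

lemma sder_unique:
  assumes s: "\<And>i. i < n \<Longrightarrow> ord 2 (s i)" and L: "cont L" "L sone = szero"
    and step: "\<And>i w. i < n \<Longrightarrow> set w \<subseteq> {..<n} \<Longrightarrow>
      L (smul (svar i) (sword w)) = sadd (smul (s i) (sword w)) (smul (svar i) (L (sword w)))"
    and f: "in_alph n f"
  shows "L f = sder n s f"
proof (rule cont_eqI[OF L(1) _ f])
  show "cont (sder n s)" by (rule raising_cont[OF raising_sder]) (rule s)
  fix w :: "nat list" assume w: "set w \<subseteq> {..<n}"
  then have "L (sword w) = dword s w"
    by (induction w) (simp_all add: sword_Nil L(2) sword_Cons step dword_Cons)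
  then show "L (sword w) = sder n s (sword w)"
    using sder_sword[where s=s and n=n, OF s w] by simp
qed

lemma in_alph_dword:
  assumes "\<And>i. i < n \<Longrightarrow> in_alph n (s i)" "set w \<subseteq> {..<n}"
  shows "in_alph n (dword s w)"
  using assms(2) by (induction w) (auto simp: dword_Cons assms(1) intro!: in_alph_intros)

lemma in_alph_sder:
  assumes "\<And>i. i < n \<Longrightarrow> in_alph n (s i)" shows "in_alph n (sder n s f)"
  unfolding in_alph_def
proof (intro allI impI)
  fix v assume "sder n s f v \<noteq> 0"
  then obtain w where "w \<in> words n (length v)" "f w * dword s w v \<noteq> 0"
    unfolding sder_eq by (meson sum.neutral)
  then show "set v \<subseteq> {..<n}"
    using in_alph_dword[where s=s and n=n, OF assms, of w] by (auto simp: words_def in_alph_def)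
qed

subsection \<open>Lie series\<close>

lemma homog_smul:
  "homog d (smul f g) = (\<lambda>v. \<Sum>i\<in>{0..d}. smul (homog i f) (homog (d - i) g) v)"
proof
  fix v :: "nat list"
  have *: "smul (homog i f) (homog (d - i) g) v
      = (if length v = d then f (take i v) * g (drop i v) else 0)" if "i \<in> {0..d}" for i
  proof -
    have "smul (homog i f) (homog (d - i) g) v = (\<Sum>k\<in>{0..length v}.
        if k = i then (if length v = d then f (take i v) * g (drop i v) else 0) else 0)"
      unfolding smul_def using that by (intro sum.cong) (auto simp: homog_apply)
    then show ?thesis using that by auto
  qed
  show "homog d (smul f g) v = (\<Sum>i\<in>{0..d}. smul (homog i f) (homog (d - i) g) v)"
    by (simp add: * homog_apply smul_def[of f g])
qed

lemma homog_sbr: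
  "homog d (sbr f g) = (\<lambda>v. \<Sum>i\<in>{0..d}. sbr (homog i f) (homog (d - i) g) v)"
proof -
  \<comment> \<open>The two halves of the bracket are indexed by the degrees of different factors;
    the reflection of i to d - i aligns them.\<close>
  have "(\<Sum>i\<in>{0..d}. smul (homog i g) (homog (d - i) f) v)
      = (\<Sum>i\<in>{0..d}. smul (homog (d - i) g) (homog i f) v)" for v
    by (rule sum.reindex_bij_witness[of _ "\<lambda>i. d - i" "\<lambda>i. d - i"]) auto
  moreover have "homog d (sbr f g) = ssub (homog d (smul f g)) (homog d (smul g f))"
    by (simp add: sbr_def slinD[OF cont_slin[OF cont_homog]])
  ultimately show ?thesis
    by (simp add: homog_smul fun_eq_iff sbr_def sum_subtractf)
qed

lemma lie_poly_sum: "(\<And>i. i \<in> I \<Longrightarrow> F i \<in> lie_poly n) \<Longrightarrow> (\<lambda>v. \<Sum>i\<in>I. F i v) \<in> lie_poly n"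
proof (induction I rule: infinite_finite_induct)
  case (insert i I)
  then have "sadd (F i) (\<lambda>v. \<Sum>i\<in>I. F i v) \<in> lie_poly n" by (auto intro: lie_poly.intros)
  then show ?case using insert by (simp add: sadd_def)
qed (use lie_poly.lp_zero in \<open>simp_all add: szero_def\<close>)

lemma in_alph_lie_poly: "p \<in> lie_poly n \<Longrightarrow> in_alph n p"
  by (induction rule: lie_poly.induct) (auto simp del: ser_apply intro: in_alph_intros)

lemma lie_poly_Nil: "p \<in> lie_poly n \<Longrightarrow> p [] = 0"
  by (induction rule: lie_poly.induct) (auto simp: svar_def sbr_def)

lemma lie_poly_homog:
  fixes p :: "'k::field_char_0 ser"
  shows "p \<in> lie_poly n \<Longrightarrow> homog d p \<in> lie_poly n"
proof (induction arbitrary: d rule: lie_poly.induct)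
  case (lp_var i)
  have "(homog d (svar i) :: 'k ser) = (if d = 1 then svar i else szero)"
    by (rule ext) (auto simp: homog_apply svar_def)
  then show ?case using lp_var by (simp add: lie_poly.intros)
next
  case (lp_br p q)
  then show ?case unfolding homog_sbr by (intro lie_poly_sum lie_poly.lp_br)
qed (auto simp: slinD[OF cont_slin[OF cont_homog]] simp del: ser_apply intro: lie_poly.intros)

lemma lie_polyD: "p \<in> lie_poly n \<Longrightarrow> p \<in> lie n"
  by (simp add: lie_def lie_poly_homog)

lemma in_alph_lie: "f \<in> lie n \<Longrightarrow> in_alph n f"
  unfolding in_alph_def
proof (intro allI impI)
  fix w assume "f \<in> lie n" "f w \<noteq> 0"
  then show "set w \<subseteq> {..<n}"
    using in_alph_lie_poly[of "homog (length w) f" n] by (auto simp: lie_def in_alph_def homog_apply)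
qed

lemma lie_Nil: "f \<in> lie n \<Longrightarrow> f [] = 0"
  using lie_poly_Nil[of "homog 0 f" n] by (simp add: lie_def homog_apply)

lemma lie_szero: "szero \<in> lie n"
  by (intro lie_polyD lie_poly.intros)

lemma lie_svar: "i < n \<Longrightarrow> svar i \<in> lie n"
  by (intro lie_polyD lie_poly.intros)

lemma lie_sadd: "f \<in> lie n \<Longrightarrow> g \<in> lie n \<Longrightarrow> sadd f g \<in> lie n"
  by (simp add: lie_def slinD[OF cont_slin[OF cont_homog]] lie_poly.intros)

lemma lie_sscale: "f \<in> lie n \<Longrightarrow> sscale c f \<in> lie n"
  by (simp add: lie_def slinD[OF cont_slin[OF cont_homog]] lie_poly.intros)

lemma lie_ssub: assumes "f \<in> lie n" "g \<in> lie n" shows "ssub f g \<in> lie n"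
proof -
  have "sadd f (sscale (-1) g) = ssub f g" by (rule ext) simp
  then show ?thesis using lie_sadd[OF assms(1) lie_sscale[OF assms(2)]] by metis
qed

lemma lie_sbr: "f \<in> lie n \<Longrightarrow> g \<in> lie n \<Longrightarrow> sbr f g \<in> lie n"
  by (simp add: lie_def homog_sbr lie_poly_sum lie_poly.intros)

text \<open>Degree d of \<open>L f\<close> sees only the components of \<open>f\<close> up to degree
  d, each of which is a Lie polynomial; so membership passes from polynomials to series.\<close>

lemma lie_cont:
  assumes "cont L" "\<And>p. p \<in> lie_poly n \<Longrightarrow> L p \<in> lie n" "f \<in> lie n"
  shows "L f \<in> lie n"
  unfolding lie_def
proof (intro CollectI allI)
  fix d
  have "homog d (L f) = (\<lambda>v. \<Sum>e\<in>{0..d}. homog d (L (homog e f)) v)"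
    by (rule ext) (use cont_homog_expand[OF assms(1)] in \<open>auto simp: homog_apply\<close>)
  also have "\<dots> \<in> lie_poly n"
    using assms(2,3) by (intro lie_poly_sum) (auto simp: lie_def)
  finally show "homog d (L f) \<in> lie_poly n" .
qed

lemma lie_fev:
  assumes "raising A" "\<And>f. f \<in> lie n \<Longrightarrow> A f \<in> lie n" "f \<in> lie n"
  shows "fev A F f \<in> lie n"
  unfolding lie_def
proof (intro CollectI allI)
  fix d
  have m: "(A ^^ m) f \<in> lie n" for m using assms(2,3) by (induction m) auto
  have "homog d (fev A F f) = (\<lambda>v. \<Sum>m\<in>{0..d}. sscale (fps_nth F m) (homog d ((A ^^ m) f)) v)"
    by (rule ext) (auto simp: homog_apply fev_def)
  also have "\<dots> \<in> lie_poly n"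
    using m by (intro lie_poly_sum lie_poly.lp_scale) (auto simp: lie_def)
  finally show "homog d (fev A F f) \<in> lie_poly n" .
qed

subsection \<open>Cyclic words\<close>

text \<open>Cyclic symmetrisation without the factor 1/length. It is a concrete model of the
  projection to tr_n: among series in the alphabet without constant term, its kernel is the closed
  span of the commutators.\<close>

definition csum :: "'k::field_char_0 ser \<Rightarrow> 'k ser" where
  "csum h = (\<lambda>w. \<Sum>k<length w. h (rotate k w))"

lemma cont_csum: "cont (csum :: 'a::field_char_0 ser \<Rightarrow> 'a ser)"
  unfolding cont_def slin_def
proof (intro conjI allI impI)
  show "csum (sadd f g) = sadd (csum f) (csum g)" for f g :: "'a ser"
    by (rule ext) (simp add: csum_def sum.distrib)
  show "csum (sscale k f) = sscale k (csum f)" for k and f :: "'a ser"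
    by (rule ext) (simp add: csum_def sum_distrib_left)
  show "ord n (csum f)" if "ord n f" for n and f :: "'a ser"
    using that by (simp add: ord_def csum_def)
qed

lemmas csum_linear = slinD[OF cont_slin[OF cont_csum]]

lemma csum_rotate1: "csum h (rotate1 w) = csum h w"
proof (cases w)
  case (Cons c v)
  let ?n = "length v"
  have "csum h (rotate1 w) = (\<Sum>k<Suc ?n. h (rotate (Suc k) w))"
    by (simp add: csum_def Cons rotate1_rotate_swap del: rotate1.simps rotate_Suc sum.lessThan_Suc)
      (simp add: rotate1_rotate_swap)
  also have "\<dots> = (\<Sum>k<?n. h (rotate (Suc k) w)) + h (rotate (length w) w)"
    by (simp add: Cons)
  also have "\<dots> = (\<Sum>k<Suc ?n. h (rotate k w))"
    by (subst sum.lessThan_Suc_shift) (simp add: rotate_length01 rotate_id)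
  finally show ?thesis by (simp add: csum_def Cons)
qed simp

lemma csum_rotate: "csum h (rotate k w) = csum h w"
  by (induction k) (simp_all add: csum_rotate1)

lemma rotate_inject: "rotate k v = rotate k w \<longleftrightarrow> v = w"
proof (induction k arbitrary: v w)
  case (Suc k)
  have "rotate1 v = rotate1 w \<longleftrightarrow> v = w" by (cases v; cases w) auto
  then show ?case using Suc by (simp add: rotate1_rotate_swap)
qed simp

lemma csum_sword: "csum (sword (u @ w)) = csum (sword (w @ u))"
proof
  fix v
  have r: "rotate (length u) (u @ w) = w @ u" by (rule rotate_append)
  have "csum (sword (u @ w)) v = (\<Sum>k<length v. sword (w @ u) (rotate k (rotate (length u) v)))"
    unfolding csum_def
  proof (rule sum.cong)
    fix k
    have "rotate k v = u @ w \<longleftrightarrow> rotate (length u) (rotate k v) = rotate (length u) (u @ w)"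
      using rotate_inject by blast
    then show "sword (u @ w) (rotate k v) = sword (w @ u) (rotate k (rotate (length u) v))"
      by (simp add: sword_def r rotate_rotate add.commute)
  qed simp
  also have "\<dots> = csum (sword (w @ u)) (rotate (length u) v)"
    by (simp add: csum_def)
  finally show "csum (sword (u @ w)) v = csum (sword (w @ u)) v"
    by (simp add: csum_rotate)
qed

lemma csum_smul_commute:
  assumes "in_alph n f" "in_alph n g"
  shows "csum (smul f g) = csum (smul g f)"
proof (rule cont_eqI[OF _ _ assms(1), where K = "\<lambda>f. csum (smul f g)"])
  show "cont (\<lambda>f. csum (smul f g))" by (rule cont_comp[OF cont_csum cont_smul_left])
  show "cont (\<lambda>f. csum (smul g f))" by (rule cont_comp[OF cont_csum cont_smul_right])
  fix u
  show "csum (smul (sword u) g) = csum (smul g (sword u))"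
  proof (rule cont_eqI[OF _ _ assms(2), where K = "\<lambda>g. csum (smul (sword u) g)"])
    show "cont (\<lambda>g. csum (smul (sword u) g))" by (rule cont_comp[OF cont_csum cont_smul_right])
    show "cont (\<lambda>g. csum (smul g (sword u)))" by (rule cont_comp[OF cont_csum cont_smul_left])
  qed (simp add: csum_sword flip: sword_append)
qed

lemma comm_span_sum: "(\<And>i. i \<in> I \<Longrightarrow> F i \<in> comm_span n) \<Longrightarrow> (\<lambda>v. \<Sum>i\<in>I. F i v) \<in> comm_span n"
proof (induction I rule: infinite_finite_induct)
  case (insert i I)
  then have "sadd (F i) (\<lambda>v. \<Sum>i\<in>I. F i v) \<in> comm_span n" by (auto intro: comm_span.intros)
  then show ?case using insert by (simp add: sadd_def)
qed (use comm_span.cs_zero in \<open>simp_all add: szero_def\<close>)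

text \<open>Apart from its constant term, p is the sum of \<open>q c\<close> times the letter c,
  where \<open>q c\<close> is the right quotient of p by c. Moving the last letter to the front thus
  changes p by the sum of the commutators of \<open>q c\<close> with c. Homogeneity makes the
  quotients polynomials.\<close>

lemma comm_span_rotate1:
  fixes p :: "'k::field_char_0 ser"
  assumes p: "in_alph n p" "\<And>w. length w \<noteq> d \<Longrightarrow> p w = 0"
  shows "(\<lambda>w. p w - p (rotate1 w)) \<in> comm_span n"
proof -
  define q where "q c = (\<lambda>v. p (v @ [c]))" for c
  have q: "spoly n (q c)" if "c < n" for c
    unfolding spoly_def
  proof
    show "in_alph n (q c)" using p(1) by (force simp: in_alph_def q_def)
    have "{w. q c w \<noteq> 0} \<subseteq> words n d"
    proof
      fix w assume "w \<in> {w. q c w \<noteq> 0}"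
      then have "p (w @ [c]) \<noteq> 0" by (simp add: q_def)
      then have "length (w @ [c]) = d" "set (w @ [c]) \<subseteq> {..<n}"
        using p unfolding in_alph_def by metis+
      then show "w \<in> words n d" by (auto simp: words_def)
    qed
    then show "finite {w. q c w \<noteq> 0}" using finite_subset finite_words by blast
  qed
  have v: "spoly n (svar c)" if "c < n" for c
  proof -
    have "{w. svar c w \<noteq> 0} \<subseteq> {[c]}" by (auto simp: svar_def)
    then show ?thesis using that finite_subset by (auto simp: spoly_def in_alph_svar)
  qed
  have "(\<lambda>w. p w - p (rotate1 w)) =
    (\<lambda>w. \<Sum>c<n. ssub (smul (q c) (svar c)) (smul (svar c) (q c)) w)"
  proof
    fix w :: "nat list"
    have z: "p v = 0" if "\<not> set v \<subseteq> {..<n}" for v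
      using p(1) that by (auto simp: in_alph_def)
    have l: "smul (q c) (svar c) w = (if w \<noteq> [] \<and> last w = c then p w else 0)" for c
    proof (cases w rule: rev_cases)
      case (snoc u e)
      have "(\<lambda>v. svar c (v @ [e]) :: 'k) = (if e = c then sone else szero)"
        by (rule ext) (auto simp: svar_def sone_def)
      then show ?thesis by (simp add: snoc smul_snoc) (simp add: svar_def q_def)
    qed (simp add: svar_def)
    have r: "smul (svar c) (q c) w = (if w \<noteq> [] \<and> hd w = c then p (rotate1 w) else 0)" for c
    proof (cases w)
      case (Cons e u)
      have "(\<lambda>v. svar c (e # v) :: 'k) = (if e = c then sone else szero)"
        by (rule ext) (auto simp: svar_def sone_def)
      then show ?thesis by (simp add: Cons smul_Cons) (simp add: svar_def q_def)
    qed (simp add: svar_def)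
    show "p w - p (rotate1 w) = (\<Sum>c<n. ssub (smul (q c) (svar c)) (smul (svar c) (q c)) w)"
    proof (cases "w = []")
      case False
      have "(\<Sum>c<n. smul (q c) (svar c) w) = (if last w < n then p w else 0)"
        using False by (simp add: l)
      moreover have "(\<Sum>c<n. smul (svar c) (q c) w) = (if hd w < n then p (rotate1 w) else 0)"
        using False by (simp add: r)
      moreover have "p w = 0" if "\<not> last w < n"
        using z[of w] last_in_set[OF False] that by auto
      moreover have "p (rotate1 w) = 0" if "\<not> hd w < n"
        using z[of "rotate1 w"] hd_in_set[OF False] that by auto
      ultimately show ?thesis by (auto simp: sum_subtractf)
    qed (simp add: l r sum_subtractf)
  qed
  also have "\<dots> \<in> comm_span n"
    by (intro comm_span_sum comm_span.cs_comm q v) simp_all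
  finally show ?thesis .
qed

lemma comm_span_rotate:
  assumes p: "in_alph n p" "\<And>w. length w \<noteq> d \<Longrightarrow> p w = 0"
  shows "(\<lambda>w. p w - p (rotate k w)) \<in> comm_span n"
proof (induction k)
  case 0
  then show ?case using comm_span.cs_zero[of n] by (simp add: szero_def)
next
  case (Suc k)
  have "(\<lambda>w. p (rotate k w) - p (rotate k (rotate1 w))) \<in> comm_span n"
  proof (rule comm_span_rotate1)
    show "in_alph n (\<lambda>w. p (rotate k w))" using p(1) by (auto simp: in_alph_def) (metis set_rotate subsetD lessThan_iff)
    show "p (rotate k w) = 0" if "length w \<noteq> d" for w using p(2) that by simp
  qed
  from comm_span.cs_add[OF Suc.IH this]
  show ?case by (simp add: sadd_def rotate1_rotate_swap)
qed

lemma csum_comm_span: "p \<in> comm_span n \<Longrightarrow> csum p = szero"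
proof (induction rule: comm_span.induct)
  case (cs_comm p q)
  then have "csum (smul p q) = csum (smul q p)" by (auto simp: spoly_def intro: csum_smul_commute)
  then have "ssub (csum (smul p q)) (csum (smul q p)) = szero" by (simp add: fun_eq_iff)
  then show ?case by (simp add: csum_linear del: ser_apply)
next
  case (cs_add p q)
  then have "sadd (csum p) (csum q) = szero" by (simp add: fun_eq_iff)
  then show ?case by (simp add: csum_linear del: ser_apply)
next
  case (cs_scale p c)
  then have "sscale c (csum p) = szero" by (simp add: fun_eq_iff)
  then show ?case by (simp add: csum_linear del: ser_apply)
qed (simp add: csum_linear del: ser_apply)

lemma in_alph_comm_span: "p \<in> comm_span n \<Longrightarrow> in_alph n p"
  by (induction rule: comm_span.induct) (auto simp: spoly_def simp del: ser_apply intro: in_alph_intros)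

text \<open>In degree d, a series whose cyclic sum vanishes is the mean of its differences from its
  d rotations, and these differences are commutators. The division by d is where characteristic zero
  enters.\<close>

lemma tr_zero_iff: "tr_zero n h \<longleftrightarrow> in_alph n h \<and> h [] = 0 \<and> csum h = szero"
proof (intro iffI conjI)
  assume h: "tr_zero n h"
  show "in_alph n h" unfolding in_alph_def
  proof (intro allI impI)
    fix w assume "h w \<noteq> 0"
    then show "set w \<subseteq> {..<n}"
      using h in_alph_comm_span[of "homog (length w) h" n] by (auto simp: tr_zero_def in_alph_def homog_apply)
  qed
  show "h [] = 0" using h by (simp add: tr_zero_def)
  show "csum h = szero"
  proof
    fix w :: "nat list"
    have "csum (homog (length w) h) = szero"
      using h csum_comm_span unfolding tr_zero_def by blast
    moreover have "csum (homog (length w) h) w = csum h w" by (simp add: csum_def homog_apply)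
    ultimately show "csum h w = szero w" by simp
  qed
next
  assume h: "in_alph n h \<and> h [] = 0 \<and> csum h = szero"
  show "tr_zero n h" unfolding tr_zero_def
  proof (intro conjI allI)
    fix d
    let ?p = "homog d h"
    show "?p \<in> comm_span n"
    proof (cases "d = 0")
      case True
      then have "?p = szero" using h by (auto simp: homog_apply fun_eq_iff)
      then show ?thesis by (simp add: comm_span.cs_zero)
    next
      case False
      have "?p = sscale (1 / of_nat d) (\<lambda>w. \<Sum>k<d. ?p w - ?p (rotate k w))"
      proof
        fix w :: "nat list"
        have "csum h w = 0" using h by simp
        then have "(\<Sum>k<d. ?p (rotate k w)) = 0"
          by (cases "length w = d") (auto simp: homog_apply csum_def)
        then show "?p w = sscale (1 / of_nat d) (\<lambda>w. \<Sum>k<d. ?p w - ?p (rotate k w)) w"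
          using False by (simp add: sum_subtractf)
      qed
      moreover have "sscale (1 / of_nat d) (\<lambda>w. \<Sum>k<d. ?p w - ?p (rotate k w)) \<in> comm_span n"
        using h by (intro comm_span.cs_scale comm_span_sum comm_span_rotate[where d = d])
          (simp_all add: in_alph_homog, simp add: homog_apply)
      ultimately show ?thesis by simp
    qed
  qed (use h in simp)
qed

lemma tr_zero_sadd: "tr_zero n f \<Longrightarrow> tr_zero n g \<Longrightarrow> tr_zero n (sadd f g)"
  by (auto simp: tr_zero_iff csum_linear fun_eq_iff intro: in_alph_intros)

lemma tr_zero_ssub: "tr_zero n f \<Longrightarrow> tr_zero n g \<Longrightarrow> tr_zero n (ssub f g)"
  by (auto simp: tr_zero_iff csum_linear fun_eq_iff intro: in_alph_intros)

lemma tr_zero_sscale: "tr_zero n f \<Longrightarrow> tr_zero n (sscale c f)"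
  by (auto simp: tr_zero_iff csum_linear fun_eq_iff intro: in_alph_intros)

lemma tr_zero_szero: "tr_zero n szero"
  by (auto simp: tr_zero_iff csum_linear)

lemma tr_zero_sbr: "in_alph n f \<Longrightarrow> in_alph n g \<Longrightarrow> tr_zero n (sbr f g)"
  using csum_smul_commute[of n f g]
  by (auto simp: tr_zero_iff sbr_def csum_linear fun_eq_iff intro: in_alph_intros)

lemma csum_cont_zero:
  assumes "cont L" "\<And>p. p \<in> comm_span n \<Longrightarrow> csum (L p) = szero" "tr_zero n h"
  shows "csum (L h) = szero"
proof
  fix v
  have "csum (L h) v = (\<Sum>d\<in>{0..length v}. csum (L (homog d h)) v)"
    by (rule cont_homog_expand[OF cont_comp[OF cont_csum assms(1)]]) simp
  also have "\<dots> = 0"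
    using assms(2,3) by (intro sum.neutral) (simp add: tr_zero_def)
  finally show "csum (L h) v = szero v" by simp
qed

lemma tr_zero_fev:
  assumes "raising A" "\<And>h. tr_zero n h \<Longrightarrow> tr_zero n (A h)" "tr_zero n f"
  shows "tr_zero n (fev A F f)"
proof -
  have m: "tr_zero n ((A ^^ m) f)" for m using assms(2,3) by (induction m) auto
  have "csum (fev A F f) = szero"
    by (rule ext, subst fev_apply[OF assms(1) cont_csum order_refl])
      (use m in \<open>simp add: tr_zero_iff\<close>)
  moreover have "in_alph n (fev A F f)"
    unfolding in_alph_def fev_def
  proof (intro allI impI)
    fix w :: "nat list" assume "(\<Sum>m\<in>{0..length w}. fps_nth F m * (A ^^ m) f w) \<noteq> 0"
    then obtain k where "fps_nth F k * (A ^^ k) f w \<noteq> 0" by (meson sum.neutral)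
    then show "set w \<subseteq> {..<n}" using m[of k] by (auto simp: tr_zero_iff in_alph_def)
  qed
  ultimately show ?thesis using assms(3) by (simp add: tr_zero_iff fev_def)
qed

subsection \<open>Tangential derivations\<close>

text \<open>The Leibniz and divergence computations take place in the associative algebra, so they
  are carried out for arbitrary pairs without constant term; Lie series enter only to place the
  results in \<open>tder2\<close>.\<close>

definition tpair :: "'k::field_char_0 ser \<times> 'k ser \<Rightarrow> bool" where
  "tpair u \<longleftrightarrow> in_alph 2 (fst u) \<and> in_alph 2 (snd u) \<and> fst u [] = 0 \<and> snd u [] = 0"

lemma tder2_iff:
  "u \<in> tder2 \<longleftrightarrow> fst u \<in> lie 2 \<and> snd u \<in> lie 2 \<and> fst u [0] = 0 \<and> snd u [1] = 0"
  by (auto simp: tder2_def)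

lemma tpair_tder2: "u \<in> tder2 \<Longrightarrow> tpair u"
  by (auto simp: tder2_iff tpair_def in_alph_lie dest: lie_Nil)

lemma ord_sbr: "ord m f \<Longrightarrow> ord n g \<Longrightarrow> ord (m + n) (sbr f g)"
  unfolding sbr_def using ord_smul[of m f n g] ord_smul[of n g m f] by (simp add: add.commute ord_ssub del: ser_apply)

lemma tgen_simps [simp]: "tgen u 0 = sbr (svar 0) (fst u)" "tgen u 1 = sbr (svar 1) (snd u)"
  "tgen u (Suc 0) = sbr (svar 1) (snd u)"
  by (simp_all add: tgen_def)

lemma ord_tgen: "ord k (fst u) \<Longrightarrow> ord k (snd u) \<Longrightarrow> ord (Suc k) (tgen u i)"
  using ord_sbr[OF ord_svar[of 0], of k "fst u"] ord_sbr[OF ord_svar[of 1], of k "snd u"]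
  by (simp add: tgen_def)

lemma ord_tgen2: "tpair u \<Longrightarrow> ord 2 (tgen u i)"
  using ord_tgen[of 1 u i] by (simp add: tpair_def ord_1_iff numeral_2_eq_2)

lemma in_alph_tgen: "tpair u \<Longrightarrow> in_alph 2 (tgen u i)"
  by (simp add: tgen_def tpair_def in_alph_intros)

lemma raising_tact: "tpair u \<Longrightarrow> raising (tact u)"
  unfolding tact_def by (rule raising_sder) (rule ord_tgen2)

lemma tact_Nil: "tpair u \<Longrightarrow> tact u f [] = 0"
  by (rule raising_Nil[OF raising_tact])

lemma in_alph_tact: "tpair u \<Longrightarrow> in_alph 2 (tact u f)"
  unfolding tact_def by (rule in_alph_sder) (rule in_alph_tgen)

lemma tact_smul:
  "tpair u \<Longrightarrow> in_alph 2 f \<Longrightarrow> in_alph 2 g \<Longrightarrow>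
    tact u (smul f g) = sadd (smul (tact u f) g) (smul f (tact u g))"
  unfolding tact_def by (rule sder_smul) (rule ord_tgen2)

lemma tact_svar: "tpair u \<Longrightarrow> i < 2 \<Longrightarrow> tact u (svar i) = tgen u i"
  unfolding tact_def by (rule sder_svar) (rule ord_tgen2)

lemma tact_sone: assumes "tpair u" shows "tact u sone = szero"
  unfolding tact_def using sder_sword[where s="tgen u" and n=2 and w="[]", OF ord_tgen2[OF assms]]
  by (simp add: sword_Nil del: ser_apply)

lemmas tact_linear = slinD[OF cont_slin[OF raising_cont[OF raising_tact]]]

lemma tact_unique:
  assumes "tpair u" "cont L" "L sone = szero"
    and "\<And>i w. i < 2 \<Longrightarrow> set w \<subseteq> {..<2} \<Longrightarrow>
      L (smul (svar i) (sword w)) = sadd (smul (tgen u i) (sword w)) (smul (svar i) (L (sword w)))"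
    and "in_alph 2 f"
  shows "L f = tact u f"
  unfolding tact_def
proof (rule sder_unique[where L = L])
  show "ord 2 (tgen u i)" for i by (rule ord_tgen2[OF assms(1)])
qed (use assms in simp_all)

lemma tact_sbr:
  assumes "tpair u" "in_alph 2 f" "in_alph 2 g"
  shows "tact u (sbr f g) = sadd (sbr (tact u f) g) (sbr f (tact u g))"
  by (rule ext) (simp add: sbr_def tact_linear assms tact_smul)

lemma lie_tact:
  assumes u: "u \<in> tder2" and f: "f \<in> lie 2" shows "tact u f \<in> lie 2"
proof (rule lie_cont[OF raising_cont[OF raising_tact[OF tpair_tder2[OF u]]] _ f])
  note t = tpair_tder2[OF u]
  show "tact u p \<in> lie 2" if "p \<in> lie_poly 2" for p
    using that
  proof (induction rule: lie_poly.induct)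
    case (lp_var i)
    then have "tgen u i \<in> lie 2" using u by (auto simp: tgen_def tder2_iff intro!: lie_sbr lie_svar)
    then show ?case using lp_var tact_svar[OF t, of i] by (simp del: ser_apply)
  next
    case (lp_br p q)
    then have "tact u (sbr p q) = sadd (sbr (tact u p) q) (sbr p (tact u q))"
      by (intro tact_sbr t in_alph_lie_poly)
    moreover have "sadd (sbr (tact u p) q) (sbr p (tact u q)) \<in> lie 2"
      using lp_br by (intro lie_sadd lie_sbr) (auto intro: lie_polyD)
    ultimately show ?case by (simp del: ser_apply)
  qed (simp_all add: tact_linear t lie_szero lie_sadd lie_sscale del: ser_apply)
qed

lemma texp_eq: "texp u = fev (tact u) (fps_exp 1)"
  by (simp add: texp_def fev_def fun_eq_iff)

lemma lie_texp: "u \<in> tder2 \<Longrightarrow> f \<in> lie 2 \<Longrightarrow> texp u f \<in> lie 2"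
  unfolding texp_eq by (intro lie_fev raising_tact tpair_tder2 lie_tact)

text \<open>A derivation sends a commutator to a sum of two commutators, so it acts on
  traces.\<close>

lemma tr_zero_tact:
  assumes u: "tpair u" and h: "tr_zero 2 h" shows "tr_zero 2 (tact u h)"
proof -
  have "csum (tact u h) = szero"
  proof (rule csum_cont_zero[OF raising_cont[OF raising_tact[OF u]] _ h])
    show "csum (tact u p) = szero" if "p \<in> comm_span 2" for p
      using that
    proof (induction rule: comm_span.induct)
      case (cs_comm p q)
      then have pq: "in_alph 2 p" "in_alph 2 q" by (auto simp: spoly_def)
      have "csum (smul (tact u p) q) = csum (smul q (tact u p))"
        "csum (smul p (tact u q)) = csum (smul (tact u q) p)"
        by (rule csum_smul_commute; fact pq in_alph_tact[OF u])+
      then have "csum (ssub (sadd (smul (tact u p) q) (smul p (tact u q)))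
          (sadd (smul (tact u q) p) (smul q (tact u p)))) = szero"
        by (simp add: csum_linear fun_eq_iff)
      then show ?case by (simp add: tact_linear u tact_smul pq del: ser_apply)
    next
      case (cs_add p q)
      then have "sadd (csum (tact u p)) (csum (tact u q)) = szero" by (simp add: fun_eq_iff)
      then show ?case by (simp add: csum_linear tact_linear u del: ser_apply)
    next
      case (cs_scale p c)
      then have "sscale c (csum (tact u p)) = szero" by (simp add: fun_eq_iff)
      then show ?case by (simp add: csum_linear tact_linear u del: ser_apply)
    qed (simp add: csum_linear tact_linear u del: ser_apply)
  qed
  then show ?thesis by (simp add: tr_zero_iff in_alph_tact u tact_Nil)
qed

subsection \<open>The Lie bracket and the divergence cocycle\<close>

text \<open>The commutator of derivations written on pairs. The last bracket comes from the Jacobi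
  identity [[x,a],a'] - [[x,a'],a] = [x,[a,a']].\<close>

definition tbr :: "'k::field_char_0 ser \<times> 'k ser \<Rightarrow> 'k ser \<times> 'k ser \<Rightarrow> 'k ser \<times> 'k ser" where
  "tbr u v = (sadd (ssub (tact u (fst v)) (tact v (fst u))) (sbr (fst u) (fst v)),
              sadd (ssub (tact u (snd v)) (tact v (snd u))) (sbr (snd u) (snd v)))"

lemma tpair_tbr: "tpair u \<Longrightarrow> tpair v \<Longrightarrow> tpair (tbr u v)"
proof -
  assume uv: "tpair u" "tpair v"
  then have al: "in_alph 2 (fst u)" "in_alph 2 (snd u)" "in_alph 2 (fst v)" "in_alph 2 (snd v)"
    and Nil: "fst u [] = 0" "snd u [] = 0"
    by (auto simp: tpair_def)
  have "in_alph 2 (fst (tbr u v))" "in_alph 2 (snd (tbr u v))"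
    unfolding tbr_def fst_conv snd_conv
    by (intro in_alph_sadd in_alph_ssub in_alph_tact in_alph_sbr uv al)+
  then show ?thesis
    by (simp add: tpair_def) (simp add: tbr_def sbr_def tact_Nil uv Nil)
qed

lemma raising_single: assumes "raising A" "f [] = 0" shows "A f [i] = 0"
proof -
  have "ord 1 f" using assms by (simp add: ord_1_iff)
  then have "ord 2 (A f)" using assms by (simp add: raising_def numeral_2_eq_2)
  then show ?thesis by (simp add: ord_def)
qed

text \<open>Normalisation survives because all terms start in degree two: derivations raise the
  degree, and the bracketed series have no constant term.\<close>

lemma tbr_tder2: assumes "u \<in> tder2" "v \<in> tder2" shows "tbr u v \<in> tder2"
proof -
  note t = assms[THEN tpair_tder2]
  have r: "tact u f [i] = 0" "tact v f [i] = 0" if "f [] = 0" for f i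
    using raising_single[of "tact u" f i] raising_single[of "tact v" f i]
      raising_tact[OF t(1)] raising_tact[OF t(2)] that by auto
  show ?thesis
    unfolding tder2_iff
  proof (intro conjI)
    have l: "fst u \<in> lie 2" "snd u \<in> lie 2" "fst v \<in> lie 2" "snd v \<in> lie 2"
      using assms by (auto simp: tder2_iff)
    show "fst (tbr u v) \<in> lie 2" "snd (tbr u v) \<in> lie 2"
      unfolding tbr_def fst_conv snd_conv
      by (intro lie_sadd lie_ssub lie_tact lie_sbr l assms)+
    show "fst (tbr u v) [0] = 0" "snd (tbr u v) [1] = 0"
      using t by (simp_all add: tbr_def r tpair_def sbr_def smul_Cons)
  qed
qed

lemma tact_tbr:
  assumes u: "tpair u" and v: "tpair v" and f: "in_alph 2 f"
  shows "tact (tbr u v) f = ssub (tact u (tact v f)) (tact v (tact u f))"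
proof -
  have L: "cont (\<lambda>f. ssub (tact u (tact v f)) (tact v (tact u f)))"
    by (rule cont_ssub[OF cont_comp[of "tact u" "tact v"] cont_comp[of "tact v" "tact u"]])
      (intro raising_cont raising_tact u v)+
  have "ssub (tact u (tact v f)) (tact v (tact u f)) = tact (tbr u v) f"
  proof (rule tact_unique[OF tpair_tbr[OF u v] L _ _ f])
    show "ssub (tact u (tact v sone)) (tact v (tact u sone)) = szero"
      by (simp add: tact_sone tact_linear u v fun_eq_iff)
    fix i w assume i: "i < (2::nat)" and w: "set w \<subseteq> {..<(2::nat)}"
    have al: "in_alph 2 (sword w)" "in_alph 2 (svar i)" "in_alph 2 (tgen u i)" "in_alph 2 (tgen v i)"
      "in_alph 2 (fst u)" "in_alph 2 (snd u)" "in_alph 2 (fst v)" "in_alph 2 (snd v)"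
      using i w u v in_alph_tgen[OF u, of i] in_alph_tgen[OF v, of i]
      by (auto simp: tpair_def intro: in_alph_intros)
    have key: "ssub (tact u (tgen v i)) (tact v (tgen u i)) = tgen (tbr u v) i"
    proof -
      have "i = 0 \<or> i = 1" using i by auto
      then show ?thesis
      proof
        assume [simp]: "i = 0"
        show ?thesis
          by (rule ext) (simp add: tbr_def tact_sbr u v al in_alph_svar tact_svar,
            simp add: sbr_def smul_distribs smul_assoc)
      next
        assume [simp]: "i = 1"
        show ?thesis
          by (rule ext) (simp add: tbr_def tact_sbr u v al in_alph_svar tact_svar,
            simp add: sbr_def smul_distribs smul_assoc)
      qed
    qed
    have "ssub (tact u (tact v (smul (svar i) (sword w)))) (tact v (tact u (smul (svar i) (sword w))))
      = sadd (smul (ssub (tact u (tgen v i)) (tact v (tgen u i))) (sword w))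
          (smul (svar i) (ssub (tact u (tact v (sword w))) (tact v (tact u (sword w)))))"
      by (rule ext) (simp add: tact_smul tact_linear u v al tact_svar i in_alph_tact in_alph_smul smul_distribs)
    then show "ssub (tact u (tact v (smul (svar i) (sword w)))) (tact v (tact u (smul (svar i) (sword w))))
      = sadd (smul (tgen (tbr u v) i) (sword w))
          (smul (svar i) (ssub (tact u (tact v (sword w))) (tact v (tact u (sword w)))))"
      unfolding key .
  qed
  then show ?thesis ..
qed

section \<open>Right derivatives and the divergence cocycle\<close>

lemma dx_linear: "dx (sadd f g) = sadd (dx f) (dx g)" "dx (ssub f g) = ssub (dx f) (dx g)"
  "dx (sscale c f) = sscale c (dx f)"
  by (simp_all add: dx_def fun_eq_iff)

lemma dy_linear: "dy (sadd f g) = sadd (dy f) (dy g)" "dy (ssub f g) = ssub (dy f) (dy g)"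
  "dy (sscale c f) = sscale c (dy f)"
  by (simp_all add: dy_def fun_eq_iff)

lemma dx_smul: "dx (smul f g) = sadd (smul f (dx g)) (sscale (g []) (dx f))"
  by (rule ext) (simp add: dx_def smul_snoc)

lemma dy_smul: "dy (smul f g) = sadd (smul f (dy g)) (sscale (g []) (dy f))"
  by (rule ext) (simp add: dy_def smul_snoc)

lemma dxy_svar: "dx (svar 0) = sone" "dx (svar (Suc 0)) = szero" "dy (svar 0) = szero" "dy (svar (Suc 0)) = sone"
  by (auto simp: dx_def dy_def svar_def sone_def fun_eq_iff)

lemma svar_Nil [simp]: "svar i [] = 0"
  by (simp add: svar_def)

lemma in_alph_dx: "in_alph n f \<Longrightarrow> in_alph n (dx f)"
  by (force simp: in_alph_def dx_def)

lemma in_alph_dy: "in_alph n f \<Longrightarrow> in_alph n (dy f)"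
  by (force simp: in_alph_def dy_def)

lemma right_decomposition:
  fixes a :: "'k::field_char_0 ser"
  assumes "in_alph 2 a" "a [] = 0"
  shows "a = sadd (smul (dx a) (svar 0)) (smul (dy a) (svar 1))"
proof
  fix w :: "nat list"
  show "a w = sadd (smul (dx a) (svar 0)) (smul (dy a) (svar 1)) w"
  proof (cases w rule: rev_cases)
    case (snoc v c)
    have s: "(\<lambda>v. svar i (v @ [c]) :: 'k) = (if c = i then sone else szero)" for i
      by (auto simp: fun_eq_iff svar_def sone_def)
    have "a w = 0" if "c \<noteq> 0" "c \<noteq> 1"
    proof (rule ccontr)
      assume "a w \<noteq> 0"
      then have "c < 2" using assms(1) by (auto simp: in_alph_def snoc)
      then show False using that by auto
    qed
    then show ?thesis by (auto simp: snoc smul_snoc s dx_def dy_def)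
  qed (simp add: assms(2))
qed

text \<open>Apply u to the right decomposition of \<open>a\<close> and strip the last letter again.
  The lone \<open>fst u\<close> stems from the half of [x, \<open>fst u\<close>] in which x comes
  last, and \<open>snd u\<close> likewise from [y, \<open>snd u\<close>].\<close>

lemma dxy_tact:
  assumes u: "tpair u" and a: "in_alph 2 a" "a [] = 0"
  shows "dx (tact u a) = sadd (tact u (dx a))
      (sadd (smul (dx a) (ssub (smul (svar 0) (dx (fst u))) (fst u))) (smul (dy a) (smul (svar 1) (dx (snd u)))))"
    and "dy (tact u a) = sadd (tact u (dy a))
      (sadd (smul (dx a) (smul (svar 0) (dy (fst u)))) (smul (dy a) (ssub (smul (svar 1) (dy (snd u))) (snd u))))"
proof -
  have al: "in_alph 2 (dx a)" "in_alph 2 (dy a)" "in_alph 2 (svar 0)" "in_alph 2 (svar (Suc 0))"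
    using a by (auto intro: in_alph_dx in_alph_dy in_alph_svar)
  have Nil: "fst u [] = 0" "snd u [] = 0" using u by (auto simp: tpair_def)
  have "tact u a = tact u (sadd (smul (dx a) (svar 0)) (smul (dy a) (svar 1)))"
    using right_decomposition[OF a] by simp
  also have "\<dots> = sadd (sadd (smul (tact u (dx a)) (svar 0)) (smul (dx a) (sbr (svar 0) (fst u))))
      (sadd (smul (tact u (dy a)) (svar 1)) (smul (dy a) (sbr (svar 1) (snd u))))"
    by (simp add: tact_linear u tact_smul al tact_svar del: ser_apply)
  finally have e: "tact u a = \<dots>" .
  show "dx (tact u a) = sadd (tact u (dx a))
      (sadd (smul (dx a) (ssub (smul (svar 0) (dx (fst u))) (fst u))) (smul (dy a) (smul (svar 1) (dx (snd u)))))"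
    unfolding e by (rule ext) (simp add: dx_linear dx_smul dxy_svar sbr_def Nil smul_distribs)
  show "dy (tact u a) = sadd (tact u (dy a))
      (sadd (smul (dx a) (smul (svar 0) (dy (fst u)))) (smul (dy a) (ssub (smul (svar 1) (dy (snd u))) (snd u))))"
    unfolding e by (rule ext) (simp add: dy_linear dy_smul dxy_svar sbr_def Nil smul_distribs)
qed

lemma sdiv_Nil: "sdiv u [] = 0"
  by (simp add: sdiv_def)

lemma in_alph_sdiv: "tpair u \<Longrightarrow> in_alph 2 (sdiv u)"
  by (simp add: sdiv_def tpair_def in_alph_intros in_alph_dx in_alph_dy)

text \<open>Once \<open>dxy_tact\<close> is inserted, the terms in which u or v acts on a right
  derivative cancel outright. What remains are products of pieces such as x \<open>dx a\<close>, y
  \<open>dx b\<close> or \<open>a\<close>, which cancel after the cyclic swaps listed in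
  \<open>c\<close>.\<close>

lemma sdiv_tbr:
  assumes u: "tpair u" and v: "tpair v"
  shows "tr_zero 2 (ssub (sdiv (tbr u v)) (ssub (tact u (sdiv v)) (tact v (sdiv u))))"
proof -
  obtain a b where ub: "u = (a, b)" by (cases u)
  obtain a' b' where vb: "v = (a', b')" by (cases v)
  have al: "in_alph 2 a" "in_alph 2 b" "in_alph 2 a'" "in_alph 2 b'"
    using u v by (auto simp: tpair_def ub vb)
  have Nil: "a [] = 0" "b [] = 0" "a' [] = 0" "b' [] = 0"
    using u v by (auto simp: tpair_def ub vb)
  let ?x = "svar 0" and ?y = "svar 1"
  have ald: "in_alph 2 ?x" "in_alph 2 (svar (Suc 0))" "in_alph 2 (dx a)" "in_alph 2 (dy a)" "in_alph 2 (dx b)" "in_alph 2 (dy b)"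
    "in_alph 2 (dx a')" "in_alph 2 (dy a')" "in_alph 2 (dx b')" "in_alph 2 (dy b')"
    using al by (auto intro: in_alph_dx in_alph_dy in_alph_svar)
  note cyc = csum_smul_commute[of 2, THEN fun_cong]
  have c: "csum (smul (smul ?x (dx a')) (smul ?x (dx a))) w = csum (smul (smul ?x (dx a)) (smul ?x (dx a'))) w"
    "csum (smul (smul ?x (dx a')) a) w = csum (smul a (smul ?x (dx a'))) w"
    "csum (smul (smul ?x (dx a)) a') w = csum (smul a' (smul ?x (dx a))) w"
    "csum (smul (smul ?x (dy a')) (smul ?y (dx b))) w = csum (smul (smul ?y (dx b)) (smul ?x (dy a'))) w"
    "csum (smul (smul ?x (dy a)) (smul ?y (dx b'))) w = csum (smul (smul ?y (dx b')) (smul ?x (dy a))) w"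
    "csum (smul (smul ?y (dy b')) (smul ?y (dy b))) w = csum (smul (smul ?y (dy b)) (smul ?y (dy b'))) w"
    "csum (smul (smul ?y (dy b')) b) w = csum (smul b (smul ?y (dy b'))) w"
    "csum (smul (smul ?y (dy b)) b') w = csum (smul b' (smul ?y (dy b))) w" for w
    by (rule cyc; simp add: al ald in_alph_smul)+
  have "csum (ssub (sdiv (tbr u v)) (ssub (tact u (sdiv v)) (tact v (sdiv u)))) = szero"
  proof
    fix w
    have d: "dx (fst (tbr u v)) = sadd (ssub (dx (tact u a')) (dx (tact v a))) (ssub (smul a (dx a')) (smul a' (dx a)))"
      "dy (snd (tbr u v)) = sadd (ssub (dy (tact u b')) (dy (tact v b))) (ssub (smul b (dy b')) (smul b' (dy b)))"
      by (simp_all add: tbr_def ub vb sbr_def dx_linear dx_smul dy_linear dy_smul Nil fun_eq_iff)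
    have t: "tact u (sdiv v) = sadd (sadd (smul (sbr ?x a) (dx a')) (smul ?x (tact u (dx a'))))
         (sadd (smul (sbr ?y b) (dy b')) (smul ?y (tact u (dy b'))))"
      "tact v (sdiv u) = sadd (sadd (smul (sbr ?x a') (dx a)) (smul ?x (tact v (dx a))))
         (sadd (smul (sbr ?y b') (dy b)) (smul ?y (tact v (dy b))))"
      using u v by (simp_all add: ub vb sdiv_def tact_linear tact_smul ald in_alph_smul tact_svar del: ser_apply)
    have dt: "dx (tact u a') = sadd (tact u (dx a')) (sadd (smul (dx a') (ssub (smul ?x (dx a)) a)) (smul (dy a') (smul ?y (dx b))))"
      "dx (tact v a) = sadd (tact v (dx a)) (sadd (smul (dx a) (ssub (smul ?x (dx a')) a')) (smul (dy a) (smul ?y (dx b'))))"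
      "dy (tact u b') = sadd (tact u (dy b')) (sadd (smul (dx b') (smul ?x (dy a))) (smul (dy b') (ssub (smul ?y (dy b)) b)))"
      "dy (tact v b) = sadd (tact v (dy b)) (sadd (smul (dx b) (smul ?x (dy a'))) (smul (dy b) (ssub (smul ?y (dy b')) b')))"
      using dxy_tact[OF u, of a'] dxy_tact[OF v, of a] dxy_tact[OF u, of b'] dxy_tact[OF v, of b] al Nil
      by (simp_all add: ub vb del: ser_apply)
    show "csum (ssub (sdiv (tbr u v)) (ssub (tact u (sdiv v)) (tact v (sdiv u)))) w = szero w"
      unfolding t unfolding sdiv_def d dt sbr_def
      by (simp only: smul_distribs smul_assoc csum_linear ser_apply c[unfolded smul_assoc])
        (simp only: algebra_simps add_0_left add_0_right)
  qed
  moreover have "in_alph 2 (ssub (sdiv (tbr u v)) (ssub (tact u (sdiv v)) (tact v (sdiv u))))"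
    by (intro in_alph_ssub in_alph_tact in_alph_sdiv tpair_tbr u v)
  ultimately show ?thesis
    by (simp only: tr_zero_iff ser_apply sdiv_Nil tact_Nil[OF u] tact_Nil[OF v] diff_0_right simp_thms)
qed

subsection \<open>Sums of tangential derivations\<close>

definition padd :: "'k::field_char_0 ser \<times> 'k ser \<Rightarrow> 'k ser \<times> 'k ser \<Rightarrow> 'k ser \<times> 'k ser" where
  "padd u v = (sadd (fst u) (fst v), sadd (snd u) (snd v))"

definition pscale :: "'k::field_char_0 \<Rightarrow> 'k ser \<times> 'k ser \<Rightarrow> 'k ser \<times> 'k ser" where
  "pscale c u = (sscale c (fst u), sscale c (snd u))"

definition pord :: "nat \<Rightarrow> 'k::field_char_0 ser \<times> 'k ser \<Rightarrow> bool" where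
  "pord k u \<longleftrightarrow> ord k (fst u) \<and> ord k (snd u)"

text \<open>Filtered linear maps in the derivation argument. Both div and the action on a fixed
  series are of this kind, so they commute with infinite sums of derivations.\<close>

definition pcont :: "('k::field_char_0 ser \<times> 'k ser \<Rightarrow> 'k ser) \<Rightarrow> bool" where
  "pcont T \<longleftrightarrow> (\<forall>u v. T (padd u v) = sadd (T u) (T v)) \<and> (\<forall>c u. T (pscale c u) = sscale c (T u))
    \<and> (\<forall>k u. pord k u \<longrightarrow> ord k (T u))"

definition psum :: "(nat \<Rightarrow> 'k::field_char_0 ser \<times> 'k ser) \<Rightarrow> nat set \<Rightarrow> 'k ser \<times> 'k ser" where
  "psum W I = ((\<lambda>v. \<Sum>i\<in>I. fst (W i) v), (\<lambda>v. \<Sum>i\<in>I. snd (W i) v))"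

text \<open>Meant for sequences with \<open>W e\<close> of order e: the terms beyond the length of
  the word vanish there, so the truncation gives the full infinite sum.\<close>

definition pser :: "(nat \<Rightarrow> 'k::field_char_0 ser \<times> 'k ser) \<Rightarrow> 'k ser \<times> 'k ser" where
  "pser W = ((\<lambda>v. \<Sum>e\<in>{0..length v}. fst (W e) v), (\<lambda>v. \<Sum>e\<in>{0..length v}. snd (W e) v))"

lemma psum_insert: "finite I \<Longrightarrow> i \<notin> I \<Longrightarrow> psum W (insert i I) = padd (W i) (psum W I)"
  by (simp add: psum_def padd_def fun_eq_iff)

lemma pcontD:
  assumes "pcont T"
  shows "T (padd u v) = sadd (T u) (T v)" "T (pscale c u) = sscale c (T u)"
    "pord k u \<Longrightarrow> ord k (T u)"
  using assms unfolding pcont_def by blast+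

lemma pcont_szero: "pcont T \<Longrightarrow> T (szero, szero) = szero"
proof -
  assume "pcont T"
  then have "T (pscale 0 (szero, szero)) = sscale 0 (T (szero, szero))" by (rule pcontD)
  moreover have "pscale 0 (szero, szero) = ((szero, szero) :: 'a ser \<times> 'a ser)"
    by (simp add: pscale_def fun_eq_iff)
  ultimately show ?thesis by (simp add: fun_eq_iff)
qed

lemma pcont_psum:
  assumes "finite I" "pcont T"
  shows "T (psum W I) v = (\<Sum>i\<in>I. T (W i) v)"
  using assms
proof (induction I rule: finite_induct)
  case empty
  have "psum W {} = (szero, szero)" by (simp add: psum_def fun_eq_iff)
  then show ?case using pcont_szero[of T] empty by simp
next
  case (insert i I)
  then show ?case by (simp add: psum_insert pcontD(1)[OF insert.prems])
qed

lemma pcont_pser: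
  assumes T: "pcont T" and W: "\<And>e. pord e (W e)"
  shows "T (pser W) v = (\<Sum>e\<in>{0..length v}. T (W e) v)"
proof -
  let ?I = "{0..length v}"
  \<comment> \<open>The tail of the series. Its order exceeds the length of \<open>v\<close>, hence
    so does that of its image under \<open>T\<close>.\<close>
  define r where "r = padd (pser W) (pscale (-1) (psum W ?I))"
  have "(\<Sum>e\<in>{0..length w}. fst (W e) w) = (\<Sum>e\<in>?I. fst (W e) w)"
    "(\<Sum>e\<in>{0..length w}. snd (W e) w) = (\<Sum>e\<in>?I. snd (W e) w)" if "length w \<le> length v" for w
    using W that by (auto intro!: sum.mono_neutral_left simp: pord_def ord_def)
  then have "pord (Suc (length v)) r"
    by (auto simp: r_def pord_def ord_def padd_def pscale_def pser_def psum_def)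
  then have "ord (Suc (length v)) (T r)" by (rule pcontD(3)[OF T])
  then have z: "T r v = 0" by (simp add: ord_def)
  have "pser W = padd (psum W ?I) r"
    by (simp add: r_def padd_def pscale_def fun_eq_iff prod_eq_iff)
  then have "T (pser W) v = T (psum W ?I) v + T r v"
    by (simp add: pcontD(1)[OF T])
  also have "T (psum W ?I) v = (\<Sum>e\<in>?I. T (W e) v)"
    by (rule pcont_psum[OF finite_atLeastAtMost T])
  finally show ?thesis unfolding z by simp
qed

lemma dword_add: "dword (\<lambda>i. sadd (s i) (t i)) w = sadd (dword s w) (dword t w)"
  by (rule ext) (simp add: dword_def smul_distribs sum.distrib)

lemma dword_scale: "dword (\<lambda>i. sscale c (s i)) w = sscale c (dword s w)"
  by (rule ext) (simp add: dword_def smul_distribs sum_distrib_left)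

lemma pcont_tact: "pcont (\<lambda>u. tact u f)"
  unfolding pcont_def
proof (intro conjI allI impI)
  fix u v :: "'a ser \<times> 'a ser" and c :: 'a and k
  have "tgen (padd u v) = (\<lambda>i. sadd (tgen u i) (tgen v i))"
    by (simp add: tgen_def padd_def sbr_def smul_distribs fun_eq_iff)
  then have "dword (tgen (padd u v)) w = sadd (dword (tgen u) w) (dword (tgen v) w)" for w
    by (simp only: dword_add)
  then show "tact (padd u v) f = sadd (tact u f) (tact v f)"
    by (simp add: tact_def sder_eq fun_eq_iff sum.distrib algebra_simps)
  have "tgen (pscale c u) = (\<lambda>i. sscale c (tgen u i))"
    by (simp add: tgen_def pscale_def sbr_def smul_distribs fun_eq_iff algebra_simps)
  then have "dword (tgen (pscale c u)) w = sscale c (dword (tgen u) w)" for w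
    by (simp only: dword_scale)
  then show "tact (pscale c u) f = sscale c (tact u f)"
    by (simp add: tact_def sder_eq fun_eq_iff sum_distrib_left algebra_simps)
  assume "pord k u"
  then show "ord k (tact u f)"
    unfolding tact_def using ord_sder[where s="tgen u" and n=2 and k=k and m=0 and f=f]
    by (simp add: pord_def ord_tgen)
qed

lemma ord_dx: "ord (Suc k) a \<Longrightarrow> ord k (dx a)" "ord (Suc k) a \<Longrightarrow> ord k (dy a)"
  by (auto simp: ord_def dx_def dy_def)

lemma pcont_sdiv: "pcont sdiv"
  unfolding pcont_def
proof (intro conjI allI impI)
  fix u v :: "'a ser \<times> 'a ser" and c :: 'a and k
  show "sdiv (padd u v) = sadd (sdiv u) (sdiv v)"
    by (simp add: sdiv_def padd_def dx_linear dy_linear smul_distribs fun_eq_iff)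
  show "sdiv (pscale c u) = sscale c (sdiv u)"
    by (simp add: sdiv_def pscale_def dx_linear dy_linear smul_distribs fun_eq_iff algebra_simps)
  assume u: "pord k u"
  show "ord k (sdiv u)"
  proof (cases k)
    case (Suc m)
    then have "ord (1 + m) (smul (svar 0) (dx (fst u)))" "ord (1 + m) (smul (svar 1) (dy (snd u)))"
      using u by (intro ord_smul ord_svar ord_dx; simp add: pord_def)+
    then show ?thesis unfolding sdiv_def Suc by (intro ord_sadd) simp_all
  qed simp
qed

lemma ord_tact: "pord k u \<Longrightarrow> ord m f \<Longrightarrow> ord (m + k) (tact u f)"
  unfolding tact_def by (rule ord_sder) (auto simp: pord_def intro: ord_tgen)

lemma pord_tbr: assumes "pord i u" "pord j v" shows "pord (i + j) (tbr u v)"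
proof -
  have "ord (i + j) (tact u (fst v))" "ord (i + j) (tact u (snd v))"
    "ord (i + j) (tact v (fst u))" "ord (i + j) (tact v (snd u))"
    using ord_tact[OF assms(1), of j] ord_tact[OF assms(2), of i] assms
    by (auto simp: pord_def add.commute)
  moreover have "ord (i + j) (sbr (fst u) (fst v))" "ord (i + j) (sbr (snd u) (snd v))"
    using assms by (auto simp: pord_def intro: ord_sbr)
  ultimately show ?thesis
    unfolding pord_def tbr_def fst_conv snd_conv by (intro conjI ord_sadd ord_ssub)
qed

lemma tder2_szero: "(szero, szero) \<in> tder2"
  by (simp add: tder2_iff lie_szero)

lemma tder2_padd: "u \<in> tder2 \<Longrightarrow> v \<in> tder2 \<Longrightarrow> padd u v \<in> tder2"
  by (simp add: tder2_iff padd_def lie_sadd)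

lemma tder2_pscale: "u \<in> tder2 \<Longrightarrow> pscale c u \<in> tder2"
  by (simp add: tder2_iff pscale_def lie_sscale)

lemma lie_locally_finite_sum:
  assumes "\<And>e. F e \<in> lie n"
  shows "(\<lambda>v. \<Sum>e\<in>{0..length v}. F e v) \<in> lie n"
  unfolding lie_def
proof (intro CollectI allI)
  fix d
  have "homog d (\<lambda>v. \<Sum>e\<in>{0..length v}. F e v) = (\<lambda>v. \<Sum>e\<in>{0..d}. homog d (F e) v)"
    by (auto simp: homog_apply fun_eq_iff)
  also have "\<dots> \<in> lie_poly n"
    by (rule lie_poly_sum) (use assms in \<open>unfold lie_def, blast\<close>)
  finally show "homog d (\<lambda>v. \<Sum>e\<in>{0..length v}. F e v) \<in> lie_poly n" .
qed

lemma tder2_pser: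
  assumes "\<And>e. W e \<in> tder2" "\<And>e. pord e (W e)" shows "pser W \<in> tder2"
proof -
  have W: "fst (W e) \<in> lie 2" "snd (W e) \<in> lie 2" "ord e (fst (W e))" "ord e (snd (W e))"
    "fst (W e) [0] = 0" "snd (W e) [1] = 0" for e
    using assms(1)[of e] assms(2)[of e] by (auto simp: tder2_iff pord_def)
  have "fst (pser W) \<in> lie 2" "snd (pser W) \<in> lie 2"
    unfolding pser_def fst_conv snd_conv by (rule lie_locally_finite_sum; rule W)+
  moreover have "fst (pser W) [0] = 0" "snd (pser W) [1] = 0"
    unfolding pser_def fst_conv snd_conv by (intro sum.neutral ballI, rule W)+
  ultimately show ?thesis unfolding tder2_iff by blast
qed

subsection \<open>The affine representation\<close>

definition aff :: "'k::field_char_0 ser \<times> 'k ser \<Rightarrow> 'k ser \<Rightarrow> 'k ser" where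
  "aff u f = sadd (tact u f) (sscale (f []) (sdiv u))"

text \<open>Equality with the affine operator of \<open>w\<close> would be too strong: the cocycle
  identity for div holds only modulo traces, so brackets of affine operators deviate at 1. The
  action on series without constant term is kept exact, because it governs how further operators
  move that deviation.\<close>

definition arep :: "'k::field_char_0 ser \<times> 'k ser \<Rightarrow> ('k ser \<Rightarrow> 'k ser) \<Rightarrow> bool" where
  "arep w L \<longleftrightarrow> (\<forall>f. in_alph 2 f \<and> f [] = 0 \<longrightarrow> L f = tact w f) \<and> tr_zero 2 (ssub (L sone) (sdiv w))"

lemma ord_sdiv: "ord 1 (sdiv u)"
  by (simp add: ord_def sdiv_Nil)

lemma raising_aff: assumes "tpair u" shows "raising (aff u)"
  unfolding raising_def slin_def
proof (intro conjI allI impI)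
  fix f g :: "'a ser" and c :: 'a and n
  show "aff u (sadd f g) = sadd (aff u f) (aff u g)"
    by (rule ext) (simp add: aff_def tact_linear assms algebra_simps)
  show "aff u (sscale c f) = sscale c (aff u f)"
    by (rule ext) (simp add: aff_def tact_linear assms algebra_simps)
  assume f: "ord n f"
  have "ord (Suc n) (tact u f)" using raising_tact[OF assms] f by (simp add: raising_def)
  moreover have "ord (Suc n) (sscale (f []) (sdiv u))"
  proof (cases n)
    case 0 then show ?thesis using ord_sscale[OF ord_sdiv, of "f []" u] by (simp del: ser_apply)
  next
    case (Suc m)
    then have "f [] = 0" using f by (simp add: ord_def)
    then show ?thesis by (simp add: ord_def)
  qed
  ultimately show "ord (Suc n) (aff u f)" unfolding aff_def by (rule ord_sadd)
qed

lemma aff_reduced: "f [] = 0 \<Longrightarrow> aff u f = tact u f"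
  by (simp add: aff_def fun_eq_iff)

lemma aff_sone: "tpair u \<Longrightarrow> aff u sone = sdiv u"
  by (simp add: aff_def fun_eq_iff tact_sone sone_apply)

lemma arep_aff: "tpair u \<Longrightarrow> arep u (aff u)"
proof -
  assume u: "tpair u"
  have "ssub (aff u sone) (sdiv u) = szero" by (simp add: aff_sone u fun_eq_iff)
  then show ?thesis by (simp add: arep_def aff_reduced tr_zero_szero)
qed

lemma arep_sone:
  assumes "arep w L"
  obtains z where "tr_zero 2 z" "L sone = sadd (sdiv w) z"
proof
  show "tr_zero 2 (ssub (L sone) (sdiv w))" using assms by (simp add: arep_def)
  show "L sone = sadd (sdiv w) (ssub (L sone) (sdiv w))" by (rule ext) simp
qed

lemma arep_szero: "arep (szero, szero) (\<lambda>f. szero)"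
proof -
  have "sdiv (szero, szero) = (szero :: 'a ser)" by (rule pcont_szero[OF pcont_sdiv])
  moreover have "ssub szero szero = (szero :: 'a ser)" by (rule ext) simp
  ultimately show ?thesis
    unfolding arep_def by (simp add: pcont_szero[OF pcont_tact] tr_zero_szero del: ser_apply)
qed

lemma arep_padd:
  assumes "arep u K" "arep v L" shows "arep (padd u v) (\<lambda>f. sadd (K f) (L f))"
proof -
  have "ssub (sadd (K sone) (L sone)) (sdiv (padd u v))
      = sadd (ssub (K sone) (sdiv u)) (ssub (L sone) (sdiv v))"
    by (rule ext) (simp add: pcontD[OF pcont_sdiv])
  then show ?thesis
    using assms by (simp add: arep_def pcontD[OF pcont_tact] tr_zero_sadd del: ser_apply)
qed

lemma arep_pscale:
  assumes "arep u L" shows "arep (pscale c u) (\<lambda>f. sscale c (L f))"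
proof -
  have "ssub (sscale c (L sone)) (sdiv (pscale c u)) = sscale c (ssub (L sone) (sdiv u))"
    by (rule ext) (simp add: pcontD[OF pcont_sdiv] algebra_simps)
  then show ?thesis
    using assms by (simp add: arep_def pcontD[OF pcont_tact] tr_zero_sscale del: ser_apply)
qed

text \<open>The trace errors y and z at 1 have no constant term, so the other operator acts on them
  as a derivation and preserves the vanishing of their trace. The rest is the cocycle identity
  \<open>sdiv_tbr\<close>.\<close>

lemma arep_tbr:
  assumes u: "tpair u" and v: "tpair v" and K: "arep u K" and L: "arep v L"
  shows "arep (tbr u v) (\<lambda>f. ssub (K (L f)) (L (K f)))"
  unfolding arep_def
proof (intro conjI allI impI)
  have Kt: "K f = tact u f" and Lt: "L f = tact v f" if "in_alph 2 f" "f [] = 0" for f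
    using K L that by (auto simp: arep_def)
  show "ssub (K (L f)) (L (K f)) = tact (tbr u v) f" if f: "in_alph 2 f \<and> f [] = 0" for f
  proof -
    have "K (L f) = tact u (tact v f)" "L (K f) = tact v (tact u f)"
      using f Kt[of f] Lt[of f] Kt[of "tact v f"] Lt[of "tact u f"]
      by (simp_all add: in_alph_tact tact_Nil u v del: ser_apply)
    then show ?thesis using tact_tbr[OF u v, of f] f by (simp del: ser_apply)
  qed
  obtain y where y: "tr_zero 2 y" "K sone = sadd (sdiv u) y" by (rule arep_sone[OF K])
  obtain z where z: "tr_zero 2 z" "L sone = sadd (sdiv v) z" by (rule arep_sone[OF L])
  have "in_alph 2 (sadd (sdiv v) z)" "sadd (sdiv v) z [] = 0"
    "in_alph 2 (sadd (sdiv u) y)" "sadd (sdiv u) y [] = 0"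
    using y z by (auto simp: tr_zero_iff sdiv_Nil simp del: in_alph_szero intro!: in_alph_sadd[unfolded sadd_def] in_alph_sdiv u v in_alph_sadd)
  then have "K (L sone) = sadd (tact u (sdiv v)) (tact u z)" "L (K sone) = sadd (tact v (sdiv u)) (tact v y)"
    unfolding y(2) z(2) by (simp_all only: Kt Lt tact_linear u v)
  then have "ssub (ssub (K (L sone)) (L (K sone))) (sdiv (tbr u v))
      = ssub (ssub (tact u z) (tact v y)) (ssub (sdiv (tbr u v)) (ssub (tact u (sdiv v)) (tact v (sdiv u))))"
    by (simp add: fun_eq_iff)
  moreover have "tr_zero 2 \<dots>"
    by (intro tr_zero_ssub tr_zero_tact sdiv_tbr u v y z)
  ultimately show "tr_zero 2 (ssub (ssub (K (L sone)) (L (K sone))) (sdiv (tbr u v)))" by simp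
qed

lemma arep_cong: "arep w L \<Longrightarrow> (\<And>f. L f = L' f) \<Longrightarrow> arep w L'"
  by (simp add: arep_def)

lemma pord_szero: "pord e (szero, szero)"
  by (simp add: pord_def ord_def)

lemma arep_sum:
  assumes "finite I" "\<And>i. i \<in> I \<Longrightarrow> \<exists>w \<in> tder2. pord e w \<and> arep w (F i)"
  shows "\<exists>w \<in> tder2. pord e w \<and> arep w (\<lambda>f v. \<Sum>i\<in>I. F i f v)"
  using assms
proof (induction I rule: finite_induct)
  case empty
  have "arep (szero, szero) (\<lambda>f v. \<Sum>i\<in>{}. F i f v)"
    by (rule arep_cong[OF arep_szero]) (simp add: fun_eq_iff)
  then show ?case using tder2_szero pord_szero by blast
next
  case (insert i I)
  then obtain w where w: "w \<in> tder2" "pord e w" "arep w (\<lambda>f v. \<Sum>i\<in>I. F i f v)" by auto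
  obtain w' where w': "w' \<in> tder2" "pord e w'" "arep w' (F i)"
    using insert.prems[of i] by blast
  have "arep (padd w' w) (\<lambda>f v. \<Sum>i\<in>insert i I. F i f v)"
    by (rule arep_cong[OF arep_padd[OF w'(3) w(3)]]) (use insert in \<open>simp add: fun_eq_iff\<close>)
  moreover have "pord e (padd w' w)" using w w' by (simp add: pord_def padd_def ord_sadd del: ser_apply)
  ultimately show ?case using tder2_padd[OF w'(1) w(1)] by blast
qed

text \<open>Each homogeneous component is treated separately, since the polynomials met in the
  induction need not be homogeneous. The bound \<open>pord e\<close> is carried along so that the
  derivations found in the various degrees can later be summed.\<close>

lemma arep_lie_poly:
  fixes p :: "'k::field_char_0 ser"
  assumes u: "u \<in> tder2" and v: "v \<in> tder2" and p: "p \<in> lie_poly 2"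
  defines "s \<equiv> (\<lambda>i::nat. if i = 0 then aff u else aff v)"
  shows "\<exists>w \<in> tder2. pord e w \<and> arep w (ev 2 s (homog e p))"
  using p
proof (induction arbitrary: e rule: lie_poly.induct)
  note t = tpair_tder2[OF u] tpair_tder2[OF v]
  have s: "raising (s i)" for i by (simp add: s_def raising_aff t)
  note lin = slinD[OF cont_slin[OF cont_ev_left[of 2 s, OF s]]]
  note hlin = slinD[OF cont_slin[OF cont_homog]]
  case lp_zero
  have "arep (szero, szero) (ev 2 s (homog e szero))"
    by (rule arep_cong[OF arep_szero]) (simp only: hlin lin)
  then show ?case using tder2_szero pord_szero by blast
next
  case (lp_var i)
  note t = tpair_tder2[OF u] tpair_tder2[OF v]
  have s: "raising (s i)" for i by (simp add: s_def raising_aff t)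
  note lin = slinD[OF cont_slin[OF cont_ev_left[of 2 s, OF s]]]
  have h: "(homog e (svar i) :: 'k ser) = (if e = 1 then svar i else szero)"
    by (rule ext) (auto simp: homog_apply svar_def)
  show ?case
  proof (cases "e = 1")
    case True
    let ?w = "if i = 0 then u else v"
    have "arep ?w (s i)" by (simp add: s_def arep_aff t)
    moreover have "(homog e (svar i) :: 'k ser) = svar i" using h True by simp
    moreover have "ev 2 s (svar i) = s i" using ev_svar[of 2 s, OF s lp_var] by (simp add: fun_eq_iff)
    ultimately have "arep ?w (ev 2 s (homog e (svar i)))" by metis
    moreover have "pord e ?w" using t by (simp add: True pord_def tpair_def ord_1_iff)
    ultimately show ?thesis using u v by auto
  next
    case False
    have "arep (szero, szero) (ev 2 s (homog e (svar i)))"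
      by (rule arep_cong[OF arep_szero]) (simp only: h False if_False lin)
    then show ?thesis using tder2_szero pord_szero by blast
  qed
next
  case (lp_add p q)
  note t = tpair_tder2[OF u] tpair_tder2[OF v]
  have s: "raising (s i)" for i by (simp add: s_def raising_aff t)
  note lin = slinD[OF cont_slin[OF cont_ev_left[of 2 s, OF s]]]
  note hlin = slinD[OF cont_slin[OF cont_homog]]
  obtain w w' where w: "w \<in> tder2" "pord e w" "arep w (ev 2 s (homog e p))"
    and w': "w' \<in> tder2" "pord e w'" "arep w' (ev 2 s (homog e q))"
    using lp_add by blast
  have "arep (padd w w') (ev 2 s (homog e (sadd p q)))"
    by (rule arep_cong[OF arep_padd[OF w(3) w'(3)]]) (simp only: hlin lin)
  moreover have "pord e (padd w w')" using w w' by (simp add: pord_def padd_def ord_sadd del: ser_apply)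
  ultimately show ?case using tder2_padd[OF w(1) w'(1)] by blast
next
  case (lp_scale p c)
  note t = tpair_tder2[OF u] tpair_tder2[OF v]
  have s: "raising (s i)" for i by (simp add: s_def raising_aff t)
  note lin = slinD[OF cont_slin[OF cont_ev_left[of 2 s, OF s]]]
  note hlin = slinD[OF cont_slin[OF cont_homog]]
  obtain w where w: "w \<in> tder2" "pord e w" "arep w (ev 2 s (homog e p))" using lp_scale by blast
  have "arep (pscale c w) (ev 2 s (homog e (sscale c p)))"
    by (rule arep_cong[OF arep_pscale[OF w(3)]]) (simp only: hlin lin)
  moreover have "pord e (pscale c w)" using w by (simp add: pord_def pscale_def ord_sscale del: ser_apply)
  ultimately show ?case using tder2_pscale[OF w(1)] by blast
next
  case (lp_br p q)
  note t = tpair_tder2[OF u] tpair_tder2[OF v]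
  have s: "raising (s i)" for i by (simp add: s_def raising_aff t)
  note lin = slinD[OF cont_slin[OF cont_ev_left[of 2 s, OF s]]]
  have al: "in_alph 2 (homog i p)" "in_alph 2 (homog i q)" for i
    using lp_br by (auto intro: in_alph_homog in_alph_lie_poly)
  \<comment> \<open>Component e of a bracket is a sum of brackets of components i and e - i, and the
    orders of the corresponding derivations add up to e.\<close>
  have "\<exists>w \<in> tder2. pord e w \<and> arep w (ev 2 s (sbr (homog i p) (homog (e - i) q)))"
    if i: "i \<in> {0..e}" for i
  proof -
    obtain w w' where w: "w \<in> tder2" "pord i w" "arep w (ev 2 s (homog i p))"
      and w': "w' \<in> tder2" "pord (e - i) w'" "arep w' (ev 2 s (homog (e - i) q))"
      using lp_br.IH by metis
    have "arep (tbr w w') (ev 2 s (sbr (homog i p) (homog (e - i) q)))"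
    proof (rule arep_cong[OF arep_tbr[OF _ _ w(3) w'(3)]])
      show "tpair w" "tpair w'" using w w' by (auto intro: tpair_tder2)
      show "ssub (ev 2 s (homog i p) (ev 2 s (homog (e - i) q) f)) (ev 2 s (homog (e - i) q) (ev 2 s (homog i p) f))
          = ev 2 s (sbr (homog i p) (homog (e - i) q)) f" for f
        unfolding sbr_def lin by (simp only: ev_smul[of 2 s, OF s] al)
    qed
    moreover have "pord e (tbr w w')" using pord_tbr[OF w(2) w'(2)] i by simp
    ultimately show ?thesis using tbr_tder2[OF w(1) w'(1)] by blast
  qed
  then have "\<exists>w \<in> tder2. pord e w \<and>
      arep w (\<lambda>f v. \<Sum>i\<in>{0..e}. ev 2 s (sbr (homog i p) (homog (e - i) q)) f v)"
    by (intro arep_sum) auto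
  moreover have "(\<lambda>f v. \<Sum>i\<in>{0..e}. ev 2 s (sbr (homog i p) (homog (e - i) q)) f v) = ev 2 s (homog e (sbr p q))"
  proof
    fix f
    have "ev 2 s (\<lambda>v. \<Sum>i\<in>{0..e}. 1 * sbr (homog i p) (homog (e - i) q) v) f
      = (\<lambda>v. \<Sum>i\<in>{0..e}. 1 * ev 2 s (sbr (homog i p) (homog (e - i) q)) f v)"
      by (rule slin_sum[OF cont_slin[OF cont_ev_left[of 2 s, OF s]]])
    then show "(\<lambda>v. \<Sum>i\<in>{0..e}. ev 2 s (sbr (homog i p) (homog (e - i) q)) f v) = ev 2 s (homog e (sbr p q)) f"
      unfolding homog_sbr by (simp only: mult_1_left)
  qed
  ultimately show ?case by metis
qed

lemma arep_lie:
  fixes P :: "'k::field_char_0 ser"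
  assumes u: "u \<in> tder2" and v: "v \<in> tder2" and P: "P \<in> lie 2"
  defines "s \<equiv> (\<lambda>i::nat. if i = 0 then aff u else aff v)"
  shows "\<exists>w \<in> tder2. arep w (ev 2 s P)"
proof -
  note t = tpair_tder2[OF u] tpair_tder2[OF v]
  have s: "raising (s i)" for i by (simp add: s_def raising_aff t)
  have hh: "homog e (homog e P) = homog e P" for e by (rule ext) (simp add: homog_apply)
  have "\<exists>w \<in> tder2. pord e w \<and> arep w (ev 2 s (homog e P))" for e
    using arep_lie_poly[OF u v, of "homog e P" e] P by (simp only: hh s_def lie_def mem_Collect_eq)
  \<comment> \<open>One derivation of order at least e for each degree e; their sum
    \<open>pser W\<close> is the derivation sought.\<close>
  then obtain W where W: "\<And>e. W e \<in> tder2" "\<And>e. pord e (W e)" "\<And>e. arep (W e) (ev 2 s (homog e P))"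
    by metis
  have expand: "ev 2 s P f v = (\<Sum>e\<in>{0..length v}. ev 2 s (homog e P) f v)" for f :: "'k ser" and v
    by (rule cont_homog_expand[OF cont_ev_left[of 2 s f, OF s] order_refl])
  have "arep (pser W) (ev 2 s P)"
    unfolding arep_def
  proof (intro conjI allI impI)
    fix f :: "'k ser" assume f: "in_alph 2 f \<and> f [] = 0"
    show "ev 2 s P f = tact (pser W) f"
    proof
      fix v
      have "ev 2 s P f v = (\<Sum>e\<in>{0..length v}. tact (W e) f v)"
        unfolding expand using W(3) f by (simp add: arep_def)
      then show "ev 2 s P f v = tact (pser W) f v"
        using pcont_pser[OF pcont_tact W(2)] by metis
    qed
  next
    let ?z = "ssub (ev 2 s P sone) (sdiv (pser W))"
    \<comment> \<open>The trace error at 1 contributed by the e-th piece. The total error is a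
      locally finite sum of these, so its cyclic sum vanishes too.\<close>
    define z where "z e = ssub (ev 2 s (homog e P) sone) (sdiv (W e))" for e
    have z: "tr_zero 2 (z e)" for e using W(3)[of e] by (simp add: arep_def z_def)
    have zs: "?z v = (\<Sum>e\<in>{0..length v}. z e v)" for v
      unfolding ser_apply expand pcont_pser[OF pcont_sdiv W(2)] by (simp add: z_def sum_subtractf)
    have "csum ?z = szero"
    proof
      fix v :: "nat list"
      have "csum ?z v = (\<Sum>e\<in>{0..length v}. csum (z e) v)"
        unfolding csum_def zs by (simp add: sum.swap[of _ "{..<length v}"])
      then show "csum ?z v = szero v" using z by (simp add: tr_zero_iff)
    qed
    moreover have "in_alph 2 ?z"
      unfolding in_alph_def
    proof (intro allI impI)
      fix v assume "?z v \<noteq> 0"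
      then obtain e where "z e v \<noteq> 0" unfolding zs by (meson sum.neutral)
      then show "set v \<subseteq> {..<2}" using z[of e] by (auto simp: tr_zero_iff in_alph_def)
    qed
    moreover have "?z [] = 0" unfolding zs using z by (simp add: tr_zero_iff)
    ultimately show "tr_zero 2 ?z" unfolding tr_zero_iff by blast
  qed
  then show ?thesis using tder2_pser[OF W(1,2)] by blast
qed

subsection \<open>Composition of exponentials\<close>

text \<open>The power series (e^t - 1)/t. Its constant term 1 makes it invertible, so div u can be
  recovered from j(exp u).\<close>

definition phi :: "'k::field_char_0 fps" where
  "phi = Abs_fps (\<lambda>m. 1 / fact (Suc m))"

lemma jser_eq: "jser u = fev (tact u) phi (sdiv u)"
  by (simp add: jser_def fev_def phi_def fun_eq_iff)

text \<open>After one application of \<open>L\<close> the constant term is gone and \<open>w\<close>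
  alone acts; the iterate of index m + 1 carries the factor 1/(m + 1)!, the m-th coefficient of
  \<open>phi\<close>. The vector \<open>L sone\<close> is left general because it will be div w only
  modulo traces.\<close>

lemma exp_sone:
  assumes L: "raising L" and eq: "\<And>f. in_alph 2 f \<Longrightarrow> f [] = 0 \<Longrightarrow> L f = tact w f"
    and w: "tpair w" and al: "in_alph 2 (L sone)"
  shows "fev L (fps_exp 1) sone = sadd sone (fev (tact w) phi (L sone))"
proof
  fix v :: "nat list"
  have Nil: "L sone [] = 0" by (rule raising_Nil[OF L])
  have p: "(L ^^ Suc m) sone = (tact w ^^ m) (L sone) \<and> in_alph 2 ((L ^^ Suc m) sone)
      \<and> (L ^^ Suc m) sone [] = 0" for m
  proof (induction m)
    case (Suc m)
    let ?f = "(L ^^ Suc m) sone"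
    have "L ?f = tact w ?f" using Suc by (intro eq) blast+
    then have "(L ^^ Suc (Suc m)) sone = tact w ?f"
      by (simp only: funpow.simps comp_apply)
    moreover have "tact w ?f = (tact w ^^ Suc m) (L sone)"
      unfolding Suc[THEN conjunct1] by (simp only: funpow.simps comp_apply)
    ultimately show ?case
      using in_alph_tact[OF w, of ?f] tact_Nil[OF w, of ?f] by metis
  qed (simp add: al Nil del: ser_apply)
  have c: "fps_nth (fps_exp 1) (Suc m) * (L ^^ Suc m) sone v = fps_nth phi m * (tact w ^^ m) (L sone) v" for m
    unfolding p[THEN conjunct1] by (simp add: phi_def algebra_simps)
  have "fev L (fps_exp 1) sone v = (\<Sum>m\<in>{0..Suc (length v)}. fps_nth (fps_exp 1) m * (L ^^ m) sone v)"
    by (rule fev_extend[OF L]) simp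
  also have "\<dots> = sone v + (\<Sum>m\<in>{0..length v}. fps_nth phi m * (tact w ^^ m) (L sone) v)"
    unfolding sum.atLeast0_atMost_Suc_shift comp_def c by simp
  finally show "fev L (fps_exp 1) sone v = sadd sone (fev (tact w) phi (L sone)) v"
    by (simp add: fev_def)
qed

lemma fev_reduced:
  assumes eq: "\<And>f. in_alph 2 f \<Longrightarrow> f [] = 0 \<Longrightarrow> L f = tact w f" and w: "tpair w"
    and f: "in_alph 2 f" "f [] = 0"
  shows "fev L F f = fev (tact w) F f"
  by (rule fev_cong_on[where K = "\<lambda>f. in_alph 2 f \<and> f [] = 0"])
    (use assms in \<open>auto simp: in_alph_tact tact_Nil\<close>)

lemma in_alph_sexp_svar: "i < n \<Longrightarrow> in_alph n (sexp (svar i))"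
  unfolding sexp_eq by (intro in_alph_fev in_alph_smul in_alph_svar in_alph_sone)

lemma sexp_Nil: "sexp f [] = 1"
  by (simp add: sexp_def spow_def sone_apply)

lemma in_alph_fev_tact: "tpair u \<Longrightarrow> in_alph 2 f \<Longrightarrow> in_alph 2 (fev (tact u) F f)"
  by (rule in_alph_fev) (rule in_alph_tact)

lemma in_alph_jser: "tpair u \<Longrightarrow> in_alph 2 (jser u)"
  unfolding jser_eq by (intro in_alph_fev_tact in_alph_sdiv)

lemma fev_Nil: "fev A F f [] = fps_nth F 0 * f []"
  by (simp add: fev_def)

lemma jser_Nil: "jser u [] = 0"
  by (simp add: jser_eq fev_Nil sdiv_Nil)

lemma aff_exp_sone: assumes u: "tpair u" shows "fev (aff u) (fps_exp 1) sone = sadd sone (jser u)"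
  using exp_sone[OF raising_aff[OF u] aff_reduced u] in_alph_sdiv[OF u]
  by (simp only: aff_sone[OF u] jser_eq)

lemma tder2_bch:
  fixes u v :: "'k::field_char_0 ser \<times> 'k ser"
  assumes ch: "(ch :: 'k ser) \<in> lie 2" and u: "u \<in> tder2" and v: "v \<in> tder2"
  obtains w where "w \<in> tder2" "\<And>f. in_alph 2 f \<Longrightarrow> f [] = 0 \<Longrightarrow> texp w f = texp u (texp v f)"
    "tr_zero 2 (ssub (jser w) (sadd (jser u) (texp u (jser v))))"
proof -
  define s where "s = (\<lambda>i::nat. if i = 0 then aff u else aff v)"
  note t = tpair_tder2[OF u] tpair_tder2[OF v]
  have s: "raising (s i)" for i by (simp add: s_def raising_aff t)
  obtain w where w: "w \<in> tder2" "arep w (ev 2 s ch)"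
    using arep_lie[OF u v ch] unfolding s_def by blast
  note tw = tpair_tder2[OF w(1)]
  have chN: "(ch :: 'k ser) [] = 0" and cha: "in_alph 2 (ch :: 'k ser)"
    using ch by (auto intro: lie_Nil in_alph_lie)
  have "sexp (ch :: 'k ser) = smul (sexp (svar 0)) (sexp (svar 1))"
    unfolding ch_def by (rule sexp_sln) (simp add: sexp_Nil)
  then have "ev 2 s (sexp ch) f = ev 2 s (sexp (svar 0)) (ev 2 s (sexp (svar 1)) f)" for f
    by (simp only: ev_smul[of 2 s, OF s in_alph_sexp_svar in_alph_sexp_svar] pos2 one_less_numeral_iff semiring_norm)
  moreover have "ev 2 s (sexp P) f = fev (ev 2 s P) (fps_exp 1) f" if "in_alph 2 P" "P [] = 0" for P f
    unfolding sexp_eq by (rule ev_fev[of 2 s, OF s that])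
  moreover have "ev 2 s (svar 0) = aff u" "ev 2 s (svar 1) = aff v"
    using ev_svar[of 2 s 0, OF s] ev_svar[of 2 s 1, OF s] by (auto simp: s_def)
  ultimately have E: "fev (ev 2 s ch) (fps_exp 1) f = fev (aff u) (fps_exp 1) (fev (aff v) (fps_exp 1) f)" for f
    by (simp only: cha chN in_alph_svar svar_Nil pos2 one_less_numeral_iff semiring_norm)
  have r: "ev 2 s ch f = tact w f" if "in_alph 2 f" "f [] = 0" for f
    using w(2) that by (simp add: arep_def)
  \<comment> \<open>Away from constant terms the three affine exponentials reduce to automorphisms,
    so \<open>E\<close> becomes the composition law.\<close>
  have tE: "texp w f = texp u (texp v f)" if f: "in_alph 2 f" "f [] = 0" for f
  proof -
    have "fev (aff v) (fps_exp 1) f = texp v f"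
      unfolding texp_eq by (rule fev_reduced[OF aff_reduced t(2) f])
    moreover have "fev (aff u) (fps_exp 1) (texp v f) = texp u (texp v f)"
      unfolding texp_eq by (rule fev_reduced[OF aff_reduced t(1)]) (simp_all add: in_alph_fev_tact t f fev_Nil)
    moreover have "fev (ev 2 s ch) (fps_exp 1) f = texp w f"
      unfolding texp_eq by (rule fev_reduced[OF r tw f])
    ultimately show ?thesis using E[of f] by simp
  qed
  obtain z where z: "tr_zero 2 z" "ev 2 s ch sone = sadd (sdiv w) z" by (rule arep_sone[OF w(2)])
  have za: "in_alph 2 (ev 2 s ch sone)"
    unfolding z(2) using z(1) by (intro in_alph_sadd in_alph_sdiv tw) (simp add: tr_zero_iff)
  have "fev (ev 2 s ch) (fps_exp 1) sone = sadd sone (fev (tact w) phi (sadd (sdiv w) z))"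
    using exp_sone[OF raising_ev[of 2 s ch, OF s chN] r tw za] unfolding z(2) .
  also have "fev (tact w) phi (sadd (sdiv w) z) = sadd (jser w) (fev (tact w) phi z)"
    unfolding jser_eq by (rule slinD(1)[OF cont_slin[OF cont_fev[OF raising_tact[OF tw]]]])
  finally have 1: "fev (ev 2 s ch) (fps_exp 1) sone = sadd sone (sadd (jser w) (fev (tact w) phi z))" .
  have "fev (aff u) (fps_exp 1) (jser v) = texp u (jser v)"
    unfolding texp_eq by (rule fev_reduced[OF aff_reduced t(1)]) (simp_all add: in_alph_jser t jser_Nil)
  then have 2: "fev (aff u) (fps_exp 1) (fev (aff v) (fps_exp 1) sone) = sadd (sadd sone (jser u)) (texp u (jser v))"
    by (simp only: aff_exp_sone t slinD(1)[OF cont_slin[OF cont_fev[OF raising_aff[OF t(1)]]]])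
  \<comment> \<open>Comparing both sides of \<open>E\<close> at 1 leaves only phi(w) z as
    discrepancy, and derivations preserve the vanishing of the trace of z.\<close>
  have "ssub (jser w) (sadd (jser u) (texp u (jser v))) = sscale (-1) (fev (tact w) phi z)"
  proof
    fix x
    have "sadd sone (sadd (jser w) (fev (tact w) phi z)) x = sadd (sadd sone (jser u)) (texp u (jser v)) x"
      using E[of sone] unfolding 1 2 by simp
    then show "ssub (jser w) (sadd (jser u) (texp u (jser v))) x = sscale (-1) (fev (tact w) phi z) x"
      by (simp add: algebra_simps)
  qed
  moreover have "tr_zero 2 (sscale (-1) (fev (tact w) phi z))"
    by (intro tr_zero_sscale tr_zero_fev raising_tact tr_zero_tact tw z)
  ultimately have "tr_zero 2 (ssub (jser w) (sadd (jser u) (texp u (jser v))))" by simp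
  with w(1) tE show thesis by (rule that)
qed

subsection \<open>Exponentials of derivations\<close>

lemma fev_const: "(\<And>m. m > 0 \<Longrightarrow> (A ^^ m) f = szero) \<Longrightarrow> fev A F f = sscale (fps_nth F 0) f"
proof
  fix v :: "nat list" assume z: "\<And>m. m > 0 \<Longrightarrow> (A ^^ m) f = szero"
  have "fev A F f v = (\<Sum>m\<in>{0..length v}. if m = 0 then fps_nth F 0 * f v else 0)"
    unfolding fev_def by (rule sum.cong) (auto simp: z)
  then show "fev A F f v = sscale (fps_nth F 0) f v" by simp
qed

lemma fev_kernel:
  assumes "raising A" "A f = szero" shows "fev A F f = sscale (fps_nth F 0) f"
proof (rule fev_const)
  fix m :: nat assume "m > 0"
  then obtain k where "m = Suc k" by (cases m) auto
  then have "(A ^^ m) f = (A ^^ k) szero" using assms(2) by (simp add: funpow_swap1 del: ser_apply)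
  then show "(A ^^ m) f = szero"
    using slinD(3)[OF cont_slin[OF cont_funpow[OF raising_cont[OF assms(1)]]]] by simp
qed

lemma fev_shift:
  assumes "raising A" shows "fev A F f = sadd (sscale (fps_nth F 0) f) (fev A (fps_shift 1 F) (A f))"
proof -
  have "F = fps_const (fps_nth F 0) + fps_shift 1 F * fps_X"
    by (rule fps_ext) (simp add: fps_const_def)
  then have "fev A F f = sadd (fev A (fps_const (fps_nth F 0)) f) (fev A (fps_shift 1 F * fps_X) f)"
    by (metis fev_add)
  moreover have "fev A (fps_const c) f = sscale c f" for c
  proof
    fix v :: "nat list"
    have "fev A (fps_const c) f v = (\<Sum>m\<in>{0..length v}. if m = 0 then c * f v else 0)"
      unfolding fev_def by (rule sum.cong) auto
    then show "fev A (fps_const c) f v = sscale c f v" by simp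
  qed
  ultimately show ?thesis by (simp only: fev_mult[OF assms] fev_X[OF assms])
qed

text \<open>The difference e^A f - f equals phi(A)(A f), and \<open>phi\<close> is
  invertible.\<close>

lemma exp_fixed_imp_kernel:
  assumes "raising A" "fev A (fps_exp 1) f = f" shows "A f = szero"
proof -
  have p: "fps_shift 1 (fps_exp 1) = (phi :: 'a fps)"
    by (rule fps_ext) (simp add: phi_def algebra_simps)
  note e = fev_shift[OF assms(1), of "fps_exp 1" f, unfolded p assms(2)]
  have "fev A phi (A f) = szero"
  proof
    fix x show "fev A phi (A f) x = szero x" using fun_cong[OF e, of x] by simp
  qed
  then have "fev A (inverse phi) (fev A phi (A f)) = szero"
    by (simp add: slinD(3)[OF cont_slin[OF cont_fev[OF assms(1)]]] del: ser_apply)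
  moreover have "inverse phi * phi = (1 :: 'a fps)"
    by (rule inverse_mult_eq_1) (simp add: phi_def)
  ultimately show ?thesis using fev_mult[OF assms(1), of "inverse phi" phi "A f"] by simp
qed

text \<open>This is e^(-t) e^t = 1 in k[[t]]. The negative operator is described pointwise so that
  the lemma serves both the derivation and the affine operator of a negated pair.\<close>

lemma exp_neg:
  assumes A: "raising A" and B: "\<And>f. B f = sscale (-1) (A f)"
  shows "fev B (fps_exp 1) (fev A (fps_exp 1) f) = f"
proof -
  note lin = slinD[OF cont_slin[OF cont_funpow[OF raising_cont[OF A]]]]
  have "(B ^^ m) g = sscale ((-1) ^ m) ((A ^^ m) g)" for m g
  proof (induction m)
    case (Suc m)
    have "A (sscale ((-1) ^ m) ((A ^^ m) g)) = sscale ((-1) ^ m) (A ((A ^^ m) g))"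
      by (rule slinD(2)) (use A in \<open>simp add: raising_def\<close>)
    then have "(B ^^ Suc m) g = sscale (-1) (sscale ((-1) ^ m) (A ((A ^^ m) g)))"
      by (simp only: funpow.simps comp_apply B Suc)
    then show ?case by (simp add: fun_eq_iff)
  qed (simp add: fun_eq_iff)
  then have "fev B (fps_exp 1) g = fev A (fps_exp (-1)) g" for g
    by (simp add: fev_def fun_eq_iff algebra_simps)
  then show ?thesis using fev_mult[OF A, of "fps_exp (-1)" "fps_exp 1" f]
    by (simp flip: fps_exp_add_mult)
qed

section \<open>Multiplicativity of the exponential of a derivation\<close>

lemma leibniz_funpow:
  assumes u: "tpair u" and f: "in_alph 2 f" and g: "in_alph 2 g"
  shows "(tact u ^^ m) (smul f g) =
    (\<lambda>v. \<Sum>i\<in>{0..m}. of_nat (m choose i) * smul ((tact u ^^ i) f) ((tact u ^^ (m - i)) g) v)"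
proof (induction m)
  case 0
  then show ?case by (simp add: fun_eq_iff)
next
  case (Suc m)
  define S where "S i j = smul ((tact u ^^ i) f) ((tact u ^^ j) g)" for i j
  have al: "in_alph 2 ((tact u ^^ i) f)" "in_alph 2 ((tact u ^^ i) g)" for i
    by (induction i) (simp_all add: f g in_alph_tact u)
  have d: "tact u (S i j) = sadd (S (Suc i) j) (S i (Suc j))" for i j
    unfolding S_def by (simp add: tact_smul u al del: ser_apply)
  have "(tact u ^^ Suc m) (smul f g) = tact u (\<lambda>v. \<Sum>i\<in>{0..m}. of_nat (m choose i) * S i (m - i) v)"
    using Suc by (simp add: S_def)
  also have "\<dots> = (\<lambda>v. \<Sum>i\<in>{0..m}. of_nat (m choose i) * tact u (S i (m - i)) v)"
    by (rule slin_sum[OF cont_slin[OF raising_cont[OF raising_tact[OF u]]]])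
  also have "\<dots> = (\<lambda>v. \<Sum>i\<in>{0..Suc m}. of_nat (Suc m choose i) * S i (Suc m - i) v)"
  proof
    fix v :: "nat list"
    have "(\<Sum>i\<in>{0..Suc m}. of_nat (Suc m choose i) * S i (Suc m - i) v)
        = S 0 (Suc m) v + (\<Sum>i\<in>{0..m}. of_nat (Suc m choose Suc i) * S (Suc i) (m - i) v)"
      by (subst sum.atLeast0_atMost_Suc_shift) (simp add: comp_def)
    also have "(\<Sum>i\<in>{0..m}. of_nat (Suc m choose Suc i) * S (Suc i) (m - i) v)
        = (\<Sum>i\<in>{0..m}. of_nat (m choose i) * S (Suc i) (m - i) v)
          + (\<Sum>i\<in>{0..m}. of_nat (m choose Suc i) * S (Suc i) (m - i) v)"
      by (simp add: sum.distrib[symmetric] algebra_simps)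
    also have "(\<Sum>i\<in>{0..m}. of_nat (m choose Suc i) * S (Suc i) (m - i) v)
        = (\<Sum>i\<in>{0..Suc m}. of_nat (m choose i) * S i (Suc m - i) v) - S 0 (Suc m) v"
      by (subst sum.atLeast0_atMost_Suc_shift) (simp add: comp_def)
    also have "(\<Sum>i\<in>{0..Suc m}. of_nat (m choose i) * S i (Suc m - i) v)
        = (\<Sum>i\<in>{0..m}. of_nat (m choose i) * S i (Suc (m - i)) v)"
      by (simp add: Suc_diff_le)
    finally show "(\<Sum>i\<in>{0..m}. of_nat (m choose i) * tact u (S i (m - i)) v)
        = (\<Sum>i\<in>{0..Suc m}. of_nat (Suc m choose i) * S i (Suc m - i) v)"
      by (simp add: d sum.distrib algebra_simps)
  qed
  finally show ?case by (simp add: S_def)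
qed

text \<open>The (i, j) term of the product has order i + j, which cuts the double sum to a triangle;
  on i + j = k the factors 1/(i! j!) are the binomial coefficients of the iterated Leibniz rule
  divided by k!.\<close>

lemma texp_smul:
  assumes u: "tpair u" and f: "in_alph 2 f" and g: "in_alph 2 g"
  shows "texp u (smul f g) = smul (texp u f) (texp u g)"
proof
  fix v :: "nat list"
  let ?N = "length v"
  note r = raising_tact[OF u]
  define H where "H i j = (1 / fact i * (1 / fact j)) * smul ((tact u ^^ i) f) ((tact u ^^ j) g) v" for i j
  have "smul (texp u f) (texp u g) v = (\<Sum>i\<in>{0..?N}. (1 / fact i) * smul ((tact u ^^ i) f) (texp u g) v)"
    unfolding texp_eq
    using fev_apply[of "tact u" "\<lambda>h. smul h (fev (tact u) (fps_exp 1) g)" v ?N "fps_exp 1" f, OF r cont_smul_left order_refl]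
    by simp
  also have "\<dots> = (\<Sum>i\<in>{0..?N}. \<Sum>j\<in>{0..?N}. H i j)"
    unfolding texp_eq
    using fev_apply[of "tact u" "smul ((tact u ^^ i) f)" v ?N "fps_exp 1" g for i, OF r cont_smul_right order_refl]
    by (simp add: H_def sum_distrib_left mult.assoc)
  also have "\<dots> = (\<Sum>k\<in>{0..?N}. \<Sum>i\<in>{0..k}. H i (k - i))"
  proof (rule sum_square_triangle)
    fix i j assume "?N < i + j"
    moreover have "ord (i + j) (smul ((tact u ^^ i) f) ((tact u ^^ j) g))"
      using ord_funpow[OF r ord_0, of i f] ord_funpow[OF r ord_0, of j g] by (intro ord_smul) simp_all
    ultimately show "H i j = 0" by (simp add: H_def ord_def)
  qed
  also have "\<dots> = (\<Sum>k\<in>{0..?N}. (tact u ^^ k) (smul f g) v / fact k)"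
    by (intro sum.cong refl)
      (simp add: leibniz_funpow[OF u f g] H_def sum_divide_distrib binomial_fact field_simps)
  also have "\<dots> = texp u (smul f g) v" by (simp add: texp_def)
  finally show "texp u (smul f g) v = smul (texp u f) (texp u g) v" ..
qed

lemma texp_sone: "tpair u \<Longrightarrow> texp u sone = sone"
  unfolding texp_eq using fev_kernel[OF raising_tact tact_sone, of u "fps_exp 1"] by (simp add: fun_eq_iff)

lemma texp_linear:
  assumes "tpair u"
  shows "texp u (sadd f g) = sadd (texp u f) (texp u g)" "texp u (ssub f g) = ssub (texp u f) (texp u g)"
    "texp u (sscale c f) = sscale c (texp u f)"
  unfolding texp_eq by (simp_all only: slinD[OF cont_slin[OF cont_fev[OF raising_tact[OF assms]]]])

lemma texp_neg: "tpair u \<Longrightarrow> texp (pscale (-1) u) (texp u f) = f"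
  unfolding texp_eq by (rule exp_neg) (simp_all only: raising_tact pcontD[OF pcont_tact])

lemma tpair_pscale: "tpair u \<Longrightarrow> tpair (pscale c u)"
  by (simp add: tpair_def pscale_def in_alph_sscale del: ser_apply) simp

text \<open>Negating u negates its affine operator on the nose. Evaluating exp(-u) exp(u) = 1 at 1
  therefore gives the cocycle formula for an inverse as an equality of series, not only of
  traces.\<close>

lemma jser_neg:
  assumes u: "tpair u"
  shows "jser (pscale (-1) u) = sscale (-1) (texp (pscale (-1) u) (jser u))"
proof -
  let ?u = "pscale (-1) u"
  note t = tpair_pscale[OF u, of "-1"]
  have "aff ?u f = sscale (-1) (aff u f)" for f
    by (rule ext) (simp add: aff_def pcontD[OF pcont_tact] pcontD[OF pcont_sdiv] algebra_simps)
  then have "fev (aff ?u) (fps_exp 1) (fev (aff u) (fps_exp 1) sone) = sone"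
    by (rule exp_neg[OF raising_aff[OF u]])
  then have "sadd (sadd sone (jser ?u)) (fev (aff ?u) (fps_exp 1) (jser u)) = sone"
    by (simp only: aff_exp_sone u t slinD(1)[OF cont_slin[OF cont_fev[OF raising_aff[OF t]]]])
  moreover have "fev (aff ?u) (fps_exp 1) (jser u) = texp ?u (jser u)"
    unfolding texp_eq by (rule fev_reduced[OF aff_reduced t]) (simp_all add: in_alph_jser u jser_Nil)
  ultimately show ?thesis by (simp add: fun_eq_iff eq_neg_iff_add_eq_0 add.assoc)
qed

subsection \<open>Equality of traces\<close>

lemma tr_eq_refl: "tr_eq n f f"
proof -
  have "ssub f f = szero" by (rule ext) simp
  then show ?thesis by (simp add: tr_eq_def tr_zero_szero)
qed

lemma tr_eq_sym: assumes "tr_eq n f g" shows "tr_eq n g f"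
proof -
  have "ssub g f = sscale (-1) (ssub f g)" by (rule ext) simp
  then show ?thesis using assms unfolding tr_eq_def by (metis tr_zero_sscale)
qed

lemma tr_eq_sadd: assumes "tr_eq n f g" "tr_eq n h k" shows "tr_eq n (sadd f h) (sadd g k)"
proof -
  have "ssub (sadd f h) (sadd g k) = sadd (ssub f g) (ssub h k)" by (rule ext) simp
  then show ?thesis using assms unfolding tr_eq_def by (metis tr_zero_sadd)
qed

lemma tr_eq_ssub: assumes "tr_eq n f g" "tr_eq n h k" shows "tr_eq n (ssub f h) (ssub g k)"
proof -
  have "ssub (ssub f h) (ssub g k) = ssub (ssub f g) (ssub h k)" by (rule ext) simp
  then show ?thesis using assms unfolding tr_eq_def by (metis tr_zero_ssub)
qed

lemma tr_eq_trans [trans]: assumes "tr_eq n f g" "tr_eq n g h" shows "tr_eq n f h"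
proof -
  have "ssub f h = sadd (ssub f g) (ssub g h)" by (rule ext) simp
  then show ?thesis using assms unfolding tr_eq_def by (metis tr_zero_sadd)
qed

lemma tr_eq_fev: assumes "tpair u" "tr_eq 2 f g" shows "tr_eq 2 (fev (tact u) F f) (fev (tact u) F g)"
proof -
  have "ssub (fev (tact u) F f) (fev (tact u) F g) = fev (tact u) F (ssub f g)"
    by (simp only: slinD(4)[OF cont_slin[OF cont_fev[OF raising_tact[OF assms(1)]]]])
  then show ?thesis
    using tr_zero_fev[OF raising_tact[OF assms(1)] tr_zero_tact[OF assms(1)], of "ssub f g"] assms(2)
    by (simp add: tr_eq_def del: ser_apply)
qed

text \<open>With G(t) = (F(t) - 1)/t one has F(u) f - f = G(u)(u f). Applied with F the exponential,
  \<open>phi\<close> and the inverse of \<open>phi\<close>.\<close>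

lemma tr_eq_fev_invariant:
  assumes u: "tpair u" and z: "tr_zero 2 (tact u f)" and F: "fps_nth F 0 = 1"
  shows "tr_eq 2 (fev (tact u) F f) f"
proof -
  have "ssub (fev (tact u) F f) f = fev (tact u) (fps_shift 1 F) (tact u f)"
    by (rule ext) (simp add: fev_shift[OF raising_tact[OF u], of F] F)
  then show ?thesis
    using tr_zero_fev[OF raising_tact[OF u] tr_zero_tact[OF u] z] by (simp add: tr_eq_def)
qed

subsection \<open>Power series in one element\<close>

text \<open>A word in a single letter is determined by its length, so substitution into a
  one-variable series is an instance of the functional calculus.\<close>

lemma ssubst_one: "ssubst 1 (\<lambda>_. p) h = fev (smul p) (Abs_fps (\<lambda>m. h (replicate m 0))) sone"
proof
  fix v :: "nat list"
  have f: "foldr smul (map (\<lambda>_. p) w) sone = (smul p ^^ length w) sone" for w :: "nat list"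
    by (induction w) simp_all
  have w: "w = replicate (length w) 0" if "set w \<subseteq> {..<1}" for w :: "nat list"
    using that by (induction w) auto
  have "ssubst 1 (\<lambda>_. p) h v = (\<Sum>w\<in>words 1 (length v). h w * (smul p ^^ length w) sone v)"
    unfolding ssubst_def f words_def ..
  also have "\<dots> = (\<Sum>m\<in>{0..length v}. h (replicate m 0) * (smul p ^^ m) sone v)"
  proof (rule sum.reindex_bij_witness[of _ "\<lambda>m. replicate m 0" length])
    fix a assume a: "a \<in> words 1 (length v)"
    then show "replicate (length a) 0 = a" using w[of a] by (simp add: words_def)
    then show "h (replicate (length a) 0) * (smul p ^^ length a) sone v = h a * (smul p ^^ length a) sone v"
      by simp
    show "length a \<in> {0..length v}" using a by (simp add: words_def)
  qed (auto simp: words_def)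
  finally show "ssubst 1 (\<lambda>_. p) h v = fev (smul p) (Abs_fps (\<lambda>m. h (replicate m 0))) sone v"
    by (simp add: fev_def)
qed

lemma in_alph_ssubst_one: "in_alph n p \<Longrightarrow> in_alph n (ssubst 1 (\<lambda>_. p) h)"
  unfolding ssubst_one by (intro in_alph_fev in_alph_smul in_alph_sone)

lemma ssubst_one_Nil: "ssubst 1 (\<lambda>_. p) h [] = h []"
  unfolding ssubst_one by (simp add: fev_Nil sone_apply)

lemma in_alph_smul_pow: "in_alph n p \<Longrightarrow> in_alph n ((smul p ^^ m) sone)"
  by (induction m) (simp_all add: in_alph_smul)

lemma texp_ssubst_one:
  assumes u: "tpair u" and p: "in_alph 2 p" "p [] = 0"
  shows "texp u (ssubst 1 (\<lambda>_. p) h) = ssubst 1 (\<lambda>_. texp u p) h"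
proof -
  have "texp u ((smul p ^^ m) sone) = (smul (texp u p) ^^ m) sone" for m
    by (induction m) (simp_all add: texp_sone u texp_smul p in_alph_smul_pow)
  moreover have "raising (smul p)" by (rule raising_smul) (rule p)
  moreover have "cont (texp u)" unfolding texp_eq by (rule cont_fev[OF raising_tact[OF u]])
  ultimately show ?thesis
    unfolding ssubst_one using fev_comm[of "smul p" "texp u" sone "smul (texp u p)" sone] by blast
qed

text \<open>Both u and bracketing with c are derivations; agreeing at p, they agree on every power
  series in p. The result is a commutator, so u kills the trace of h(p). This serves p = x and p =
  y, and p = x + y with c = 0.\<close>

lemma tact_power_sum:
  assumes u: "tpair u" and p: "in_alph 2 p" "p [] = 0" and c: "in_alph 2 c" "tact u p = sbr p c"
  shows "tact u (ssubst 1 (\<lambda>_. p) h) = sbr (ssubst 1 (\<lambda>_. p) h) c"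
proof
  fix v :: "nat list"
  have r: "raising (smul p)" by (rule raising_smul) (rule p)
  have "tact u ((smul p ^^ m) sone) = sbr ((smul p ^^ m) sone) c" for m
  proof (induction m)
    case 0
    show ?case by (simp add: tact_sone u sbr_def fun_eq_iff)
  next
    case (Suc m)
    let ?q = "(smul p ^^ m) sone"
    have "tact u (smul p ?q) = sadd (smul (sbr p c) ?q) (smul p (sbr ?q c))"
      using Suc by (simp add: tact_smul u p c(2) in_alph_smul_pow del: ser_apply)
    also have "\<dots> = sbr (smul p ?q) c"
      by (rule ext) (simp add: sbr_def smul_distribs smul_assoc)
    finally show ?case by simp
  qed
  moreover have "cont (\<lambda>f. sbr f c)"
    unfolding sbr_def by (rule cont_ssub[OF cont_smul_left cont_smul_right])
  ultimately show "tact u (ssubst 1 (\<lambda>_. p) h) v = sbr (ssubst 1 (\<lambda>_. p) h) c v"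
    unfolding ssubst_one
    using fev_apply[OF r raising_cont[OF raising_tact[OF u]] order_refl, of _ sone v]
      fev_apply[OF r, of "\<lambda>f. sbr f c" v "length v" _ sone] by simp
qed

subsection \<open>The cosimplicial differentials\<close>

definition delta1 :: "'k::field_char_0 ser \<Rightarrow> 'k ser" where
  "delta1 g = sadd (ssub (ssubst 1 (\<lambda>_. svar 0) g) (ssubst 1 (\<lambda>_. sadd (svar 0) (svar 1)) g))
     (ssubst 1 (\<lambda>_. svar 1) g)"

lemma in_alph_delta1: "in_alph 2 (delta1 g)"
  unfolding delta1_def by (intro in_alph_sadd in_alph_ssub in_alph_ssubst_one in_alph_svar) simp_all

lemma delta1_Nil: "g [] = 0 \<Longrightarrow> delta1 g [] = 0"
  unfolding delta1_def ser_apply ssubst_one_Nil by simp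

lemma dtilde_linear: "dtilde (sadd f g) = sadd (dtilde f) (dtilde g)" "dtilde (ssub f g) = ssub (dtilde f) (dtilde g)"
  by (rule ext, simp add: dtilde_def ssubst_def sum.distrib sum_subtractf algebra_simps)+

lemma tr1_sadd: "f \<in> tr1 \<Longrightarrow> g \<in> tr1 \<Longrightarrow> sadd f g \<in> tr1"
  unfolding tr1_def by (auto intro: in_alph_sadd simp del: One_nat_def)

lemma tr_zero_tact_svar_series:
  assumes u: "tpair u" and i: "i < 2"
  shows "tr_zero 2 (tact u (ssubst 1 (\<lambda>_. svar i) g))"
proof -
  have "\<exists>c. in_alph 2 c \<and> tact u (svar i) = sbr (svar i) c"
    using u i tact_svar[OF u i] by (auto simp: tgen_def tpair_def less_2_cases_iff)
  then obtain c where c: "in_alph 2 c" "tact u (svar i) = sbr (svar i) c" by blast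
  have "tact u (ssubst 1 (\<lambda>_. svar i) g) = sbr (ssubst 1 (\<lambda>_. svar i) g) c"
    by (rule tact_power_sum[OF u in_alph_svar[OF i] _ c]) simp
  then show ?thesis using tr_zero_sbr[OF in_alph_ssubst_one[OF in_alph_svar[OF i]] c(1)] by simp
qed

lemma tact_delta1:
  assumes u: "u \<in> sder2" shows "tr_zero 2 (tact u (delta1 g))"
proof -
  have t: "tpair u" and z: "tact u (sadd (svar 0) (svar 1)) = szero"
    using u by (auto simp: sder2_def intro: tpair_tder2)
  have b: "sbr f szero = szero" for f :: "'a ser" by (rule ext) (simp add: sbr_def)
  have "tact u (ssubst 1 (\<lambda>_. sadd (svar 0) (svar 1)) g)
      = sbr (ssubst 1 (\<lambda>_. sadd (svar 0) (svar 1)) g) szero"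
  proof (rule tact_power_sum[OF t])
    show "in_alph 2 (sadd (svar 0) (svar 1) :: 'a ser)" by (intro in_alph_sadd in_alph_svar) simp_all
    show "tact u (sadd (svar 0) (svar 1)) = sbr (sadd (svar 0) (svar 1)) szero" by (simp only: z b)
  qed simp_all
  also have "\<dots> = szero" by (rule b)
  finally have "tr_zero 2 (tact u (ssubst 1 (\<lambda>_. sadd (svar 0) (svar 1)) g))"
    by (simp add: tr_zero_szero del: ser_apply)
  then show ?thesis
    unfolding delta1_def tact_linear[OF t]
    by (intro tr_zero_sadd tr_zero_ssub tr_zero_tact_svar_series t) simp_all
qed

text \<open>A tangential derivation moves x and y by brackets with themselves, so its exponential
  fixes the traces of g(x) and g(y); only the middle term changes, where x + y becomes
  \<open>ch\<close>.\<close>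

lemma texp_delta1:
  assumes v: "tpair v" and ch: "texp v (sadd (svar 0) (svar 1)) = ch"
  shows "tr_eq 2 (texp v (delta1 g)) (dtilde g)"
proof -
  have e: "texp v (ssubst 1 (\<lambda>_. sadd (svar 0) (svar 1)) g) = ssubst 1 (\<lambda>_. ch) g"
    unfolding ch[symmetric] by (rule texp_ssubst_one[OF v]) (simp_all add: in_alph_sadd in_alph_svar)
  have "tr_eq 2 (texp v (ssubst 1 (\<lambda>_. svar i) g)) (ssubst 1 (\<lambda>_. svar i) g)" if "i < 2" for i
    unfolding texp_eq using that by (intro tr_eq_fev_invariant v tr_zero_tact_svar_series) simp_all
  then show ?thesis
    unfolding delta1_def dtilde_def texp_linear[OF v] e
    by (intro tr_eq_sadd tr_eq_ssub tr_eq_refl) simp_all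
qed

text \<open>Describes substitutions whose values are sums of distinct letters, no letter occurring
  in two of them: \<open>P\<close> selects the letters that occur and \<open>q\<close> returns the
  variable each came from. A word then has a single preimage, read off letter by letter.\<close>

lemma ssubst_letters:
  assumes s: "\<And>l w. l < n \<Longrightarrow> s l w = (if \<exists>c. w = [c] \<and> P c \<and> q c = l then 1 else 0)"
    and q: "\<And>c. P c \<Longrightarrow> q c < n"
  shows "ssubst n s f v = (if \<forall>c\<in>set v. P c then f (map q v) else 0)"
proof -
  have e: "foldr smul (map s w) sone v = (if (\<forall>c\<in>set v. P c) \<and> map q v = w then 1 else 0)"
    if "set w \<subseteq> {..<n}" for w
    using that
  proof (induction w arbitrary: v)
    case Nil
    then show ?case by (simp add: sone_apply)
  next
    case (Cons l w)
    have l: "l < n" using Cons.prems by simp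
    show ?case
    proof (cases v)
      case Nil
      then show ?thesis using s[OF l, of "[]"] by simp
    next
      case (Cons c v')
      have "(\<lambda>x. s l (c # x)) = (if P c \<and> q c = l then sone else szero)"
        by (rule ext) (simp add: s[OF l] sone_apply)
      moreover have "s l [] = 0" using s[OF l, of "[]"] by simp
      ultimately show ?thesis
        using Cons.IH[of v'] Cons.prems by (auto simp: Cons smul_Cons)
    qed
  qed
  have "ssubst n s f v = (\<Sum>w\<in>words n (length v). if w = map q v then (if \<forall>c\<in>set v. P c then f (map q v) else 0) else 0)"
    unfolding ssubst_def words_def[symmetric] by (rule sum.cong) (auto simp: words_def e)
  also have "\<dots> = (if \<forall>c\<in>set v. P c then f (map q v) else 0)"
    using q by (auto simp: words_def[of n "length v"] finite_words[unfolded words_def])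
  finally show ?thesis .
qed

lemma csum_ssubst_letters:
  assumes "\<And>l w. l < n \<Longrightarrow> s l w = (if \<exists>c. w = [c] \<and> P c \<and> q c = l then 1 else 0)"
    and "\<And>c. P c \<Longrightarrow> q c < n"
  shows "csum (ssubst n s f) v = (if \<forall>c\<in>set v. P c then csum f (map q v) else 0)"
proof (cases "\<forall>c\<in>set v. P c")
  case True
  have "ssubst n s f (rotate k v) = f (rotate k (map q v))" for k
    using ssubst_letters[where s=s and n=n and P=P and q=q and f=f and v="rotate k v", OF assms] True
    by (auto simp: rotate_map)
  then show ?thesis unfolding if_P[OF True] by (simp add: csum_def)
next
  case False
  have "ssubst n s f (rotate k v) = 0" for k
    using ssubst_letters[where s=s and n=n and P=P and q=q and f=f and v="rotate k v", OF assms] False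
    by (auto simp: rotate_map)
  then show ?thesis unfolding if_not_P[OF False] by (simp add: csum_def)
qed

lemma csum_delta1:
  "csum (delta1 g) v = (if \<forall>c\<in>set v. c = 0 then csum g (replicate (length v) 0) else 0)
    - (if \<forall>c\<in>set v. c < 2 then csum g (replicate (length v) 0) else 0)
    + (if \<forall>c\<in>set v. c = 1 then csum g (replicate (length v) 0) else 0)"
proof -
  have "csum (ssubst 1 (\<lambda>_. svar i) g) v = (if \<forall>c\<in>set v. c = i then csum g (map (\<lambda>_. 0) v) else 0)" for i
    by (rule csum_ssubst_letters) (auto simp: svar_def)
  moreover have "csum (ssubst 1 (\<lambda>_. sadd (svar 0) (svar 1)) g) v
      = (if \<forall>c\<in>set v. c < 2 then csum g (map (\<lambda>_. 0) v) else 0)"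
    by (rule csum_ssubst_letters) (auto simp: svar_def less_2_cases_iff)
  ultimately show ?thesis
    by (simp only: delta1_def csum_linear ser_apply map_replicate_const)
qed

text \<open>Truncated subtraction of letters serves two of the faces: on words without x it is the
  shift of y, z to x, y, and on all words it merges x with y, as the substitution of x + y
  demands.\<close>

lemma csum_delta2:
  "csum (delta2 f) v = (if \<forall>c\<in>set v. c = 1 \<or> c = 2 then csum f (map (\<lambda>c. c - 1) v) else 0)
    - (if \<forall>c\<in>set v. c < 3 then csum f (map (\<lambda>c. c - 1) v) else 0)
    + (if \<forall>c\<in>set v. c < 3 then csum f (map (\<lambda>c. if c = 0 then 0 else 1) v) else 0)
    - (if \<forall>c\<in>set v. c < 2 then csum f v else 0)"
proof -
  have "csum (ssubst 2 (\<lambda>i. if i = 0 then svar 1 else svar 2) f) v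
      = (if \<forall>c\<in>set v. c = 1 \<or> c = 2 then csum f (map (\<lambda>c. c - 1) v) else 0)"
    by (rule csum_ssubst_letters) (auto simp: svar_def less_2_cases_iff)
  moreover have "csum (ssubst 2 (\<lambda>i. if i = 0 then sadd (svar 0) (svar 1) else svar 2) f) v
      = (if \<forall>c\<in>set v. c < 3 then csum f (map (\<lambda>c. c - 1) v) else 0)"
    by (rule csum_ssubst_letters) (auto simp: svar_def less_2_cases_iff numeral_3_eq_3 less_Suc_eq)
  moreover have "csum (ssubst 2 (\<lambda>i. if i = 0 then svar 0 else sadd (svar 1) (svar 2)) f) v
      = (if \<forall>c\<in>set v. c < 3 then csum f (map (\<lambda>c. if c = 0 then 0 else 1) v) else 0)"
    by (rule csum_ssubst_letters) (auto simp: svar_def less_2_cases_iff numeral_3_eq_3 less_Suc_eq)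
  moreover have "csum (ssubst 2 (\<lambda>i. if i = 0 then svar 0 else svar 1) f) v
      = (if \<forall>c\<in>set v. c < 2 then csum f (map (\<lambda>c. c) v) else 0)"
    by (rule csum_ssubst_letters) (auto simp: svar_def less_2_cases_iff)
  ultimately show ?thesis
    by (simp only: delta2_def csum_linear ser_apply map_ident)
qed

lemma csum_Nil [simp]: "csum f [] = 0"
  by (simp add: csum_def)

text \<open>Relabelling keeps the length of a word, so each of the four faces contributes one fixed
  scalar \<open>G\<close> times an alternating sum of three conditions on the letters; the twelve
  terms cancel in pairs.\<close>

lemma delta2_delta1:
  assumes f: "in_alph 2 f" "f [] = 0" and e: "tr_eq 2 f (delta1 g)"
  shows "tr_zero 3 (delta2 f)"
  unfolding tr_zero_iff
proof (intro conjI)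
  have letters: "ssubst 2 (\<lambda>i. if i = 0 then svar 1 else svar 2) f v
      = (if \<forall>c\<in>set v. c = 1 \<or> c = 2 then f (map (\<lambda>c. c - 1) v) else 0)"
    "ssubst 2 (\<lambda>i. if i = 0 then sadd (svar 0) (svar 1) else svar 2) f v
      = (if \<forall>c\<in>set v. c < 3 then f (map (\<lambda>c. c - 1) v) else 0)"
    "ssubst 2 (\<lambda>i. if i = 0 then svar 0 else sadd (svar 1) (svar 2)) f v
      = (if \<forall>c\<in>set v. c < 3 then f (map (\<lambda>c. if c = 0 then 0 else 1) v) else 0)"
    "ssubst 2 (\<lambda>i. if i = 0 then svar 0 else svar 1) f v
      = (if \<forall>c\<in>set v. c < 2 then f (map (\<lambda>c. c) v) else 0)" for v
    by (rule ssubst_letters; auto simp: svar_def less_2_cases_iff numeral_3_eq_3 less_Suc_eq)+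
  show "in_alph 3 (delta2 f)"
    unfolding in_alph_def
  proof (intro allI impI)
    fix v assume nz: "delta2 f v \<noteq> 0"
    have "\<forall>c\<in>set v. c < 3"
    proof (rule ccontr)
      assume n3: "\<not> (\<forall>c\<in>set v. c < 3)"
      then have n: "\<not> (\<forall>c\<in>set v. c = 1 \<or> c = 2)" "\<not> (\<forall>c\<in>set v. c < 2)" by force+
      have "delta2 f v = 0 - 0 + 0 - 0"
        unfolding delta2_def ser_apply letters by (simp only: n n3 if_False)
      then show False using nz by simp
    qed
    then show "set v \<subseteq> {..<3}" by auto
  qed
  show "delta2 f [] = 0" unfolding delta2_def ser_apply letters by (simp add: f)
  have c: "csum f w = csum (delta1 g) w" for w
  proof -
    have "csum (ssub f (delta1 g)) w = 0" using e by (simp add: tr_eq_def tr_zero_iff)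
    then show ?thesis by (simp add: csum_linear)
  qed
  show "csum (delta2 f) = szero"
  proof
    fix v :: "nat list"
    define G where "G = csum g (replicate (length v) 0)"
    have cm: "csum f (map r v) = (if \<forall>c\<in>set v. r c = 0 then G else 0)
        - (if \<forall>c\<in>set v. r c < 2 then G else 0) + (if \<forall>c\<in>set v. r c = 1 then G else 0)" for r
      by (simp only: c csum_delta1 length_map G_def set_map ball_simps)
    let ?p = "\<lambda>Q. if \<forall>c\<in>set v. Q c then G else 0"
    have t1: "(if \<forall>c\<in>set v. c = 1 \<or> c = 2 then csum f (map (\<lambda>c. c - 1) v) else 0)
        = ?p (\<lambda>c. c = 1) - ?p (\<lambda>c. c = 1 \<or> c = 2) + ?p (\<lambda>c. c = 2)"
    proof (cases "\<forall>c\<in>set v. c = 1 \<or> c = 2")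
      case True
      then have k: "(\<forall>c\<in>set v. c - 1 = 0) = (\<forall>c\<in>set v. c = 1)" "\<forall>c\<in>set v. c - 1 < 2"
        "(\<forall>c\<in>set v. c - 1 = 1) = (\<forall>c\<in>set v. c = 2)" by force+
      show ?thesis unfolding if_P[OF True] cm if_P[OF k(2)] k(1) k(3) by (rule refl)
    next
      case False
      then have "\<not> (\<forall>c\<in>set v. c = 1)" "\<not> (\<forall>c\<in>set v. c = 2)" by auto
      then show ?thesis using False by (simp only: if_False diff_0_right add_0_right)
    qed
    have t2: "(if \<forall>c\<in>set v. c < 3 then csum f (map (\<lambda>c. c - 1) v) else 0)
        = ?p (\<lambda>c. c < 2) - ?p (\<lambda>c. c < 3) + ?p (\<lambda>c. c = 2)"
    proof (cases "\<forall>c\<in>set v. c < 3")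
      case True
      then have k: "(\<forall>c\<in>set v. c - 1 = 0) = (\<forall>c\<in>set v. c < 2)" "\<forall>c\<in>set v. c - 1 < 2"
        "(\<forall>c\<in>set v. c - 1 = 1) = (\<forall>c\<in>set v. c = 2)" by force+
      show ?thesis unfolding if_P[OF True] cm if_P[OF k(2)] k(1) k(3) by (rule refl)
    next
      case False
      then have "\<not> (\<forall>c\<in>set v. c < 2)" "\<not> (\<forall>c\<in>set v. c = 2)" by force+
      then show ?thesis using False by (simp only: if_False diff_0_right add_0_right)
    qed
    have t3: "(if \<forall>c\<in>set v. c < 3 then csum f (map (\<lambda>c. if c = 0 then 0 else 1) v) else 0)
        = ?p (\<lambda>c. c = 0) - ?p (\<lambda>c. c < 3) + ?p (\<lambda>c. c = 1 \<or> c = 2)"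
    proof (cases "\<forall>c\<in>set v. c < 3")
      case True
      then have k: "(\<forall>c\<in>set v. (if c = 0 then 0 else 1) = (0::nat)) = (\<forall>c\<in>set v. c = 0)"
        "\<forall>c\<in>set v. (if c = 0 then 0 else 1) < (2::nat)"
        "(\<forall>c\<in>set v. (if c = 0 then 0 else 1) = (1::nat)) = (\<forall>c\<in>set v. c = 1 \<or> c = 2)" by force+
      show ?thesis unfolding if_P[OF True] cm if_P[OF k(2)] k(1) k(3) by (rule refl)
    next
      case False
      then have "\<not> (\<forall>c\<in>set v. c = 0)" "\<not> (\<forall>c\<in>set v. c = 1 \<or> c = 2)" by force+
      then show ?thesis using False by (simp only: if_False diff_0_right add_0_right)
    qed
    have t4: "(if \<forall>c\<in>set v. c < 2 then csum f v else 0)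
        = ?p (\<lambda>c. c = 0) - ?p (\<lambda>c. c < 2) + ?p (\<lambda>c. c = 1)"
    proof (cases "\<forall>c\<in>set v. c < 2")
      case True
      show ?thesis using cm[of "\<lambda>c. c"] unfolding map_ident if_P[OF True] .
    next
      case False
      then have "\<not> (\<forall>c\<in>set v. c = 0)" "\<not> (\<forall>c\<in>set v. c = 1)" by force+
      then show ?thesis using False by (simp only: if_False diff_0_right add_0_right)
    qed
    show "csum (delta2 f) v = szero v"
      unfolding csum_delta2 t1 t2 t3 t4 ser_apply by (simp only: algebra_simps add_0_left add_0_right)
  qed
qed

text \<open>The words with exactly one letter z determine the cyclic derivative of a with respect to y,
  and hence a up to powers of x.\<close>

lemma delta2_exact:
  fixes a :: "'k::field_char_0 ser"
  assumes a: "in_alph 2 a" "a [] = 0" and d: "tr_zero 3 (delta2 a)"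
  shows "\<exists>h \<in> tr1. tr_eq 2 a (delta1 h)"
proof -
  \<comment> \<open>The coefficients of y x^n in the cyclic sum, that is, the part of the trace that
    is linear in y.\<close>
  define cy where "cy n = csum a (1 # replicate n 0)" for n
  \<comment> \<open>On a word of length n containing both x and y, the cyclic sum of
    \<open>delta1 h\<close> is -n h(x^n). It has to equal \<open>cy (n - 1)\<close>, which forces
    the sign and the division by the length.\<close>
  define h :: "'k ser" where
    "h = (\<lambda>w. if set w \<subseteq> {0} \<and> w \<noteq> [] then - cy (length w - 1) / of_nat (length w) else 0)"
  have d0: "csum (delta2 a) v = 0" for v using d by (simp add: tr_zero_iff)
  \<comment> \<open>On a nonempty power of x the first face vanishes, and the signs of the other
    three leave one negative copy of the coefficient.\<close>
  have pure: "csum a (replicate n 0) = 0" for n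
  proof (cases n)
    case (Suc m)
    let ?v = "replicate n (0::nat)"
    have m: "map (\<lambda>c. if c = 0 then 0 else 1) ?v = ?v" "map (\<lambda>c. c - 1) ?v = ?v" by simp_all
    have cs: "\<not> (\<forall>c\<in>set ?v. c = 1 \<or> c = 2)" "\<forall>c\<in>set ?v. c < 3" "\<forall>c\<in>set ?v. c < 2"
      by (simp_all add: Suc)
    have "0 - csum a ?v + csum a ?v - csum a ?v = 0"
      using d0[of ?v] unfolding csum_delta2 m if_not_P[OF cs(1)] if_P[OF cs(2)] if_P[OF cs(3)] .
    then show ?thesis by simp
  qed simp
  \<comment> \<open>At the word z w the last face vanishes, merging x with y collapses the word to y
    x^n, and merging y with z returns y w. The first face contributes only when w is a power of y,
    which accounts for the correction term.\<close>
  have lin: "csum a (1 # w) = cy (length w) - (if \<forall>c\<in>set w. c = 1 then cy (length w) else 0)"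
    if w: "\<forall>c\<in>set w. c < 2" for w
  proof -
    have m: "map (\<lambda>c. c - 1) (2 # w) = 1 # replicate (length w) 0"
    proof -
      have "map (\<lambda>c. c - 1) w = replicate (length w) 0" using w by (induction w) auto
      then show ?thesis by simp
    qed
    have m': "map (\<lambda>c. if c = 0 then 0 else 1) (2 # w) = 1 # w"
      using w by (force intro: map_idI)
    have cs: "(\<forall>c\<in>set (2 # w). c = 1 \<or> c = 2) = (\<forall>c\<in>set w. c = 1)" "\<forall>c\<in>set (2 # w). c < 3"
      "\<not> (\<forall>c\<in>set (2 # w). c < 2)" using w by force+
    show ?thesis using d0[of "2 # w"] unfolding csum_delta2 m m' cs cy_def[symmetric]
      using cs by (simp add: algebra_simps split: if_splits)
  qed
  have hs: "csum h (replicate n 0) = (if n = 0 then 0 else - cy (n - 1))" for n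
    by (simp add: csum_def h_def)
  have "csum a v = csum (delta1 h) v" for v
  proof (cases "\<forall>c\<in>set v. c < 2")
    case False
    then have "a (rotate k v) = 0" for k
      using a(1) by (auto simp: in_alph_def) (metis set_rotate subsetD lessThan_iff)
    moreover have n: "\<not> (\<forall>c\<in>set v. c = 0)" "\<not> (\<forall>c\<in>set v. c = 1)" using False by force+
    ultimately show ?thesis
      unfolding csum_delta1 if_not_P[OF False] if_not_P[OF n(1)] if_not_P[OF n(2)] by (simp add: csum_def)
  next
    case True
    show ?thesis
    proof (cases "1 \<in> set v")
      case False
      then have v: "\<forall>c\<in>set v. c = 0" using True by (auto simp: less_2_cases_iff)
      then have "v = replicate (length v) 0" by (simp add: replicate_eqI)
      then have "csum a v = 0" using pure by metis
      moreover have "csum (delta1 h) v = 0"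
        using True v False by (cases v) (auto simp: csum_delta1)
      ultimately show ?thesis by simp
    next
      case one: True
      \<comment> \<open>A cyclic sum may be read from any starting letter, so the word is rotated to
        begin with y and \<open>lin\<close> applies.\<close>
      then obtain p q where pq: "v = p @ 1 # q" by (meson split_list)
      let ?w = "q @ p"
      have "csum a v = csum a (rotate (length p) v)" by (simp add: csum_rotate)
      also have "rotate (length p) v = 1 # ?w" by (simp add: pq rotate_append)
      also have "csum a (1 # ?w) = cy (length ?w) - (if \<forall>c\<in>set ?w. c = 1 then cy (length ?w) else 0)"
        using True by (intro lin) (auto simp: pq)
      also have "\<dots> = csum (delta1 h) v"
      proof -
        have n: "\<not> (\<forall>c\<in>set v. c = 0)" "(\<forall>c\<in>set v. c = 1) = (\<forall>c\<in>set ?w. c = 1)"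
          "length v = Suc (length ?w)" by (auto simp: pq)
        show ?thesis unfolding csum_delta1 if_not_P[OF n(1)] if_P[OF True] n(2,3) hs by simp
      qed
      finally show ?thesis .
    qed
  qed
  then have "csum (ssub a (delta1 h)) = szero" by (simp add: csum_linear fun_eq_iff)
  moreover have "h \<in> tr1" by (auto simp: tr1_def h_def in_alph_def)
  moreover have "in_alph 2 (ssub a (delta1 h))" by (intro in_alph_ssub a in_alph_delta1)
  moreover have "ssub a (delta1 h) [] = 0" using a by (simp add: delta1_Nil h_def)
  ultimately show ?thesis unfolding tr_eq_def tr_zero_iff by blast
qed

subsection \<open>The torsor\<close>

lemma ch_in_lie:
  assumes "(Sol :: ('k::field_char_0 ser \<Rightarrow> 'k ser) set) \<noteq> {}"
  shows "(ch :: 'k ser) \<in> lie 2"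
proof -
  obtain F :: "'k ser \<Rightarrow> 'k ser" and u where u: "u \<in> tder2" "\<forall>f\<in>lie 2. F f = texp u f"
    "F (sadd (svar 0) (svar 1)) = ch"
    using assms unfolding Sol_def by blast
  have "sadd (svar 0) (svar 1) \<in> (lie 2 :: 'k ser set)" by (intro lie_sadd lie_svar) simp_all
  then show ?thesis using u lie_texp by metis
qed

theorem theorem5p9:
  assumes "(Sol :: ('k::field_char_0 ser \<Rightarrow> 'k ser) set) \<noteq> {}"
  shows "(\<forall>F \<in> (Sol :: ('k ser \<Rightarrow> 'k ser) set). \<forall>u \<in> (kv2 :: ('k ser \<times> 'k ser) set).
            (F \<circ> texp u) \<in> Sol)
       \<and> (\<forall>F \<in> (Sol :: ('k ser \<Rightarrow> 'k ser) set). \<forall>u \<in> (kv2 :: ('k ser \<times> 'k ser) set).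
            (\<forall>f \<in> lie 2. F (texp u f) = F f) \<longrightarrow> (\<forall>f \<in> lie 2. texp u f = f))
       \<and> (\<forall>F \<in> (Sol :: ('k ser \<Rightarrow> 'k ser) set). \<forall>G \<in> Sol.
            \<exists>u \<in> (kv2 :: ('k ser \<times> 'k ser) set). \<forall>f \<in> lie 2. G f = F (texp u f))"
proof (intro conjI ballI impI)
  note ch = ch_in_lie[OF assms]
  let ?xy = "sadd (svar 0) (svar 1) :: 'k ser"
  have xy: "?xy \<in> lie 2" by (intro lie_sadd lie_svar) simp_all
  have lie: "in_alph 2 f \<and> f [] = 0" if "f \<in> lie 2" for f :: "'k ser"
    using that by (auto intro: in_alph_lie lie_Nil)
  {
    fix F :: "'k ser \<Rightarrow> 'k ser" and u :: "'k ser \<times> 'k ser"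
    assume F: "F \<in> Sol" and u: "u \<in> kv2"
    obtain v g where v: "v \<in> tder2" "\<forall>f\<in>lie 2. F f = texp v f" "F ?xy = ch"
      and g: "g \<in> tr1" "tr_eq 2 (jser v) (dtilde g)"
      using F unfolding Sol_def by blast
    have us: "u \<in> sder2" "u \<in> tder2" and uz: "tact u ?xy = szero" and ud: "tr_zero 3 (delta2 (sdiv u))"
      using u by (auto simp: kv2_def sder2_def)
    note tu = tpair_tder2[OF us(2)] and tv = tpair_tder2[OF v(1)]
    show "F \<circ> texp u \<in> Sol"
    proof -
      \<comment> \<open>The kernel condition puts div u in the image of \<open>delta1\<close>. As u
        kills this class modulo traces, phi(u) fixes it, so j(exp u) has the same potential
        h.\<close>
      obtain h where h: "h \<in> tr1" "tr_eq 2 (sdiv u) (delta1 h)"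
        using delta2_exact[OF in_alph_sdiv[OF tu] sdiv_Nil ud] by blast
      have "tr_eq 2 (jser u) (fev (tact u) phi (delta1 h))"
        unfolding jser_eq by (rule tr_eq_fev[OF tu h(2)])
      also have "tr_eq 2 \<dots> (delta1 h)"
        by (rule tr_eq_fev_invariant[OF tu tact_delta1[OF us(1)]]) (simp add: phi_def)
      finally have "tr_eq 2 (texp v (jser u)) (texp v (delta1 h))"
        unfolding texp_eq by (rule tr_eq_fev[OF tv])
      also have "tr_eq 2 \<dots> (dtilde h)"
        using v xy by (intro texp_delta1 tv) simp
      finally have ju: "tr_eq 2 (texp v (jser u)) (dtilde h)" .
      obtain w where w: "w \<in> tder2" "\<And>f. in_alph 2 f \<Longrightarrow> f [] = 0 \<Longrightarrow> texp w f = texp v (texp u f)"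
        "tr_zero 2 (ssub (jser w) (sadd (jser v) (texp v (jser u))))"
        using tder2_bch[OF ch v(1) us(2)] by blast
      have "tr_eq 2 (jser w) (sadd (jser v) (texp v (jser u)))" using w(3) by (simp only: tr_eq_def)
      also have "tr_eq 2 \<dots> (sadd (dtilde g) (dtilde h))" by (rule tr_eq_sadd[OF g(2) ju])
      finally have "tr_eq 2 (jser w) (dtilde (sadd g h))" by (simp only: dtilde_linear)
      moreover have "\<forall>f\<in>lie 2. (F \<circ> texp u) f = texp w f"
        using v(2) w(2) lie lie_texp[OF us(2)] by simp
      moreover have "(F \<circ> texp u) ?xy = ch"
      proof -
        have "texp u ?xy = ?xy"
          unfolding texp_eq fev_kernel[OF raising_tact[OF tu] uz] by (rule ext) simp
        then show ?thesis by (simp only: comp_apply v(3))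
      qed
      ultimately show ?thesis
        using w(1) tr1_sadd[OF g(1) h(1)] unfolding Sol_def by blast
    qed
    fix f :: "'k ser" assume inv: "\<forall>f\<in>lie 2. F (texp u f) = F f" and f: "f \<in> lie 2"
    \<comment> \<open>Freeness: on Lie series F is exp(v), which exp(-v) inverts.\<close>
    have "texp v (texp u f) = texp v f"
      using inv f v(2) lie_texp[OF us(2) f] by metis
    then show "texp u f = f" using texp_neg[OF tv] by metis
  }
  fix F G :: "'k ser \<Rightarrow> 'k ser" assume F: "F \<in> Sol" and G: "G \<in> Sol"
  obtain v g where v: "v \<in> tder2" "\<forall>f\<in>lie 2. F f = texp v f" "F ?xy = ch"
    and g: "g \<in> tr1" "tr_eq 2 (jser v) (dtilde g)"
    using F unfolding Sol_def by blast
  obtain w h where w: "w \<in> tder2" "\<forall>f\<in>lie 2. G f = texp w f" "G ?xy = ch"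
    and h: "h \<in> tr1" "tr_eq 2 (jser w) (dtilde h)"
    using G unfolding Sol_def by blast
  let ?v = "pscale (-1) v"
  note tv = tpair_tder2[OF v(1)] and tw = tpair_tder2[OF w(1)]
  note t_v = tpair_pscale[OF tv, of "-1"]
  \<comment> \<open>A generator of the only possible candidate, the inverse of F followed on the
    right by G, with exp(-v) as that inverse.\<close>
  obtain u where u: "u \<in> tder2" "\<And>f. in_alph 2 f \<Longrightarrow> f [] = 0 \<Longrightarrow> texp u f = texp ?v (texp w f)"
    "tr_zero 2 (ssub (jser u) (sadd (jser ?v) (texp ?v (jser w))))"
    using tder2_bch[OF ch tder2_pscale[OF v(1)] w(1)] by blast
  note tu = tpair_tder2[OF u(1)]
  have vv: "texp v (texp ?v f) = f" for f :: "'k ser"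
  proof -
    have "pscale (-1) ?v = v" by (simp add: pscale_def prod_eq_iff fun_eq_iff)
    then show ?thesis using texp_neg[OF t_v] by metis
  qed
  \<comment> \<open>F and G both send x + y to \<open>ch\<close>, so the quotient fixes x + y; a
    vector fixed by an exponential is killed by its generator.\<close>
  have "texp u ?xy = ?xy"
    using u(2) lie[OF xy] v w xy texp_neg[OF tv, of ?xy] by metis
  then have us: "u \<in> sder2"
    using u(1) exp_fixed_imp_kernel[OF raising_tact[OF tu]] by (simp add: sder2_def texp_eq)
  \<comment> \<open>By the cocycle identity j of the quotient is the inverse of F applied to j(G) -
    j(F), whose potential is h - g. Since F carries this \<open>delta1\<close> class to the
    \<open>dtilde\<close> class, the inverse of F brings it back.\<close>
  let ?d = "delta1 (ssub h g)"
  have "tr_eq 2 (jser u) (sadd (jser ?v) (texp ?v (jser w)))" using u(3) by (simp only: tr_eq_def)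
  also have "sadd (jser ?v) (texp ?v (jser w)) = texp ?v (ssub (jser w) (jser v))"
    by (rule ext) (simp add: jser_neg[OF tv] texp_linear[OF t_v])
  also have "tr_eq 2 (texp ?v (ssub (jser w) (jser v))) (texp ?v (dtilde (ssub h g)))"
    unfolding texp_eq dtilde_linear by (intro tr_eq_fev t_v tr_eq_ssub g h)
  also have "tr_eq 2 (texp ?v (dtilde (ssub h g))) (texp ?v (texp v ?d))"
    unfolding texp_eq[of ?v] using v xy by (intro tr_eq_fev t_v tr_eq_sym[OF texp_delta1] tv) simp
  also have "texp ?v (texp v ?d) = ?d" by (rule texp_neg[OF tv])
  finally have ju: "tr_eq 2 (jser u) ?d" .
  \<comment> \<open>Inverting phi(u) turns j(exp u) back into div u. The inverse also fixes the
    class of \<open>?d\<close>, which u kills modulo traces.\<close>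
  have "inverse phi * phi = (1 :: 'k fps)"
    by (rule inverse_mult_eq_1) (simp add: phi_def)
  then have s: "fev (tact u) (inverse phi) (jser u) = sdiv u"
    unfolding jser_eq using fev_mult[OF raising_tact[OF tu], of "inverse phi" phi "sdiv u"] by simp
  have "tr_eq 2 (sdiv u) (fev (tact u) (inverse phi) ?d)"
    using tr_eq_fev[OF tu ju, of "inverse phi"] unfolding s .
  also have "tr_eq 2 \<dots> ?d"
    by (rule tr_eq_fev_invariant[OF tu tact_delta1[OF us]]) (simp add: phi_def)
  finally have "tr_zero 3 (delta2 (sdiv u))"
    by (rule delta2_delta1[OF in_alph_sdiv[OF tu] sdiv_Nil])
  then have "u \<in> kv2" using us by (simp add: kv2_def)
  moreover have "G f = F (texp u f)" if f: "f \<in> lie 2" for f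
    using u(2) lie[OF f] v(2) w(2) f lie_texp[OF u(1) f] vv by metis
  ultimately show "\<exists>u\<in>kv2. \<forall>f\<in>lie 2. G f = F (texp u f)" by blast
qed

end
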